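(* Let (CS), (F) and (G) hold true and let $K$ satisfy the gap condition $$K\left(\frac{e^{\beta+\eta}(C_SM_se^{-\eta}+1)}{1-e^{-(\beta+\eta)}}+\frac{e^{\gamma-\eta}(C_SM_ce^{-\eta}+1)}{1-e^{-(\gamma-\eta)}}\right)<\frac14 .$$ Then, for each fixed $\xi$, the discrete Lyapunov–Perron map $J_{R,d}:\Omega_W\times BC^{\eta}(D^{2\alpha}_W)\to BC^{\eta}(D^{2\alpha}_W)$, $(W,\mathbb U)\mapsto J_{R,d}(W,\mathbb U,\xi)$, possesses a unique fixed point $\Gamma\in BC^{\eta}(D^{2\alpha}_W)$.
   Context: **Basic notation.** $\mathcal X=\mathbb R^n$, $\mathcal V=\mathbb R^d$, $A\in\mathbb R^{n\times n}$, $\alpha\in(1/3,1/2]$, $S(t)=e^{tA}$. $|\cdot|$ is the Euclidean/operator norm; $\|\cdot\|_\infty,\|\cdot\|_\alpha,\|\cdot\|_{2\alpha}$ are the sup norm and the Hölder semi-norms on $[0,1]$. $C^m_b$ is the space of $m$-times differentiable maps with bounded derivatives. $\mathbb Z^-=\{0,-1,-2,\dots\}$. $C_S$ stands for a constant which depends exclusively on the group $S$. **Rough paths.** An $\alpha$-Hölder rough path is $\mathbf W=(W,\mathbb W)$ with $W$ $\alpha$-Hölder and $\mathcal V$-valued, $\mathbb W$ a two-parameter $2\alpha$-Hölder $\mathcal V\otimes\mathcal V$-valued map, and $\mathbb W_{s,t}-\mathbb W_{s,u}-\mathbb W_{u,t}=W_{s,u}\otimes W_{u,t}$, where $W_{s,t}=W_t-W_s$.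 $D^{2\alpha}_W([0,1];E)$ is the space of controlled rough paths: pairs $(Y,Y')$ with $Y\in C^\alpha([0,1];E)$, $Y'\in C^\alpha([0,1];\mathcal L(\mathcal V,E))$ (the Gubinelli derivative) such that $R^Y_{s,t}=Y_t-Y_s-Y'_sW_{s,t}$ is $2\alpha$-Hölder. $\|Y,Y'\|_{\mathbf D^{2\alpha}_W}$ denotes its norm, $|Y_0|+|Y'_0|+\|Y'\|_\alpha+\|R^Y\|_{2\alpha}$ or, equivalently, $\|Y\|_\infty+\|Y'\|_\infty+\|Y'\|_\alpha+\|R^Y\|_{2\alpha}$. Rough integral: $\int_s^tY_r\,\mathrm d\mathbf W_r=\lim_{|\mathcal P|\to0}\sum_{[u,v]\in\mathcal P}(Y_uW_{u,v}+Y'_u\mathbb W_{u,v})$; in $\int S(t-r)Y_r\,\mathrm d\mathbf W_r$ the integrand $r\mapsto S(t-r)Y_r$ has Gubinelli derivative $S(t-r)Y'_r$. **Noise.** $(\Omega_W,\mathcal F_W,\mathbb P,(\Theta_t)_{t\in\mathbb R})$ is a metric dynamical system (measurable, measure-preserving flow) whose elements are paths $W:\mathbb R\to\mathbb R^d$, $W_0=0$, with a rough path lift $\mathbf W=(W,\mathbb W)$; $(\Theta_\tau W)_t=W_{t+\tau}-W_\tau$, $(\Theta_\tau\mathbb W)_{s,t}=\mathbb W_{s+\tau,t+\tau}$. $\mathbf W$ is a rough path cocycle: $\mathbf W_{s,s+t}(\omega)=\mathbf W_{0,t}(\Theta_s\omega)$ for $s\in\mathbb R$, $t\ge0$. Standing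 assumption: $\|W\|_\alpha$ and $\|\mathbb W\|_{2\alpha}$ are tempered from above ($Q>0$ is tempered from above if $\limsup_{t\to\pm\infty}\ln^+Q(\Theta_tW)/|t|=0$ for all $W$). **(F)** $F:\mathcal X\to\mathcal X$ is $C^1_b$ and Lipschitz continuous with $F(0)=DF(0)=0$. **(G)** $G:\mathcal X\to\mathcal L(\mathcal V,\mathcal X)$ is $C^3_b$ and Lipschitz continuous with $G(0)=DG(0)=D^2G(0)=0$. **(CS)** $A$ has eigenvalues on the imaginary axis and eigenvalues in $\{\mathrm{Re}\,z<0\}$, and these are all its eigenvalues; $\mathcal X=\mathcal X^c\oplus\mathcal X^s$ is the splitting into the corresponding generalized eigenspaces, with projections $P^c,P^s$, $P^c+P^s=\mathrm{Id}$, commuting with $S(t)$, $t\ge0$; $S^c(t)=e^{tA|_{\mathcal X^c}}$, $S^s(t)=e^{tA|_{\mathcal X^s}}$. There are exponents $-\beta<0\le\gamma<\beta$ and constants $M_c,M_s\ge1$ with $|S^c(t)x|\le M_ce^{\gamma t}|x|$ for $t\le0$, $x\in\mathcal X^c$, and $|S^s(t)x|\le M_se^{-\beta t}|x|$ for $t\ge0$, $x\in\mathcal X^s$. **Cut-off.** $f:\mathbb R_+\to[0,1]$ is a $C^3_b$ Lipschitz function with $f=1$ on $[0,1/2]$, $f=0$ on $[1,\infty)$. For $R>0$ and $(Y,Y')\in D^{2\alpha}_W([0,1];\mathcal X)$: $\chi_R(Y)=Y f(\|Y,Y'\|_{\mathbf D^{2\alpha}_W}/R)$ with Gubinelli derivative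 $Y' f(\|Y,Y'\|_{\mathbf D^{2\alpha}_W}/R)$, $F_R(Y)(t)=F(\chi_R(Y)_t)$, $G_R(Y)(t)=G(\chi_R(Y)_t)$ with Gubinelli derivative $DG(\chi_R(Y))(\chi_R(Y))'$. Let $T_R(W,Y,Y')[t]=\int_0^tS(t-r)F_R(Y)(r)\,\mathrm dr+\int_0^tS(t-r)G_R(Y)(r)\,\mathrm d\mathbf W_r$, with Gubinelli derivative $G_R(Y)$. Let $C_1=C[|A|,F]$, $C_2=C[|A|,G]$ be the constants in the estimate (for $R\le1$) that $(Y,Y')\mapsto(T_R(W,Y,Y'),G_R(Y))$ is Lipschitz in the $\mathbf D^{2\alpha}_W$-norm with constant $C_1R+C_2R(1+\|W\|_\alpha)(\|W\|_\alpha+\|\mathbb W\|_{2\alpha})$. For the fixed $K>0$ of the claim, $\widetilde R(W)$ is the unique solution of $C_1\widetilde R(W)+C_2\widetilde R(W)(1+\|W\|_\alpha)(\|W\|_\alpha+\|\mathbb W\|_{2\alpha})=K$ and $R(W)=\min\{\widetilde R(W),1\}$. The cut-off is used with $R=R(W)$; the dependence on $W$ is suppressed in the notation. **Lyapunov–Perron map.** Let $-\beta<\eta<0$. $BC^\eta(D^{2\alpha}_W)$ is the space of sequences $\mathbb U=((U^{i-1},(U^{i-1})'))_{i\in\mathbb Z^-}$ of $\mathcal X$-valued controlled rough paths on $[0,1]$ with $U^{i-1}_0=U^{i-2}_1$ and $$\|\mathbb U\|_{BC^\eta(D^{2\alpha}_W)}:=\sup_{i\in\mathbb Z^-}e^{-\eta(i-1)}\|U^{i-1},(U^{i-1})'\|_{\mathbf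 D^{2\alpha}_W([0,1];\mathcal X)}<\infty.$$ For $\xi\in\mathcal X$, $\xi^c=P^c\xi$, $i\in\mathbb Z^-$, $t\in[0,1]$, $$\begin{aligned}J^1_{R,d}(W,\mathbb U,\xi)[i-1,t]&=S^c(t+i-1)\xi^c\\&-\sum_{k=0}^{i+1}S^c(t+i-1-k)\Big(\int_0^1S^c(1-r)P^cF_R(U^{k-1})(r)\,\mathrm dr+\int_0^1S^c(1-r)P^cG_R(U^{k-1})(r)\,\mathrm d\Theta_{k-1}\mathbf W_r\Big)\\&-\int_t^1S^c(t-r)P^cF_R(U^{i-1})(r)\,\mathrm dr-\int_t^1S^c(t-r)P^cG_R(U^{i-1})(r)\,\mathrm d\Theta_{i-1}\mathbf W_r\\&+\sum_{k=-\infty}^{i-1}S^s(t+i-1-k)\Big(\int_0^1S^s(1-r)P^sF_R(U^{k-1})(r)\,\mathrm dr+\int_0^1S^s(1-r)P^sG_R(U^{k-1})(r)\,\mathrm d\Theta_{k-1}\mathbf W_r\Big)\\&+\int_0^tS^s(t-r)P^sF_R(U^{i-1})(r)\,\mathrm dr+\int_0^tS^s(t-r)P^sG_R(U^{i-1})(r)\,\mathrm d\Theta_{i-1}\mathbf W_r,\end{aligned}$$ where $\sum_{k=0}^{i+1}$ runs over $k=0,-1,\dots,i+1$ (empty for $i=0$); $J^2_{R,d}(W,\mathbb U,\xi)[i-1,\cdot]$ is the Gubinelli derivative of $J^1_{R,d}(W,\mathbb U,\xi)[i-1,\cdot]$, and $J_{R,d}=(J^1_{R,d},J^2_{R,d})$.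 A fixed point is a sequence $\Gamma=\Gamma(\xi^c,W)$ with $J_{R,d}(W,\Gamma,\xi)=\Gamma$. *)

theory Defs
  imports "HOL-Probability.Probability"
begin

section \<open>Linear part\<close>

definition sgrp :: "real^'n^'n \<Rightarrow> real \<Rightarrow> (real^'n) \<Rightarrow>\<^sub>L (real^'n)" where
  "sgrp A t = Blinfun (\<lambda>x. \<Sum>k. (t ^ k / fact k) *\<^sub>R ((\<lambda>y. A *v y) ^^ k) x)"

definition complexify :: "real^'n \<Rightarrow> complex^'n" where
  "complexify x = (\<chi> i. complex_of_real (x $ i))"

definition eigval :: "real^'n^'n \<Rightarrow> complex \<Rightarrow> bool" where
  "eigval A l \<longleftrightarrow> (\<exists>v. v \<noteq> 0 \<and> map_matrix complex_of_real A *v v = l *s v)"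

definition gen_eigenspace :: "real^'n^'n \<Rightarrow> complex \<Rightarrow> (complex^'n) set" where
  "gen_eigenspace A l =
     {v. \<exists>k. ((\<lambda>w. map_matrix complex_of_real A *v w - l *s w) ^^ k) v = 0}"

text \<open>The real vectors in the complex span of the generalized eigenspaces belonging to
  spectral values in \<open>\<Lambda>\<close> (only eigenvalues contribute: otherwise the generalized
  eigenspace is trivial).\<close>

definition spectral_space :: "real^'n^'n \<Rightarrow> complex set \<Rightarrow> (real^'n) set" where
  "spectral_space A \<Lambda> = {x. complexify x \<in> vec.span (\<Union>l\<in>\<Lambda>. gen_eigenspace A l)}"

definition Xc :: "real^'n^'n \<Rightarrow> (real^'n) set" where
  "Xc A = spectral_space A {l. Re l = 0}"

definition Xs :: "real^'n^'n \<Rightarrow> (real^'n) set" where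
  "Xs A = spectral_space A {l. Re l < 0}"

definition direct_decomp :: "(real^'n) set \<Rightarrow> (real^'n) set \<Rightarrow> bool" where
  "direct_decomp U V \<longleftrightarrow> U \<inter> V = {0} \<and> (\<forall>x. \<exists>u\<in>U. \<exists>v\<in>V. x = u + v)"

definition proj_along :: "(real^'n) set \<Rightarrow> (real^'n) set \<Rightarrow> (real^'n) \<Rightarrow>\<^sub>L (real^'n)" where
  "proj_along U V = Blinfun (\<lambda>x. THE u. u \<in> U \<and> x - u \<in> V)"

definition Pc :: "real^'n^'n \<Rightarrow> (real^'n) \<Rightarrow>\<^sub>L (real^'n)" where
  "Pc A = proj_along (Xc A) (Xs A)"

definition Ps :: "real^'n^'n \<Rightarrow> (real^'n) \<Rightarrow>\<^sub>L (real^'n)" where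
  "Ps A = proj_along (Xs A) (Xc A)"

text \<open>\<open>S\<^sup>c(t)\<close> and \<open>S\<^sup>s(t)\<close> are the restrictions of \<open>S(t) = sgrp A t\<close> to \<open>Xc A\<close> and \<open>Xs A\<close>;
  below \<open>sgrp A t\<close> is therefore written for all three, applied to vectors of the
  respective subspace.\<close>

definition CS :: "real^'n^'n \<Rightarrow> real \<Rightarrow> real \<Rightarrow> real \<Rightarrow> real \<Rightarrow> bool" where
  "CS A \<beta> \<gamma> Mc Ms \<longleftrightarrow>
     (\<exists>l. eigval A l \<and> Re l = 0) \<and> (\<exists>l. eigval A l \<and> Re l < 0) \<and>
     (\<forall>l. eigval A l \<longrightarrow> Re l = 0 \<or> Re l < 0) \<and>
     direct_decomp (Xc A) (Xs A) \<and>
     (\<forall>t\<ge>0. Pc A o\<^sub>L sgrp A t = sgrp A t o\<^sub>L Pc A \<and> Ps A o\<^sub>L sgrp A t = sgrp A t o\<^sub>L Ps A) \<and>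
     - \<beta> < 0 \<and> 0 \<le> \<gamma> \<and> \<gamma> < \<beta> \<and> Mc \<ge> 1 \<and> Ms \<ge> 1 \<and>
     (\<forall>t\<le>0. \<forall>x\<in>Xc A. norm (sgrp A t x) \<le> Mc * exp (\<gamma> * t) * norm x) \<and>
     (\<forall>t\<ge>0. \<forall>x\<in>Xs A. norm (sgrp A t x) \<le> Ms * exp (- \<beta> * t) * norm x)"


section \<open>Smooth maps\<close>

definition Dop :: "('a::real_normed_vector \<Rightarrow> 'b::real_normed_vector) \<Rightarrow> 'a \<Rightarrow> 'a \<Rightarrow>\<^sub>L 'b" where
  "Dop g x = Blinfun (frechet_derivative g (at x))"

definition C1b :: "('a::real_normed_vector \<Rightarrow> 'b::real_normed_vector) \<Rightarrow> bool" where
  "C1b g \<longleftrightarrow> (\<forall>x. g differentiable (at x)) \<and> bounded (range (Dop g))"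

definition C3b :: "('a::real_normed_vector \<Rightarrow> 'b::real_normed_vector) \<Rightarrow> bool" where
  "C3b g \<longleftrightarrow> C1b g \<and> C1b (Dop g) \<and> C1b (Dop (Dop g))"

definition cond_F :: "(real^'n \<Rightarrow> real^'n) \<Rightarrow> bool" where
  "cond_F F \<longleftrightarrow> C1b F \<and> (\<exists>L. L-lipschitz_on UNIV F) \<and> F 0 = 0 \<and> Dop F 0 = 0"

definition cond_G :: "(real^'n \<Rightarrow> (real^'d) \<Rightarrow>\<^sub>L (real^'n)) \<Rightarrow> bool" where
  "cond_G G \<longleftrightarrow> C3b G \<and> (\<exists>L. L-lipschitz_on UNIV G) \<and>
     G 0 = 0 \<and> Dop G 0 = 0 \<and> Dop (Dop G) 0 = 0"

text \<open>The cut-off profile lives on the half-line, hence derivatives within \<open>{0..}\<close>.\<close>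

definition cutoff_fun :: "(real \<Rightarrow> real) \<Rightarrow> bool" where
  "cutoff_fun f \<longleftrightarrow>
     (\<forall>x\<ge>0. 0 \<le> f x \<and> f x \<le> 1) \<and>
     (\<forall>x\<in>{0..1/2}. f x = 1) \<and> (\<forall>x\<ge>1. f x = 0) \<and>
     (\<exists>L. L-lipschitz_on {0..} f) \<and>
     (\<exists>f1 f2 f3. (\<forall>x\<ge>0. (f has_real_derivative f1 x) (at x within {0..}) \<and>
                        (f1 has_real_derivative f2 x) (at x within {0..}) \<and>
                        (f2 has_real_derivative f3 x) (at x within {0..})) \<and>
        bounded (f1 ` {0..}) \<and> bounded (f2 ` {0..}) \<and> bounded (f3 ` {0..}))"


section \<open>Rough paths and controlled rough paths\<close>

definition hoelder2_on :: "real \<Rightarrow> real \<Rightarrow> real \<Rightarrow> (real \<Rightarrow> real \<Rightarrow> 'e::real_normed_vector) \<Rightarrow> bool" where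
  "hoelder2_on a b \<alpha> g \<longleftrightarrow>
     (\<exists>C. \<forall>s t. a \<le> s \<and> s < t \<and> t \<le> b \<longrightarrow> norm (g s t) \<le> C * (t - s) powr \<alpha>)"

definition hoelder_on :: "real \<Rightarrow> real \<Rightarrow> real \<Rightarrow> (real \<Rightarrow> 'e::real_normed_vector) \<Rightarrow> bool" where
  "hoelder_on a b \<alpha> g \<longleftrightarrow> hoelder2_on a b \<alpha> (\<lambda>s t. g t - g s)"

text \<open>Hoelder semi-norms and the sup norm on \<open>[0,1]\<close>; only meaningful when finite.\<close>

definition hnorm2 :: "real \<Rightarrow> (real \<Rightarrow> real \<Rightarrow> 'e::real_normed_vector) \<Rightarrow> real" where
  "hnorm2 \<alpha> g = (SUP (s, t)\<in>{(s, t). 0 \<le> s \<and> s < t \<and> t \<le> 1}. norm (g s t) / (t - s) powr \<alpha>)"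

definition hnorm :: "real \<Rightarrow> (real \<Rightarrow> 'e::real_normed_vector) \<Rightarrow> real" where
  "hnorm \<alpha> g = hnorm2 \<alpha> (\<lambda>s t. g t - g s)"

definition snorm :: "(real \<Rightarrow> 'e::real_normed_vector) \<Rightarrow> real" where
  "snorm g = (SUP t\<in>{0..1}. norm (g t))"

text \<open>\<open>\<V> \<otimes> \<V>\<close> is modelled by matrices, \<open>(a \<otimes> b)\<^sub>i\<^sub>j = a\<^sub>i b\<^sub>j\<close>. The second level of a rough path
  is only relevant on \<open>s \<le> t\<close>.\<close>

definition tensor :: "real^'d \<Rightarrow> real^'d \<Rightarrow> real^'d^'d" where
  "tensor a b = (\<chi> i j. a $ i * b $ j)"

type_synonym 'd rpath = "(real \<Rightarrow> real^'d) \<times> (real \<Rightarrow> real \<Rightarrow> real^'d^'d)"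

definition rough_path_on :: "real \<Rightarrow> real \<Rightarrow> real \<Rightarrow> 'd::finite rpath \<Rightarrow> bool" where
  "rough_path_on a b \<alpha> \<W> \<longleftrightarrow> (case \<W> of (W, WW) \<Rightarrow>
     hoelder_on a b \<alpha> W \<and> hoelder2_on a b (2 * \<alpha>) WW \<and>
     (\<forall>s u t. a \<le> s \<and> s \<le> u \<and> u \<le> t \<and> t \<le> b \<longrightarrow>
        WW s t - WW s u - WW u t = tensor (W u - W s) (W t - W u)))"

type_synonym ('d, 'e) cpath = "(real \<Rightarrow> 'e) \<times> (real \<Rightarrow> (real^'d) \<Rightarrow>\<^sub>L 'e)"

definition remainder ::
    "(real \<Rightarrow> real^'d) \<Rightarrow> ('d::finite, 'e::real_normed_vector) cpath \<Rightarrow> real \<Rightarrow> real \<Rightarrow> 'e" where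
  "remainder W U s t = fst U t - fst U s - snd U s (W t - W s)"

text \<open>The controlled rough path space on \<open>[0,1]\<close>; components are extensional so that equality
  of elements is equality on \<open>[0,1]\<close>.\<close>

definition ctrl :: "real \<Rightarrow> (real \<Rightarrow> real^'d) \<Rightarrow> ('d::finite, 'e::real_normed_vector) cpath set" where
  "ctrl \<alpha> W = {U. fst U \<in> extensional {0..1} \<and> snd U \<in> extensional {0..1} \<and>
     hoelder_on 0 1 \<alpha> (fst U) \<and> hoelder_on 0 1 \<alpha> (snd U) \<and>
     hoelder2_on 0 1 (2 * \<alpha>) (remainder W U)}"

definition dnorm ::
    "real \<Rightarrow> (real \<Rightarrow> real^'d) \<Rightarrow> ('d::finite, 'e::real_normed_vector) cpath \<Rightarrow> real" where
  "dnorm \<alpha> W U = snorm (fst U) + snorm (snd U) + hnorm \<alpha> (snd U) + hnorm2 (2 * \<alpha>) (remainder W U)"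

definition cdiff :: "('d::finite, 'e::real_normed_vector) cpath \<Rightarrow> ('d, 'e) cpath \<Rightarrow> ('d, 'e) cpath" where
  "cdiff U V = (\<lambda>t. fst U t - fst V t, \<lambda>t. snd U t - snd V t)"


section \<open>Rough integral\<close>

text \<open>Identification of \<open>\<L>(\<V>, \<L>(\<V>, E))\<close> with \<open>\<L>(\<V> \<otimes> \<V>, E)\<close>. The outer argument pairs with the
  first tensor factor: with \<open>Y\<^sub>r \<approx> Y\<^sub>u + Y'\<^sub>u W\<^sub>u\<^sub>,\<^sub>r\<close> and \<open>\<W>\<^sub>u\<^sub>,\<^sub>v = \<integral> W\<^sub>u\<^sub>,\<^sub>r \<otimes> dW\<^sub>r\<close>, the second-order
  term of \<open>\<integral> Y dW\<close> is \<open>tapply Y'\<^sub>u \<W>\<^sub>u\<^sub>,\<^sub>v\<close>.\<close>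

definition tapply ::
    "((real^'d) \<Rightarrow>\<^sub>L ((real^'d) \<Rightarrow>\<^sub>L 'e::real_normed_vector)) \<Rightarrow> real^'d^'d \<Rightarrow> 'e" where
  "tapply Z m = (\<Sum>i\<in>UNIV. \<Sum>j\<in>UNIV. (m $ i $ j) *\<^sub>R Z (axis i 1) (axis j 1))"

definition is_partition :: "real \<Rightarrow> real \<Rightarrow> nat \<Rightarrow> (nat \<Rightarrow> real) \<Rightarrow> bool" where
  "is_partition s t N p \<longleftrightarrow> p 0 = s \<and> p N = t \<and> (\<forall>i<N. p i < p (Suc i))"

definition has_rough_integral ::
    "('d::finite, (real^'d) \<Rightarrow>\<^sub>L 'e::real_normed_vector) cpath \<Rightarrow> 'd rpath \<Rightarrow> real \<Rightarrow> real \<Rightarrow> 'e \<Rightarrow> bool" where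
  "has_rough_integral Y \<W> s t I \<longleftrightarrow>
     (\<forall>\<epsilon>>0. \<exists>\<delta>>0. \<forall>N p. is_partition s t N p \<and> (\<forall>i<N. p (Suc i) - p i < \<delta>) \<longrightarrow>
        norm ((\<Sum>i<N. fst Y (p i) (fst \<W> (p (Suc i)) - fst \<W> (p i)) +
                      tapply (snd Y (p i)) (snd \<W> (p i) (p (Suc i)))) - I) < \<epsilon>)"

definition rough_integral ::
    "('d::finite, (real^'d) \<Rightarrow>\<^sub>L 'e::real_normed_vector) cpath \<Rightarrow> 'd rpath \<Rightarrow> real \<Rightarrow> real \<Rightarrow> 'e" where
  "rough_integral Y \<W> s t = (THE I. has_rough_integral Y \<W> s t I)"


section \<open>Noise\<close>

definition shift :: "real \<Rightarrow> (real \<Rightarrow> real^'d) \<Rightarrow> real \<Rightarrow> real^'d" where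
  "shift \<tau> W = (\<lambda>t. W (t + \<tau>) - W \<tau>)"

definition shift_rp :: "real \<Rightarrow> 'd::finite rpath \<Rightarrow> 'd rpath" where
  "shift_rp \<tau> \<W> = (shift \<tau> (fst \<W>), \<lambda>s t. snd \<W> (s + \<tau>) (t + \<tau>))"

definition tempered_above :: "(real \<Rightarrow> real^'d) set \<Rightarrow> ((real \<Rightarrow> real^'d) \<Rightarrow> real) \<Rightarrow> bool" where
  "tempered_above \<Omega> Q \<longleftrightarrow> (\<forall>W\<in>\<Omega>.
     Limsup at_top (\<lambda>t. ereal (ln (max 1 (Q (shift t W))) / \<bar>t\<bar>)) = 0 \<and>
     Limsup at_bot (\<lambda>t. ereal (ln (max 1 (Q (shift t W))) / \<bar>t\<bar>)) = 0)"

text \<open>\<open>M\<close> is a probability space of paths, \<open>lift\<close> maps a path \<open>W\<close> to its second level. The flow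
  laws \<open>\<Theta>\<^sub>0 = id\<close>, \<open>\<Theta>\<^sub>s\<^sub>+\<^sub>t = \<Theta>\<^sub>s \<circ> \<Theta>\<^sub>t\<close> hold for \<open>shift\<close> on paths with \<open>W 0 = 0\<close>, and the first level of
  the cocycle identity is \<open>W\<^sub>s\<^sub>,\<^sub>s\<^sub>+\<^sub>t = (\<Theta>\<^sub>s W)\<^sub>t\<close>, which is the definition of \<open>shift\<close>.\<close>

definition rough_noise ::
    "real \<Rightarrow> (real \<Rightarrow> real^'d) measure \<Rightarrow> ((real \<Rightarrow> real^'d) \<Rightarrow> real \<Rightarrow> real \<Rightarrow> real^'d^'d::finite) \<Rightarrow> bool" where
  "rough_noise \<alpha> M lift \<longleftrightarrow>
     prob_space M \<and> (\<forall>W\<in>space M. W 0 = 0) \<and>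
     (\<lambda>(t, W). shift t W) \<in> borel \<Otimes>\<^sub>M M \<rightarrow>\<^sub>M M \<and>
     (\<forall>t. distr M M (shift t) = M) \<and>
     (\<forall>W\<in>space M. \<forall>a b. rough_path_on a b \<alpha> (W, lift W)) \<and>
     (\<forall>W\<in>space M. \<forall>s. \<forall>t\<ge>0. lift W s (s + t) = lift (shift s W) 0 t) \<and>
     tempered_above (space M) (\<lambda>W. hnorm \<alpha> W) \<and>
     tempered_above (space M) (\<lambda>W. hnorm2 (2 * \<alpha>) (lift W))"


section \<open>Cut-off nonlinearities\<close>

definition chi ::
    "(real \<Rightarrow> real) \<Rightarrow> real \<Rightarrow> (real \<Rightarrow> real^'d) \<Rightarrow> real \<Rightarrow> ('d::finite, real^'n) cpath \<Rightarrow> ('d, real^'n) cpath" where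
  "chi f \<alpha> W R U = (\<lambda>t. f (dnorm \<alpha> W U / R) *\<^sub>R fst U t, \<lambda>t. f (dnorm \<alpha> W U / R) *\<^sub>R snd U t)"

definition F_cut ::
    "(real^'n \<Rightarrow> real^'n) \<Rightarrow> (real \<Rightarrow> real) \<Rightarrow> real \<Rightarrow> (real \<Rightarrow> real^'d) \<Rightarrow> real \<Rightarrow>
     ('d::finite, real^'n) cpath \<Rightarrow> real \<Rightarrow> real^'n" where
  "F_cut F f \<alpha> W R U = (\<lambda>t. F (fst (chi f \<alpha> W R U) t))"

definition G_cut ::
    "(real^'n \<Rightarrow> (real^'d) \<Rightarrow>\<^sub>L (real^'n)) \<Rightarrow> (real \<Rightarrow> real) \<Rightarrow> real \<Rightarrow> (real \<Rightarrow> real^'d) \<Rightarrow> real \<Rightarrow>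
     ('d::finite, real^'n) cpath \<Rightarrow> ('d, (real^'d) \<Rightarrow>\<^sub>L (real^'n)) cpath" where
  "G_cut G f \<alpha> W R U =
     (\<lambda>t. G (fst (chi f \<alpha> W R U) t),
      \<lambda>t. Dop G (fst (chi f \<alpha> W R U) t) o\<^sub>L snd (chi f \<alpha> W R U) t)"

text \<open>The path \<open>r \<mapsto> T(r) Y\<^sub>r\<close> with Gubinelli derivative \<open>r \<mapsto> T(r) Y'\<^sub>r\<close>.\<close>

definition op_mult ::
    "(real \<Rightarrow> (real^'n) \<Rightarrow>\<^sub>L (real^'n)) \<Rightarrow> ('d::finite, (real^'d) \<Rightarrow>\<^sub>L (real^'n)) cpath \<Rightarrow>
     ('d, (real^'d) \<Rightarrow>\<^sub>L (real^'n)) cpath" where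
  "op_mult T Y = (\<lambda>r. T r o\<^sub>L fst Y r, \<lambda>r. Blinfun (\<lambda>v. T r o\<^sub>L snd Y r v))"

text \<open>\<open>\<integral>\<^sub>a\<^sup>b S(\<tau>-r) P F\<^sub>R(U)(r) dr + \<integral>\<^sub>a\<^sup>b S(\<tau>-r) P G\<^sub>R(U)(r) d\<W>\<^sub>r\<close>\<close>

definition conv ::
    "real^'n^'n \<Rightarrow> (real^'n \<Rightarrow> real^'n) \<Rightarrow> (real^'n \<Rightarrow> (real^'d) \<Rightarrow>\<^sub>L (real^'n)) \<Rightarrow> (real \<Rightarrow> real) \<Rightarrow> real \<Rightarrow>
     'd::finite rpath \<Rightarrow> real \<Rightarrow> (real^'n) \<Rightarrow>\<^sub>L (real^'n) \<Rightarrow> ('d, real^'n) cpath \<Rightarrow>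
     real \<Rightarrow> real \<Rightarrow> real \<Rightarrow> real^'n" where
  "conv A F G f \<alpha> \<W> R P U a b \<tau> =
     integral {a..b} (\<lambda>r. (sgrp A (\<tau> - r) o\<^sub>L P) (F_cut F f \<alpha> (fst \<W>) R U r)) +
     rough_integral (op_mult (\<lambda>r. sgrp A (\<tau> - r) o\<^sub>L P) (G_cut G f \<alpha> (fst \<W>) R U)) \<W> a b"

definition T_cut ::
    "real^'n^'n \<Rightarrow> (real^'n \<Rightarrow> real^'n) \<Rightarrow> (real^'n \<Rightarrow> (real^'d) \<Rightarrow>\<^sub>L (real^'n)) \<Rightarrow> (real \<Rightarrow> real) \<Rightarrow> real \<Rightarrow>
     'd::finite rpath \<Rightarrow> real \<Rightarrow> ('d, real^'n) cpath \<Rightarrow> ('d, real^'n) cpath" where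
  "T_cut A F G f \<alpha> \<W> R U =
     (\<lambda>t\<in>{0..1}. conv A F G f \<alpha> \<W> R id_blinfun U 0 t t,
      \<lambda>t\<in>{0..1}. fst (G_cut G f \<alpha> (fst \<W>) R U) t)"

text \<open>\<open>C1\<close>, \<open>C2\<close> are constants for the Lipschitz estimate of \<open>T\<^sub>R\<close>, uniformly in \<open>R \<le> 1\<close> and in
  the driving rough path.\<close>

definition T_cut_estimate ::
    "real^'n^'n \<Rightarrow> (real^'n \<Rightarrow> real^'n) \<Rightarrow> (real^'n \<Rightarrow> (real^'d::finite) \<Rightarrow>\<^sub>L (real^'n)) \<Rightarrow> (real \<Rightarrow> real) \<Rightarrow> real \<Rightarrow>
     real \<Rightarrow> real \<Rightarrow> bool" where
  "T_cut_estimate A F G f \<alpha> C1 C2 \<longleftrightarrow>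
     (\<forall>\<W> R. rough_path_on 0 1 \<alpha> \<W> \<and> 0 < R \<and> R \<le> 1 \<longrightarrow>
       (\<forall>U\<in>ctrl \<alpha> (fst \<W>). \<forall>V\<in>ctrl \<alpha> (fst \<W>).
          dnorm \<alpha> (fst \<W>) (cdiff (T_cut A F G f \<alpha> \<W> R U) (T_cut A F G f \<alpha> \<W> R V))
          \<le> (C1 * R + C2 * R * (1 + hnorm \<alpha> (fst \<W>)) * (hnorm \<alpha> (fst \<W>) + hnorm2 (2 * \<alpha>) (snd \<W>)))
             * dnorm \<alpha> (fst \<W>) (cdiff U V)))"

definition R_tilde :: "real \<Rightarrow> real \<Rightarrow> real \<Rightarrow> real \<Rightarrow> 'd::finite rpath \<Rightarrow> real" where
  "R_tilde \<alpha> C1 C2 K \<W> = (THE R.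
     C1 * R + C2 * R * (1 + hnorm \<alpha> (fst \<W>)) * (hnorm \<alpha> (fst \<W>) + hnorm2 (2 * \<alpha>) (snd \<W>)) = K)"

definition R_cut :: "real \<Rightarrow> real \<Rightarrow> real \<Rightarrow> real \<Rightarrow> 'd::finite rpath \<Rightarrow> real" where
  "R_cut \<alpha> C1 C2 K \<W> = min (R_tilde \<alpha> C1 C2 K \<W>) 1"


section \<open>Lyapunov-Perron map\<close>

text \<open>A sequence is indexed by \<open>j = i - 1 \<in> {-1, -2, \<dots>}\<close>; its entry \<open>U j\<close> describes the path on
  \<open>[j, j + 1]\<close> and is thus controlled by \<open>\<Theta>\<^sub>j W\<close>.\<close>

definition BC ::
    "real \<Rightarrow> real \<Rightarrow> (real \<Rightarrow> real^'d) \<Rightarrow> (int \<Rightarrow> ('d::finite, real^'n) cpath) set" where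
  "BC \<alpha> \<eta> W = {U. U \<in> extensional {..-1} \<and>
     (\<forall>i\<le>0. U (i - 1) \<in> ctrl \<alpha> (shift (of_int (i - 1)) W)) \<and>
     (\<forall>i\<le>0. fst (U (i - 1)) 0 = fst (U (i - 2)) 1) \<and>
     bdd_above ((\<lambda>i. exp (- \<eta> * of_int (i - 1)) * dnorm \<alpha> (shift (of_int (i - 1)) W) (U (i - 1))) ` {..0})}"

text \<open>The block \<open>[k-1, k]\<close> is driven by \<open>\<Theta>\<^sub>k\<^sub>-\<^sub>1\<W>\<close> and truncated at the radius \<open>R(\<Theta>\<^sub>k\<^sub>-\<^sub>1\<W>)\<close>;
  \<open>Rad\<close> is the random radius \<open>\<W> \<mapsto> R(\<W>)\<close>.\<close>

definition block ::
    "real^'n^'n \<Rightarrow> (real^'n \<Rightarrow> real^'n) \<Rightarrow> (real^'n \<Rightarrow> (real^'d) \<Rightarrow>\<^sub>L (real^'n)) \<Rightarrow> (real \<Rightarrow> real) \<Rightarrow> real \<Rightarrow>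
     ('d::finite rpath \<Rightarrow> real) \<Rightarrow> 'd rpath \<Rightarrow> (int \<Rightarrow> ('d, real^'n) cpath) \<Rightarrow>
     (real^'n) \<Rightarrow>\<^sub>L (real^'n) \<Rightarrow> int \<Rightarrow> real \<Rightarrow> real \<Rightarrow> real \<Rightarrow> real^'n" where
  "block A F G f \<alpha> Rad \<W> U P k a b \<tau> =
     (let \<Z> = shift_rp (of_int (k - 1)) \<W> in conv A F G f \<alpha> \<Z> (Rad \<Z>) P (U (k - 1)) a b \<tau>)"

definition J1 ::
    "real^'n^'n \<Rightarrow> (real^'n \<Rightarrow> real^'n) \<Rightarrow> (real^'n \<Rightarrow> (real^'d) \<Rightarrow>\<^sub>L (real^'n)) \<Rightarrow> (real \<Rightarrow> real) \<Rightarrow> real \<Rightarrow>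
     ('d::finite rpath \<Rightarrow> real) \<Rightarrow> 'd rpath \<Rightarrow> (int \<Rightarrow> ('d, real^'n) cpath) \<Rightarrow> real^'n \<Rightarrow>
     int \<Rightarrow> real \<Rightarrow> real^'n" where
  "J1 A F G f \<alpha> Rad \<W> U \<xi> i t =
     sgrp A (t + of_int (i - 1)) (Pc A \<xi>)
     - (\<Sum>k\<in>{i+1..0}. sgrp A (t + of_int (i - 1 - k)) (block A F G f \<alpha> Rad \<W> U (Pc A) k 0 1 1))
     - block A F G f \<alpha> Rad \<W> U (Pc A) i t 1 t
     + (\<Sum>\<^sub>\<infinity>k\<in>{..i-1}. sgrp A (t + of_int (i - 1 - k)) (block A F G f \<alpha> Rad \<W> U (Ps A) k 0 1 1))
     + block A F G f \<alpha> Rad \<W> U (Ps A) i 0 t t"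

text \<open>Gubinelli derivative of \<open>J1 \<dots> i\<close>: the terms that are smooth in \<open>t\<close> contribute \<open>0\<close>, and the
  rough integrals over \<open>[t, 1]\<close> and \<open>[0, t]\<close> contribute \<open>P\<^sup>c G\<^sub>R(U\<^sup>i\<^sup>-\<^sup>1)(t)\<close> and \<open>P\<^sup>s G\<^sub>R(U\<^sup>i\<^sup>-\<^sup>1)(t)\<close>.\<close>

definition J2 ::
    "real^'n^'n \<Rightarrow> (real^'n \<Rightarrow> (real^'d) \<Rightarrow>\<^sub>L (real^'n)) \<Rightarrow> (real \<Rightarrow> real) \<Rightarrow> real \<Rightarrow>
     ('d::finite rpath \<Rightarrow> real) \<Rightarrow> 'd rpath \<Rightarrow> (int \<Rightarrow> ('d, real^'n) cpath) \<Rightarrow>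
     int \<Rightarrow> real \<Rightarrow> (real^'d) \<Rightarrow>\<^sub>L (real^'n)" where
  "J2 A G f \<alpha> Rad \<W> U i t =
     (let \<Z> = shift_rp (of_int (i - 1)) \<W>; g = fst (G_cut G f \<alpha> (fst \<Z>) (Rad \<Z>) (U (i - 1))) t
      in (Pc A o\<^sub>L g) + (Ps A o\<^sub>L g))"

definition Jd ::
    "real^'n^'n \<Rightarrow> (real^'n \<Rightarrow> real^'n) \<Rightarrow> (real^'n \<Rightarrow> (real^'d) \<Rightarrow>\<^sub>L (real^'n)) \<Rightarrow> (real \<Rightarrow> real) \<Rightarrow> real \<Rightarrow>
     ('d::finite rpath \<Rightarrow> real) \<Rightarrow> 'd rpath \<Rightarrow> (int \<Rightarrow> ('d, real^'n) cpath) \<Rightarrow> real^'n \<Rightarrow>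
     int \<Rightarrow> ('d, real^'n) cpath" where
  "Jd A F G f \<alpha> Rad \<W> U \<xi> =
     (\<lambda>j\<in>{..-1}. (\<lambda>t\<in>{0..1}. J1 A F G f \<alpha> Rad \<W> U \<xi> (j + 1) t,
                   \<lambda>t\<in>{0..1}. J2 A G f \<alpha> Rad \<W> U (j + 1) t))"

definition gap_condition ::
    "real \<Rightarrow> real \<Rightarrow> real \<Rightarrow> real \<Rightarrow> real \<Rightarrow> real \<Rightarrow> real \<Rightarrow> bool" where
  "gap_condition K C\<^sub>S \<beta> \<gamma> \<eta> Mc Ms \<longleftrightarrow>
     K * (exp (\<beta> + \<eta>) * (C\<^sub>S * Ms * exp (- \<eta>) + 1) / (1 - exp (- (\<beta> + \<eta>))) +
          exp (\<gamma> - \<eta>) * (C\<^sub>S * Mc * exp (- \<eta>) + 1) / (1 - exp (- (\<gamma> - \<eta>)))) < 1 / 4"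

end

theory Submission
  imports Defs
begin

text \<open>
  Write \<open>T\<^sub>k\<close> for the cut-off solution map on the block \<open>[k - 1, k]\<close> applied to \<open>U (k - 1)\<close>. Since \<open>S\<close> is
  a group that commutes with the projections, every convolution over a subinterval can be expressed
  through values of \<open>T\<^sub>k\<close>, and the Lyapunov--Perron map takes the form
  \<open>J(U)\<^sub>i(t) = S(t) x\<^sub>i + T\<^sub>i(t)\<close> with
  \<open>x\<^sub>i = S(i - 1) P\<^sup>c \<xi> - \<Sum>\<^sub>i\<^sub>\<le>\<^sub>k\<^sub>\<le>\<^sub>0 S(i - 1 - k) P\<^sup>c T\<^sub>k(1) + \<Sum>\<^sub>k\<^sub><\<^sub>i S(i - 1 - k) P\<^sup>s T\<^sub>k(1)\<close>.
  The radius of the cut-off makes every \<open>T\<^sub>k\<close> Lipschitz with constant \<open>K\<close>, the decay on the two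
  spectral subspaces turns the weighted sums into geometric series, and a smooth path \<open>S(\<cdot>) x\<close> has
  controlled norm at most a constant depending on \<open>A\<close> times \<open>|x|\<close>. The gap condition therefore makes
  \<open>J\<close> a contraction with factor \<open>1/4\<close>. That \<open>T\<^sub>k\<close> is a controlled path at all, so that the suprema in
  its norm are finite, rests on the sewing lemma for the rough integral.
\<close>

section \<open>The matrix exponential\<close>

text \<open>The hypothesis \<open>T_cut_estimate\<close> bounds only the unprojected convolution
  over [0,t], not the projected ones or those over [t,1]. This forces the rewriting through
  \<open>T_cut\<close>: if N is the primitive of S(-r)F dr + S(-r)G dW, every convolution equals
  S(\<tau>) P (N b - N a), and T(t) = S(t) N(t). The other blocks then enter J only through endpoint
  values, and J(U) differs from T on each block by a smooth path with zero Gubinelli derivative, so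
  no further rough estimate is needed. The contraction constant is K (1 + s \<kappa>) with s =
  \<open>smooth_const A\<close>: the 1 stems from the block's own T, and \<kappa> bounds the
  dependence of x_i on the endpoints. The norms of the projections enter \<kappa> because (CS)
  bounds S only on the two subspaces; they depend on A alone and go into C_S. The suprema in
  \<open>dnorm\<close> are real-valued and carry no information on unbounded sets, so membership in
  \<open>ctrl\<close> is tracked throughout. As \<open>BC\<close> is a set of sequences and not a
  metric type, the Banach iteration is run with explicit weighted bounds.\<close>

abbreviation mnorm :: "real^'n^'n \<Rightarrow> real" where
  "mnorm A \<equiv> onorm (\<lambda>x. A *v x)"

lemma mnorm_nonneg: 
  fixes A :: "real^'n^'n"
  shows "0 \<le> mnorm A"
  by (rule onorm_pos_le) (rule matrix_vector_mul_bounded_linear)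

lemma norm_mult_vec_funpow:
  fixes A :: "real^'n^'n"
  shows "norm (((\<lambda>y. A *v y) ^^ k) x) \<le> mnorm A ^ k * norm (x :: real^'n)"
proof (induction k)
  case (Suc k)
  have "norm (((\<lambda>y. A *v y) ^^ Suc k) x) \<le> mnorm A * norm (((\<lambda>y. A *v y) ^^ k) x)"
    using onorm[OF matrix_vector_mul_bounded_linear] by simp
  also have "\<dots> \<le> mnorm A * (mnorm A ^ k * norm x)"
    by (intro mult_left_mono Suc mnorm_nonneg)
  finally show ?case by (simp add: mult_ac)
qed auto

lemma linear_mult_vec_funpow: "linear ((\<lambda>y. (A :: real^'n^'n) *v y) ^^ k)"
proof (induction k)
  case 0
  show ?case using linear_id by (simp add: id_def)
next
  case (Suc k)
  then show ?case
    using linear_compose[OF Suc matrix_vector_mul_linear[of A]] by (simp add: o_def)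
qed

lemma norm_sgrp_term:
  fixes A :: "real^'n^'n"
  shows "norm ((t ^ k / fact k) *\<^sub>R ((\<lambda>y. A *v y) ^^ k) x) \<le> (mnorm A * \<bar>t\<bar>) ^ k / fact k * norm (x :: real^'n)"
proof -
  have "norm ((t ^ k / fact k) *\<^sub>R ((\<lambda>y. A *v y) ^^ k) x) \<le> \<bar>t\<bar> ^ k / fact k * (mnorm A ^ k * norm x)"
    using norm_mult_vec_funpow[where A = A and k = k and x = x] by (simp add: power_abs mult_left_mono divide_right_mono)
  then show ?thesis by (simp add: power_mult_distrib mult_ac)
qed

lemma summable_exp_real: "summable (\<lambda>k. (c::real) ^ k / fact k)"
  using summable_exp[of c] by (simp add: field_simps)

lemma summable_norm_sgrp_term:
  fixes A :: "real^'n^'n"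
  shows "summable (\<lambda>k. norm ((t ^ k / fact k) *\<^sub>R ((\<lambda>y. A *v y) ^^ k) (x :: real^'n)))"
  by (rule summable_comparison_test'[OF summable_mult2[OF summable_exp_real[of "mnorm A * \<bar>t\<bar>"], of "norm x"]])
     (use norm_sgrp_term in auto)

lemma exp_sums_real: "(\<lambda>k. (c::real) ^ k / fact k) sums exp c"
  using exp_converges[of c] by (simp add: field_simps)

lemma norm_suminf_sgrp:
  fixes A :: "real^'n^'n"
  shows "norm (\<Sum>k. (t ^ k / fact k) *\<^sub>R ((\<lambda>y. A *v y) ^^ k) (x :: real^'n)) \<le> exp (mnorm A * \<bar>t\<bar>) * norm x"
proof -
  have "norm (\<Sum>k. (t ^ k / fact k) *\<^sub>R ((\<lambda>y. A *v y) ^^ k) x)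
    \<le> (\<Sum>k. (mnorm A * \<bar>t\<bar>) ^ k / fact k * norm x)"
    by (intro norm_suminf_le norm_sgrp_term summable_mult2 summable_exp_real)
  also have "\<dots> = exp (mnorm A * \<bar>t\<bar>) * norm x"
    using sums_mult2[OF exp_sums_real] by (rule sums_unique[symmetric])
  finally show ?thesis .
qed

lemma sgrp_apply:
  fixes A :: "real^'n^'n"
  shows "sgrp A t x = (\<Sum>k. (t ^ k / fact k) *\<^sub>R ((\<lambda>y. A *v y) ^^ k) (x :: real^'n))"
proof -
  have "bounded_linear (\<lambda>x. \<Sum>k. (t ^ k / fact k) *\<^sub>R ((\<lambda>y. A *v y) ^^ k) (x :: real^'n))"
  proof (rule bounded_linear_intro)
    note s = summable_norm_cancel[OF summable_norm_sgrp_term[of t A]]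
    show "(\<Sum>k. (t ^ k / fact k) *\<^sub>R ((\<lambda>y. A *v y) ^^ k) (x + y)) =
      (\<Sum>k. (t ^ k / fact k) *\<^sub>R ((\<lambda>y. A *v y) ^^ k) x) + (\<Sum>k. (t ^ k / fact k) *\<^sub>R ((\<lambda>y. A *v y) ^^ k) y)"
      for x y :: "real^'n"
      by (subst suminf_add[OF s s]) (simp add: linear_add[OF linear_mult_vec_funpow] scaleR_add_right)
    show "(\<Sum>k. (t ^ k / fact k) *\<^sub>R ((\<lambda>y. A *v y) ^^ k) (r *\<^sub>R x)) =
      r *\<^sub>R (\<Sum>k. (t ^ k / fact k) *\<^sub>R ((\<lambda>y. A *v y) ^^ k) x)" for r and x :: "real^'n"
      by (subst suminf_scaleR_right[OF s]) (simp add: linear_scale[OF linear_mult_vec_funpow] mult_ac)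
    show "norm (\<Sum>k. (t ^ k / fact k) *\<^sub>R ((\<lambda>y. A *v y) ^^ k) x) \<le> norm x * exp (mnorm A * \<bar>t\<bar>)"
      for x :: "real^'n"
      using norm_suminf_sgrp[of t A x] by (simp add: mult.commute)
  qed
  then show ?thesis
    unfolding sgrp_def by (simp add: bounded_linear_Blinfun_apply)
qed

text \<open>The unordered form of the series: \<open>has_sum\<close> lets the product of two such
  series be regrouped freely.\<close>

lemma sgrp_has_sum:
  fixes A :: "real^'n^'n"
  shows "((\<lambda>k. (t ^ k / fact k) *\<^sub>R ((\<lambda>y. A *v y) ^^ k) x) has_sum sgrp A t x) (UNIV :: nat set)"
  unfolding sgrp_apply
  by (intro norm_summable_imp_has_sum summable_norm_sgrp_term summable_sums
      summable_norm_cancel[OF summable_norm_sgrp_term])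

lemma norm_sgrp:
  fixes A :: "real^'n^'n"
  shows "norm (sgrp A t) \<le> exp (mnorm A * \<bar>t\<bar>)"
  by (rule norm_blinfun_bound) (auto simp: sgrp_apply norm_suminf_sgrp)

lemma sgrp_0 [simp]:
  fixes A :: "real^'n^'n"
  shows "sgrp A 0 = id_blinfun"
proof (rule blinfun_eqI)
  fix x
  have "(\<lambda>k. ((0::real) ^ k / fact k) *\<^sub>R ((\<lambda>y. A *v y) ^^ k) x) sums x"
    using sums_finite[of "{0::nat}" "\<lambda>k. ((0::real) ^ k / fact k) *\<^sub>R ((\<lambda>y. A *v y) ^^ k) x"]
    by (simp add: power_0_left)
  then show "sgrp A 0 x = id_blinfun x"
    by (simp add: sgrp_apply sums_iff)
qed

lemma summable_on_times_nonneg: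
  fixes u :: "'a \<Rightarrow> real" and v :: "'b \<Rightarrow> real"
  assumes "u summable_on A" "v summable_on B" "\<And>x. u x \<ge> 0" "\<And>y. v y \<ge> 0"
  shows "(\<lambda>(x, y). u x * v y) summable_on A \<times> B"
proof (rule summable_on_SigmaI)
  show "((\<lambda>y. case (x, y) of (x, y) \<Rightarrow> u x * v y) has_sum u x * infsum v B) B" if "x \<in> A" for x
    using has_sum_cmult_right[OF has_sum_infsum[OF assms(2)]] by simp
  show "(\<lambda>x. u x * infsum v B) summable_on A"
    by (intro summable_on_cmult_left assms)
  show "0 \<le> (case (x, y) of (x, y) \<Rightarrow> u x * v y)" if "x \<in> A" "y \<in> B" for x y
    using assms by simp
qed

text \<open>Cauchy product. The double family \<open>h\<close> is absolutely summable, so it may be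
  summed by rows, which gives the composition, or along the antidiagonals k + j = n, where the
  binomial theorem gives the series at s + t.\<close>

lemma sgrp_add:
  fixes A :: "real^'n^'n"
  shows "sgrp A (s + t) = sgrp A s o\<^sub>L sgrp A t"
proof (rule blinfun_eqI)
  fix x :: "real^'n"
  let ?P = "\<lambda>k. ((\<lambda>y. A *v y) ^^ k)"
  define h where "h = (\<lambda>(k::nat, j::nat). (s ^ k / fact k * (t ^ j / fact j)) *\<^sub>R ?P (k + j) x)"
  have pow: "?P (k + j) y = ?P k (?P j y)" for k j y
    by (simp add: funpow_add)
  have inner: "((\<lambda>j. h (k, j)) has_sum (s ^ k / fact k) *\<^sub>R ?P k (sgrp A t x)) UNIV" for k
  proof -
    have "bounded_linear (\<lambda>y. (s ^ k / fact k) *\<^sub>R ?P k y)"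
      using linear_mult_vec_funpow by (intro bounded_linear_scaleR_right[THEN bounded_linear_compose])
        (simp add: linear_conv_bounded_linear)
    from has_sum_bounded_linear[OF this sgrp_has_sum[of t A x]]
    show ?thesis
      by (simp add: h_def pow o_def linear_scale[OF linear_mult_vec_funpow] case_prod_unfold)
  qed
  have "(\<lambda>p. norm (h p)) summable_on (UNIV \<times> UNIV)"
  proof -
    let ?g = "\<lambda>(k, j). ((mnorm A * \<bar>s\<bar>) ^ k / fact k) * ((mnorm A * \<bar>t\<bar>) ^ j / fact j * norm x)"
    have su: "(\<lambda>k. (c::real) ^ k / fact k) summable_on UNIV" if "c \<ge> 0" for c
      by (rule norm_summable_imp_summable_on) (use that summable_exp_real[of c] in simp)
    have nn: "mnorm A * \<bar>r\<bar> \<ge> 0" for r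
      by (simp add: mnorm_nonneg)
    have pos: "?g p \<ge> 0" for p
      using mnorm_nonneg[of A] by (auto simp: case_prod_unfold intro!: mult_nonneg_nonneg divide_nonneg_nonneg)
    have "?g summable_on (UNIV \<times> UNIV)"
      using nn[of s] nn[of t]
      by (intro summable_on_times_nonneg summable_on_cmult_left su mult_nonneg_nonneg divide_nonneg_nonneg zero_le_power mnorm_nonneg) auto
    then have "(\<lambda>p. norm (?g p)) summable_on (UNIV \<times> UNIV)"
      using pos by simp
    then show ?thesis
    proof (rule Infinite_Sum.abs_summable_on_comparison_test)
      fix p :: "nat \<times> nat"
      obtain k j where p: "p = (k, j)" by (cases p)
      have "norm (h p) = (\<bar>s\<bar> ^ k / fact k * (\<bar>t\<bar> ^ j / fact j)) * norm (?P (k + j) x)"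
        by (simp add: p h_def abs_mult power_abs)
      also have "\<dots> \<le> (\<bar>s\<bar> ^ k / fact k * (\<bar>t\<bar> ^ j / fact j)) * (mnorm A ^ (k + j) * norm x)"
        by (intro mult_left_mono norm_mult_vec_funpow) simp
      also have "\<dots> = ?g p"
        by (simp add: p power_mult_distrib power_add mult_ac)
      finally show "norm (h p) \<le> norm (?g p)" by auto
    qed
  qed
  then have h: "h summable_on (UNIV \<times> UNIV)"
    by (rule Infinite_Sum.abs_summable_summable)
  then have "((\<lambda>k. (s ^ k / fact k) *\<^sub>R ?P k (sgrp A t x)) has_sum infsum h (UNIV \<times> UNIV)) UNIV"
    using inner by (intro has_sum_SigmaD[OF has_sum_infsum]) auto
  then have 1: "infsum h (UNIV \<times> UNIV) = sgrp A s (sgrp A t x)"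
    using sgrp_has_sum has_sum_unique by blast
  \<comment> \<open>\<open>?B\<close> lists the index pairs by antidiagonal: (n, k) stands for (k, n
    - k).\<close>
  let ?B = "Sigma UNIV (\<lambda>n::nat. {..n})"
  have "bij_betw (\<lambda>(n, k). (k, n - k)) ?B (UNIV \<times> UNIV)"
    by (rule bij_betwI[where g = "\<lambda>(k, j). (k + j, k)"]) auto
  then have diag: "((\<lambda>p. h ((\<lambda>(n, k). (k, n - k)) p)) has_sum infsum h (UNIV \<times> UNIV)) ?B"
    using h by (simp add: has_sum_reindex_bij_betw)
  have "((\<lambda>k. h ((\<lambda>(n, k). (k, n - k)) (n, k))) has_sum ((s + t) ^ n / fact n) *\<^sub>R ?P n x) {..n}" for n
  proof -
    have "(\<Sum>k\<le>n. h (k, n - k)) = (\<Sum>k\<le>n. (s ^ k / fact k * (t ^ (n - k) / fact (n - k)))) *\<^sub>R ?P n x"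
      by (simp add: h_def scaleR_left.sum)
    also have "(\<Sum>k\<le>n. (s ^ k / fact k * (t ^ (n - k) / fact (n - k)))) =
        (\<Sum>k\<le>n. of_nat (n choose k) * s ^ k * t ^ (n - k) / fact n)"
      by (intro sum.cong) (auto simp: binomial_fact)
    also have "\<dots> = (s + t) ^ n / fact n"
      by (simp add: binomial_ring sum_divide_distrib)
    finally show ?thesis
      using has_sum_finite[of "{..n}" "\<lambda>k. h (k, n - k)"] by simp
  qed
  from has_sum_SigmaD[OF diag this]
  have "((\<lambda>n. ((s + t) ^ n / fact n) *\<^sub>R ?P n x) has_sum infsum h (UNIV \<times> UNIV)) UNIV"
    by simp
  then have 2: "infsum h (UNIV \<times> UNIV) = sgrp A (s + t) x"
    using sgrp_has_sum has_sum_unique by blast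
  show "sgrp A (s + t) x = (sgrp A s o\<^sub>L sgrp A t) x"
    using 1 2 by simp
qed

lemma sgrp_minus_cancel:
  fixes A :: "real^'n^'n"
  shows "sgrp A s o\<^sub>L sgrp A (- s) = id_blinfun"
  using sgrp_add[of A s "- s"] by simp

lemma exp_minus_1_le: "exp x - 1 \<le> x * exp (x::real)"
proof -
  have "(1 + (-x)) * exp x \<le> exp (-x) * exp x"
    by (intro mult_right_mono exp_ge_add_one_self) auto
  then show ?thesis by (simp add: algebra_simps exp_minus)
qed

text \<open>Without its zeroth term the series is dominated by e^x - 1, which is of first order in
  |t|. This is the source of the Lipschitz continuity of S.\<close>

lemma norm_sgrp_minus_id:
  fixes A :: "real^'n^'n"
  shows "norm (sgrp A t - id_blinfun) \<le> mnorm A * \<bar>t\<bar> * exp (mnorm A * \<bar>t\<bar>)"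
proof (rule norm_blinfun_bound)
  show "0 \<le> mnorm A * \<bar>t\<bar> * exp (mnorm A * \<bar>t\<bar>)"
    by (simp add: mnorm_nonneg)
  fix x :: "real^'n"
  let ?f = "\<lambda>k. (t ^ k / fact k) *\<^sub>R ((\<lambda>y. A *v y) ^^ k) x"
  have "sgrp A t x - ?f 0 = (\<Sum>k. ?f (Suc k))"
    unfolding sgrp_apply
    using suminf_split_head[OF summable_norm_cancel[OF summable_norm_sgrp_term[of t A x]]] by simp
  then have "(sgrp A t - id_blinfun) x = (\<Sum>k. ?f (Suc k))"
    by (simp add: blinfun.diff_left)
  also have "norm \<dots> \<le> (\<Sum>k. (mnorm A * \<bar>t\<bar>) ^ Suc k / fact (Suc k) * norm x)"
    by (intro norm_suminf_le norm_sgrp_term summable_mult2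
        summable_Suc_iff[of "\<lambda>k. (mnorm A * \<bar>t\<bar>) ^ k / fact k", THEN iffD2] summable_exp_real)
  also have "\<dots> = (exp (mnorm A * \<bar>t\<bar>) - 1) * norm x"
  proof (intro sums_unique[symmetric] sums_mult2)
    show "(\<lambda>k. (mnorm A * \<bar>t\<bar>) ^ Suc k / fact (Suc k)) sums (exp (mnorm A * \<bar>t\<bar>) - 1)"
      by (subst sums_Suc_iff) (use exp_sums_real[of "mnorm A * \<bar>t\<bar>"] in simp)
  qed
  also have "\<dots> \<le> mnorm A * \<bar>t\<bar> * exp (mnorm A * \<bar>t\<bar>) * norm x"
    by (intro mult_right_mono exp_minus_1_le) auto
  finally show "norm ((sgrp A t - id_blinfun) x) \<le> \<dots>" .
qed

text \<open>The group law reduces the increment to \<open>sgrp A (t - s) - id_blinfun\<close>. The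
  bounds on |s| and |t - s| turn both exponentials into exp (mnorm A); they hold for s, t in [0,1]
  and also for the pair - s, - t.\<close>

lemma norm_sgrp_diff:
  fixes A :: "real^'n^'n"
  assumes "\<bar>s\<bar> \<le> 1" "\<bar>t - s\<bar> \<le> 1"
  shows "norm (sgrp A t - sgrp A s) \<le> mnorm A * exp (2 * mnorm A) * \<bar>t - s\<bar>"
proof -
  note n = mnorm_nonneg[of A]
  have "sgrp A t - sgrp A s = sgrp A s o\<^sub>L (sgrp A (t - s) - id_blinfun)"
    using sgrp_add[of A s "t - s"]
    by (auto intro!: blinfun_eqI simp: blinfun.diff_left blinfun.diff_right)
  also have "norm \<dots> \<le> norm (sgrp A s) * norm (sgrp A (t - s) - id_blinfun)"
    by (rule norm_blinfun_compose)
  also have "\<dots> \<le> exp (mnorm A * \<bar>s\<bar>) * (mnorm A * \<bar>t - s\<bar> * exp (mnorm A * \<bar>t - s\<bar>))"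
    by (intro mult_mono norm_sgrp norm_sgrp_minus_id) auto
  also have "\<dots> \<le> exp (mnorm A * 1) * (mnorm A * \<bar>t - s\<bar> * exp (mnorm A * 1))"
    using n assms by (intro mult_mono mult_left_mono exp_le_cancel_iff[THEN iffD2] mult_nonneg_nonneg) auto
  also have "\<dots> = mnorm A * exp (2 * mnorm A) * \<bar>t - s\<bar>"
    by (simp add: mult_ac exp_double power2_eq_square)
  finally show ?thesis .
qed

section \<open>Hoelder semi-norms and the sewing lemma\<close>

lemma hoelder2_onE:
  assumes "hoelder2_on a b \<alpha> g"
  obtains C where "C \<ge> 0" "\<And>s t. a \<le> s \<Longrightarrow> s < t \<Longrightarrow> t \<le> b \<Longrightarrow> norm (g s t) \<le> C * (t - s) powr \<alpha>"
proof -
  from assms obtain C where C: "\<And>s t. a \<le> s \<Longrightarrow> s < t \<Longrightarrow> t \<le> b \<Longrightarrow> norm (g s t) \<le> C * (t - s) powr \<alpha>"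
    unfolding hoelder2_on_def by blast
  show thesis
  proof (rule that[of "max C 0"])
    show "norm (g s t) \<le> max C 0 * (t - s) powr \<alpha>" if "a \<le> s" "s < t" "t \<le> b" for s t
      using C[OF that] mult_right_mono[of C "max C 0" "(t - s) powr \<alpha>"] by simp
  qed simp
qed

text \<open>\<open>hoelder2_on\<close> says nothing about s = t. As \<open>0 powr \<alpha>\<close>
  is 0, the diagonal can be included exactly when g vanishes there.\<close>

lemma hoelder2_on_leE:
  assumes "hoelder2_on a b \<alpha> g" "\<And>s. g s s = 0"
  obtains C where "C \<ge> 0" "\<And>s t. a \<le> s \<Longrightarrow> s \<le> t \<Longrightarrow> t \<le> b \<Longrightarrow> norm (g s t) \<le> C * (t - s) powr \<alpha>"
proof -
  from assms(1) obtain C where "C \<ge> 0"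
    and C: "\<And>s t. a \<le> s \<Longrightarrow> s < t \<Longrightarrow> t \<le> b \<Longrightarrow> norm (g s t) \<le> C * (t - s) powr \<alpha>"
    by (rule hoelder2_onE) blast
  show thesis
  proof (rule that[of C])
    show "norm (g s t) \<le> C * (t - s) powr \<alpha>" if "a \<le> s" "s \<le> t" "t \<le> b" for s t
      using C[of s t] that assms(2)[of s] by (cases "s = t") auto
  qed fact
qed

lemma hoelder_onE:
  assumes "hoelder_on a b \<alpha> g"
  obtains C where "C \<ge> 0" "\<And>s t. a \<le> s \<Longrightarrow> s \<le> t \<Longrightarrow> t \<le> b \<Longrightarrow> norm (g t - g s) \<le> C * (t - s) powr \<alpha>"
  using assms unfolding hoelder_on_def by (rule hoelder2_on_leE) auto

lemma hoelder2_onI: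
  assumes "\<And>s t. a \<le> s \<Longrightarrow> s < t \<Longrightarrow> t \<le> b \<Longrightarrow> norm (g s t) \<le> C * (t - s) powr \<alpha>"
  shows "hoelder2_on a b \<alpha> g"
  using assms unfolding hoelder2_on_def by blast

lemma hoelder_onI:
  assumes "\<And>s t. a \<le> s \<Longrightarrow> s < t \<Longrightarrow> t \<le> b \<Longrightarrow> norm (g t - g s) \<le> C * (t - s) powr \<alpha>"
  shows "hoelder_on a b \<alpha> g"
  using assms unfolding hoelder_on_def by (rule hoelder2_onI)

lemma hoelder_on_bounded:
  assumes "hoelder_on 0 1 \<alpha> g" "\<alpha> \<ge> 0"
  obtains B where "B \<ge> 0" "\<And>t. t \<in> {0..1} \<Longrightarrow> norm (g t) \<le> B"
proof -
  obtain C where C: "C \<ge> 0" "\<And>s t. 0 \<le> s \<Longrightarrow> s \<le> t \<Longrightarrow> t \<le> 1 \<Longrightarrow> norm (g t - g s) \<le> C * (t - s) powr \<alpha>"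
    using assms(1) by (rule hoelder_onE) blast
  show thesis
  proof (rule that[of "norm (g 0) + C"])
    fix t :: real assume t: "t \<in> {0..1}"
    have "norm (g t - g 0) \<le> C * t powr \<alpha>"
      using C(2)[of 0 t] t by simp
    also have "\<dots> \<le> C * 1"
      using t C(1) assms(2) by (intro mult_left_mono powr_le1) auto
    finally show "norm (g t) \<le> norm (g 0) + C"
      using norm_triangle_sub[of "g t" "g 0"] by simp
  qed (use C in simp)
qed

lemma hoelder_on_continuous:
  assumes "hoelder_on 0 1 \<alpha> g" "\<alpha> > 0"
  shows "continuous_on {0..1} g"
proof -
  obtain C where C: "C \<ge> 0" "\<And>s t. 0 \<le> s \<Longrightarrow> s \<le> t \<Longrightarrow> t \<le> 1 \<Longrightarrow> norm (g t - g s) \<le> C * (t - s) powr \<alpha>"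
    using assms(1) by (rule hoelder_onE) blast
  have b: "norm (g t - g s) \<le> C * \<bar>t - s\<bar> powr \<alpha>" if "s \<in> {0..1}" "t \<in> {0..1}" for s t
    using that C(2)[of s t] C(2)[of t s] by (cases "s \<le> t") (auto simp: norm_minus_commute)
  show ?thesis
    unfolding continuous_on_def
  proof
    fix s :: real assume s: "s \<in> {0..1}"
    have "((\<lambda>t. C * \<bar>t - s\<bar> powr \<alpha>) \<longlongrightarrow> C * \<bar>s - s\<bar> powr \<alpha>) (at s within {0..1})"
      using assms(2) by (intro tendsto_intros tendsto_powr') auto
    then have "((\<lambda>t. g t - g s) \<longlongrightarrow> 0) (at s within {0..1})"
    proof (rule Lim_null_comparison[rotated, OF tendsto_eq_rhs])
      show "C * \<bar>s - s\<bar> powr \<alpha> = 0" by simp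
      show "\<forall>\<^sub>F t in at s within {0..1}. norm (g t - g s) \<le> C * \<bar>t - s\<bar> powr \<alpha>"
        unfolding eventually_at_filter by (rule always_eventually) (use b s in blast)
    qed
    then show "(g \<longlongrightarrow> g s) (at s within {0..1})"
      by (simp add: LIM_zero_iff)
  qed
qed

text \<open>Hoelder regularity is what bounds the set under the supremum; without it the real-valued
  \<open>SUP\<close> would give no pointwise information.\<close>

lemma hnorm2_bound:
  assumes "hoelder2_on 0 1 \<alpha> g" "0 \<le> s" "s < t" "t \<le> 1"
  shows "norm (g s t) \<le> hnorm2 \<alpha> g * (t - s) powr \<alpha>"
proof -
  obtain C where C: "\<And>s t. 0 \<le> s \<Longrightarrow> s < t \<Longrightarrow> t \<le> 1 \<Longrightarrow> norm (g s t) \<le> C * (t - s) powr \<alpha>"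
    using assms(1) by (rule hoelder2_onE) blast
  have "(\<lambda>(s, t). norm (g s t) / (t - s) powr \<alpha>) (s, t) \<le> hnorm2 \<alpha> g"
    unfolding hnorm2_def
    by (rule cSUP_upper) (use assms C in \<open>auto intro!: bdd_aboveI[of _ C] simp: field_simps\<close>)
  then show ?thesis
    using assms by (simp add: field_simps)
qed

lemma hnorm2_le:
  assumes "\<And>s t. 0 \<le> s \<Longrightarrow> s < t \<Longrightarrow> t \<le> 1 \<Longrightarrow> norm (g s t) \<le> C * (t - s) powr \<alpha>"
  shows "hnorm2 \<alpha> g \<le> C"
  unfolding hnorm2_def
proof (rule cSUP_least)
  have "(0, 1) \<in> {(s, t). 0 \<le> s \<and> s < t \<and> t \<le> (1::real)}" by simp
  then show "{(s, t). 0 \<le> s \<and> s < t \<and> t \<le> (1::real)} \<noteq> {}" by blast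
qed (use assms in \<open>auto simp: field_simps\<close>)

lemma hnorm2_nonneg:
  assumes "hoelder2_on 0 1 \<alpha> g"
  shows "0 \<le> hnorm2 \<alpha> g"
  using hnorm2_bound[OF assms, of 0 1] by (simp add: order_trans[OF norm_ge_zero])

lemma snorm_bound:
  assumes "hoelder_on 0 1 \<alpha> g" "\<alpha> \<ge> 0" "t \<in> {0..1}"
  shows "norm (g t) \<le> snorm g"
proof -
  obtain B where "\<And>t. t \<in> {0..1} \<Longrightarrow> norm (g t) \<le> B"
    using assms(1,2) by (rule hoelder_on_bounded) blast
  then show ?thesis
    unfolding snorm_def using assms(3) by (intro cSUP_upper bdd_aboveI2[where M = B]) auto
qed

lemma snorm_le: "(\<And>t. t \<in> {0..1} \<Longrightarrow> norm (g t) \<le> B) \<Longrightarrow> snorm g \<le> B"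
  unfolding snorm_def by (rule cSUP_least) auto

lemma snorm_nonneg: "hoelder_on 0 1 \<alpha> g \<Longrightarrow> \<alpha> \<ge> 0 \<Longrightarrow> 0 \<le> snorm g"
  using snorm_bound[of \<alpha> g 0] by (simp add: order_trans[OF norm_ge_zero])

lemma mono_between:
  fixes p :: "nat \<Rightarrow> real"
  assumes "\<And>i. m \<le> i \<Longrightarrow> i < n \<Longrightarrow> p i \<le> p (Suc i)" "m \<le> i" "i \<le> j" "j \<le> n"
  shows "p i \<le> p j"
  using assms(3,4)
proof (induction j rule: dec_induct)
  case (step j)
  then show ?case using assms(1)[of j] assms(2) by simp
qed simp

section \<open>The sewing lemma\<close>

locale sewing =
  fixes \<Xi> :: "real \<Rightarrow> real \<Rightarrow> 'e::banach" and C \<theta> :: real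
  assumes theta: "\<theta> > 1" and C_nonneg: "C \<ge> 0"
    and defect: "\<And>s u t. 0 \<le> s \<Longrightarrow> s \<le> u \<Longrightarrow> u \<le> t \<Longrightarrow> t \<le> 1 \<Longrightarrow>
      norm (\<Xi> s t - \<Xi> s u - \<Xi> u t) \<le> C * (t - s) powr \<theta>"
begin

text \<open>Chosen to solve \<open>K_eq\<close>: in the induction below the two halves cost 2 K
  (1/2)^\<theta> and the two defects cost 2 C. The solution is finite and nonnegative because
  \<theta> > 1 makes 2^(1 - \<theta>) < 1.\<close>

definition "K = 2 * C / (1 - 2 powr (1 - \<theta>))"

lemma two_powr: "2 powr (1 - \<theta>) < 1"
  using theta powr_less_mono[of "1 - \<theta>" 0 2] by simp

lemma K_nonneg: "K \<ge> 0"
  using two_powr C_nonneg by (simp add: K_def)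

lemma K_eq: "K * (2 * 2 powr (- \<theta>)) + 2 * C = K"
proof -
  have "2 * 2 powr (- \<theta>) = 2 powr (1 - \<theta>)"
    using powr_add[of 2 1 "- \<theta>"] by simp
  then show ?thesis
    using two_powr theta by (simp add: K_def divide_simps) (simp add: algebra_simps)
qed

text \<open>At s = u = t the defect is \<open>- \<Xi> s s\<close>, and its bound contains
  \<open>0 powr \<theta>\<close>, which is 0.\<close>

lemma diag_zero: "s \<in> {0..1} \<Longrightarrow> \<Xi> s s = 0"
  using defect[of s s s] by simp

text \<open>The sum over a partition is compared with the single germ by splitting off the interval
  that contains the midpoint, so that both remaining parts have at most half the length.\<close>

lemma maximal_inequality:
  assumes "m \<le> n" "\<And>i. m \<le> i \<Longrightarrow> i < n \<Longrightarrow> p i \<le> p (Suc i)" "0 \<le> p m" "p n \<le> 1"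
  shows "norm ((\<Sum>i=m..<n. \<Xi> (p i) (p (Suc i))) - \<Xi> (p m) (p n)) \<le> K * (p n - p m) powr \<theta>"
  using assms
proof (induction "n - m" arbitrary: m n rule: less_induct)
  case less
  note mono = mono_between[of m n p, OF less.prems(2)]
  show ?case
  proof (cases "m = n")
    case True
    then show ?thesis
      using less.prems diag_zero[of "p n"] mono K_nonneg by simp
  next
    case False
    with less.prems have "m < n" by simp
    define L where "L = p n - p m"
    have L: "L \<ge> 0" using mono[of m n] \<open>m < n\<close> by (simp add: L_def)
    define mid where "mid = (p m + p n) / 2"
    \<comment> \<open>\<open>j\<close> is the last index whose point does not exceed the midpoint,
      so the interval from p j to p (Suc j) is the one to be split off.\<close>
    define S where "S = {i \<in> {m..<n}. p i \<le> mid}"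
    define j where "j = Max S"
    have S: "finite S" "m \<in> S"
      using \<open>m < n\<close> L by (auto simp: S_def mid_def L_def)
    then have "j \<in> S" unfolding j_def by (intro Max_in) auto
    then have j: "m \<le> j" "j < n" "p j \<le> mid" by (auto simp: S_def)
    have "p (Suc j) \<ge> mid"
    proof (cases "Suc j = n")
      case True
      then show ?thesis using L by (simp add: mid_def L_def)
    next
      case False
      then have "Suc j \<notin> S"
        using S j_def by (metis Max_ge Suc_n_not_le_n)
      then show ?thesis using False j by (auto simp: S_def)
    qed
    note j = j this
    have "(\<Sum>i=m..<n. \<Xi> (p i) (p (Suc i))) = (\<Sum>i=m..<j. \<Xi> (p i) (p (Suc i))) + \<Xi> (p j) (p (Suc j))
        + (\<Sum>i=Suc j..<n. \<Xi> (p i) (p (Suc i)))"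
      using j sum.atLeastLessThan_concat[of m j n "\<lambda>i. \<Xi> (p i) (p (Suc i))"]
      by (simp add: sum.atLeast_Suc_lessThan add.assoc)
    \<comment> \<open>The germ over the whole interval is cut first at p j and then at p (Suc j);
      \<open>?c\<close> and \<open>?d\<close> are the two defects this costs.\<close>
    then have "(\<Sum>i=m..<n. \<Xi> (p i) (p (Suc i))) - \<Xi> (p m) (p n) =
        ((\<Sum>i=m..<j. \<Xi> (p i) (p (Suc i))) - \<Xi> (p m) (p j)) +
        ((\<Sum>i=Suc j..<n. \<Xi> (p i) (p (Suc i))) - \<Xi> (p (Suc j)) (p n)) -
        (\<Xi> (p m) (p n) - \<Xi> (p m) (p j) - \<Xi> (p j) (p n)) -
        (\<Xi> (p j) (p n) - \<Xi> (p j) (p (Suc j)) - \<Xi> (p (Suc j)) (p n))"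
      (is "_ = ?a + ?b - ?c - ?d") by (simp add: algebra_simps)
    then have "norm ((\<Sum>i=m..<n. \<Xi> (p i) (p (Suc i))) - \<Xi> (p m) (p n)) \<le>
        norm ?a + norm ?b + norm ?c + norm ?d"
      by (smt (verit) norm_triangle_ineq norm_triangle_ineq4)
    also have "norm ?a \<le> K * (p j - p m) powr \<theta>"
      using j less.prems mono[of j n] by (intro less.hyps) auto
    also have "\<dots> \<le> K * (L / 2) powr \<theta>"
      using j mono[of m j] theta by (intro mult_left_mono K_nonneg powr_mono2) (auto simp: L_def mid_def field_simps)
    also have "norm ?b \<le> K * (p n - p (Suc j)) powr \<theta>"
      using j less.prems mono[of m "Suc j"] by (intro less.hyps) auto
    also have "\<dots> \<le> K * (L / 2) powr \<theta>"
      using j mono[of "Suc j" n] theta by (intro mult_left_mono K_nonneg powr_mono2) (auto simp: L_def mid_def field_simps)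
    also have "norm ?c \<le> C * L powr \<theta>"
      unfolding L_def using j less.prems mono[of m j] mono[of j n] by (intro defect) auto
    also have "norm ?d \<le> C * (p n - p j) powr \<theta>"
      using j less.prems mono[of m j] mono[of j "Suc j"] mono[of "Suc j" n] by (intro defect) auto
    also have "\<dots> \<le> C * L powr \<theta>"
      using j mono[of m j] mono[of j n] theta C_nonneg by (intro mult_left_mono powr_mono2) (auto simp: L_def)
    also have "K * (L / 2) powr \<theta> + K * (L / 2) powr \<theta> + C * L powr \<theta> + C * L powr \<theta> =
       (K * (2 * 2 powr (- \<theta>)) + 2 * C) * L powr \<theta>"
      using L by (simp add: powr_divide powr_minus field_simps)
    also have "\<dots> = K * L powr \<theta>"
      by (simp add: K_eq)
    finally show ?thesis by (simp add: L_def)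
  qed
qed

text \<open>Truncation by \<open>min\<close> keeps one grid for all t, so sums for different t can
  be compared term by term; intervals beyond t contribute \<open>\<Xi> t t\<close>, which
  vanishes.\<close>

definition dyadic_sum :: "nat \<Rightarrow> real \<Rightarrow> 'e" where
  "dyadic_sum n t = (\<Sum>k<2 ^ n. \<Xi> (min (real k / 2 ^ n) t) (min (real (Suc k) / 2 ^ n) t))"

lemma sum_lessThan_double: "(\<Sum>k<2 * (N::nat). h k) = (\<Sum>k<N. h (2 * k) + h (Suc (2 * k)) :: 'e)"
  by (induction N) (simp_all add: add.assoc)

text \<open>There are 2^n intervals of length 2^(-n), each with an error of order \<theta> > 1: in
  total a geometric sequence with ratio 2^(1 - \<theta>) < 1.\<close>

lemma mesh_powr: "2 ^ n * (C * (1 / 2 ^ n) powr \<theta>) = C * (2 powr (1 - \<theta>)) ^ n"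
proof -
  have "(1 / 2 ^ n) powr \<theta> = 2 powr (- real n * \<theta>)"
    by (simp add: powr_divide powr_powr flip: powr_realpow) (simp add: powr_minus_divide)
  then have "2 ^ n * (1 / 2 ^ n) powr \<theta> = 2 powr (real n + - real n * \<theta>)"
    by (simp only: powr_add) (simp add: powr_realpow)
  also have "\<dots> = (2 powr (1 - \<theta>)) ^ n"
    by (simp add: powr_powr field_simps flip: powr_realpow)
  finally show ?thesis by simp
qed

text \<open>Refining the grid inserts one point into each interval, so the difference of two
  successive sums is a sum of 2^n defects.\<close>

lemma dyadic_sum_Suc:
  assumes "t \<in> {0..1}"
  shows "norm (dyadic_sum (Suc n) t - dyadic_sum n t) \<le> C * (2 powr (1 - \<theta>)) ^ n"
proof -
  let ?u = "\<lambda>k. min (real k / 2 ^ n) t"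
  let ?m = "\<lambda>k. min (real (Suc (2 * k)) / 2 ^ Suc n) t"
  have eq: "real (2 * k) / 2 ^ Suc n = real k / 2 ^ n" for k
    by simp
  have "dyadic_sum (Suc n) t = (\<Sum>k<2 ^ n. \<Xi> (?u k) (?m k) + \<Xi> (?m k) (?u (Suc k)))"
    unfolding dyadic_sum_def power_Suc[of "2::nat"] sum_lessThan_double eq
  proof (intro sum.cong refl)
    fix k :: nat
    have "real (Suc (Suc (2 * k))) / 2 ^ Suc n = real (Suc k) / 2 ^ n"
      by (simp add: field_simps)
    then show "\<Xi> (?u k) (min (real (Suc (2 * k)) / 2 ^ Suc n) t) +
      \<Xi> (?m k) (min (real (Suc (Suc (2 * k))) / 2 ^ Suc n) t) = \<Xi> (?u k) (?m k) + \<Xi> (?m k) (?u (Suc k))"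
      by simp
  qed
  then have eq: "dyadic_sum (Suc n) t - dyadic_sum n t =
      (\<Sum>k<2 ^ n. - (\<Xi> (?u k) (?u (Suc k)) - \<Xi> (?u k) (?m k) - \<Xi> (?m k) (?u (Suc k))))"
    by (simp add: dyadic_sum_def sum_subtractf[symmetric] algebra_simps)
  have "norm (dyadic_sum (Suc n) t - dyadic_sum n t) \<le> (\<Sum>k<(2::nat) ^ n. C * (1 / 2 ^ n) powr \<theta>)"
    unfolding eq
  proof (rule sum_norm_le)
    fix k :: nat
    have o: "?u k \<le> ?m k" "?m k \<le> ?u (Suc k)" "0 \<le> ?u k" "?u (Suc k) \<le> 1"
      using assms by (auto intro!: min.mono simp: field_simps min_le_iff_disj)
    have "norm (- (\<Xi> (?u k) (?u (Suc k)) - \<Xi> (?u k) (?m k) - \<Xi> (?m k) (?u (Suc k))))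
      \<le> C * (?u (Suc k) - ?u k) powr \<theta>"
      using o unfolding norm_minus_cancel by (intro defect)
    also have "\<dots> \<le> C * (1 / 2 ^ n) powr \<theta>"
      using o theta C_nonneg by (intro mult_left_mono powr_mono2) (auto simp: min_def field_simps)
    finally show "norm (- (\<Xi> (?u k) (?u (Suc k)) - \<Xi> (?u k) (?m k) - \<Xi> (?m k) (?u (Suc k)))) \<le> \<dots>" .
  qed
  also have "\<dots> = C * (2 powr (1 - \<theta>)) ^ n"
    by (simp only: sum_constant card_lessThan of_nat_power of_nat_numeral mesh_powr)
  finally show ?thesis .
qed

definition sewn :: "real \<Rightarrow> 'e" where
  "sewn t = lim (\<lambda>n. dyadic_sum n t)"

lemma dyadic_sum_tendsto:
  assumes "t \<in> {0..1}"
  shows "(\<lambda>n. dyadic_sum n t) \<longlonglongrightarrow> sewn t"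
proof -
  have "summable (\<lambda>n. dyadic_sum (Suc n) t - dyadic_sum n t)"
    using two_powr dyadic_sum_Suc[OF assms]
    by (intro summable_comparison_test'[OF summable_mult[OF summable_geometric[of "2 powr (1 - \<theta>)"], of C], of 0]) auto
  then have "(\<lambda>n. dyadic_sum 0 t + (\<Sum>k<n. dyadic_sum (Suc k) t - dyadic_sum k t)) \<longlonglongrightarrow>
      dyadic_sum 0 t + (\<Sum>n. dyadic_sum (Suc n) t - dyadic_sum n t)"
    by (intro tendsto_intros summable_LIMSEQ)
  moreover have "dyadic_sum 0 t + (\<Sum>k<n. dyadic_sum (Suc k) t - dyadic_sum k t) = dyadic_sum n t" for n
    using sum_lessThan_telescope[of "\<lambda>k. dyadic_sum k t" n] by simp
  ultimately have "convergent (\<lambda>n. dyadic_sum n t)"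
    unfolding convergent_def by auto
  then show ?thesis
    by (simp add: sewn_def convergent_LIMSEQ_iff)
qed

text \<open>The difference of the dyadic sums at t and s is, up to an error that vanishes with the
  mesh, the sum over the partition of [s,t] cut out by the grid; \<open>maximal_inequality\<close>
  compares the latter with the single germ.\<close>

lemma sewn_germ:
  assumes "0 \<le> s" "s \<le> t" "t \<le> 1"
  shows "norm (sewn t - sewn s - \<Xi> s t) \<le> K * (t - s) powr \<theta>"
proof -
  have *: "norm (dyadic_sum n t - dyadic_sum n s - \<Xi> s t) \<le> C * (2 powr (1 - \<theta>)) ^ n + K * (t - s) powr \<theta>" for n
  proof -
    let ?g = "\<lambda>k. real k / 2 ^ n"
    \<comment> \<open>The grid clamped to [s,t]; it repeats the endpoints, which is why
      \<open>maximal_inequality\<close> asks only for weakly increasing points.\<close>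
    define q where "q k = max s (min (?g k) t)" for k
    define d where "d k = \<Xi> (min (?g k) t) (min (?g (Suc k)) t) - \<Xi> (min (?g k) s) (min (?g (Suc k)) s) - \<Xi> (q k) (q (Suc k))" for k
    have mesh: "?g k \<le> ?g (Suc k)" "?g (Suc k) - ?g k = 1 / 2 ^ n" "0 \<le> ?g k" for k
      by (auto simp: field_simps)
    \<comment> \<open>Only the grid interval with s in its interior contributes; elsewhere the germs
      cancel or lie on the diagonal. Using the bound for every k still gives a total that tends to
      0.\<close>
    have d: "norm (d k) \<le> C * (1 / 2 ^ n) powr \<theta>" for k
    proof -
      consider "?g (Suc k) \<le> s" | "s \<le> ?g k" | "?g k < s" "s < ?g (Suc k)"
        by linarith
      then show ?thesis
      proof cases
        case 1
        then show ?thesis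
        proof -
          have "q k = s" "q (Suc k) = s" "min (?g k) t = ?g k" "min (?g k) s = ?g k"
            "min (?g (Suc k)) t = ?g (Suc k)" "min (?g (Suc k)) s = ?g (Suc k)"
            using 1 assms mesh(1)[of k] by (auto simp: q_def)
          then show ?thesis
            using assms C_nonneg diag_zero[of s] by (simp add: d_def)
        qed
      next
        case 2
        then have "min (?g k) s = s" "min (?g (Suc k)) s = s" "q k = min (?g k) t" "q (Suc k) = min (?g (Suc k)) t"
          using assms mesh(1)[of k] by (auto simp: q_def)
        then show ?thesis
          using assms C_nonneg diag_zero[of s] by (simp add: d_def)
      next
        case 3
        then have e: "min (?g k) t = ?g k" "min (?g k) s = ?g k" "min (?g (Suc k)) s = s" "q k = s"
           "q (Suc k) = min (?g (Suc k)) t"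
          using assms by (auto simp: q_def)
        have "norm (d k) \<le> C * (min (?g (Suc k)) t - ?g k) powr \<theta>"
          unfolding d_def e using 3 assms mesh(3)[of k] by (intro defect) auto
        also have "\<dots> \<le> C * (1 / 2 ^ n) powr \<theta>"
          using 3 assms mesh(2)[of k] theta C_nonneg by (intro mult_left_mono powr_mono2) (auto simp: min_def)
        finally show ?thesis .
      qed
    qed
    have "norm (dyadic_sum n t - dyadic_sum n s - \<Xi> s t) = norm (
       (\<Sum>k<2 ^ n. d k) + ((\<Sum>k<2 ^ n. \<Xi> (q k) (q (Suc k))) - \<Xi> s t))"
      by (simp add: dyadic_sum_def d_def sum_subtractf)
    also have "\<dots> \<le> norm (\<Sum>k<2 ^ n. d k) + norm ((\<Sum>k<2 ^ n. \<Xi> (q k) (q (Suc k))) - \<Xi> s t)"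
      by (rule norm_triangle_ineq)
    also have "norm (\<Sum>k<2 ^ n. d k) \<le> (\<Sum>k<(2::nat) ^ n. C * (1 / 2 ^ n) powr \<theta>)"
      using d by (intro sum_norm_le) auto
    also have "\<dots> = C * (2 powr (1 - \<theta>)) ^ n"
      by (simp only: sum_constant card_lessThan of_nat_power of_nat_numeral mesh_powr)
    also have "norm ((\<Sum>k<2 ^ n. \<Xi> (q k) (q (Suc k))) - \<Xi> s t) \<le> K * (t - s) powr \<theta>"
    proof -
      have "q 0 = s" "q (2 ^ n) = t"
        using assms by (auto simp: q_def)
      moreover have "q k \<le> q (Suc k)" for k
        unfolding q_def using mesh(1)[of k] by (intro max.mono min.mono order_refl)
      then have "norm ((\<Sum>i=0..<2^n. \<Xi> (q i) (q (Suc i))) - \<Xi> (q 0) (q (2 ^ n))) \<le> K * (q (2 ^ n) - q 0) powr \<theta>"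
        using assms \<open>q 0 = s\<close> \<open>q (2 ^ n) = t\<close>
        by (intro maximal_inequality[where p = q]) auto
      ultimately show ?thesis by (simp add: atLeast0LessThan)
    qed
    finally show ?thesis by simp
  qed
  have "(\<lambda>n. dyadic_sum n t - dyadic_sum n s - \<Xi> s t) \<longlonglongrightarrow> sewn t - sewn s - \<Xi> s t"
    using assms by (intro tendsto_intros dyadic_sum_tendsto) auto
  then have "(\<lambda>n. norm (dyadic_sum n t - dyadic_sum n s - \<Xi> s t)) \<longlonglongrightarrow> norm (sewn t - sewn s - \<Xi> s t)"
    by (rule tendsto_norm)
  moreover have "(\<lambda>n. C * (2 powr (1 - \<theta>)) ^ n + K * (t - s) powr \<theta>) \<longlonglongrightarrow> C * 0 + K * (t - s) powr \<theta>"
    using two_powr by (intro tendsto_intros LIMSEQ_power_zero) auto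
  ultimately have "norm (sewn t - sewn s - \<Xi> s t) \<le> C * 0 + K * (t - s) powr \<theta>"
    by (rule LIMSEQ_le) (use * in blast)
  then show ?thesis by simp
qed

lemma sewn_partition_limit:
  assumes "0 \<le> s" "s \<le> t" "t \<le> 1" "\<epsilon> > 0"
  shows "\<exists>\<delta>>0. \<forall>N p. is_partition s t N p \<and> (\<forall>i<N. p (Suc i) - p i < \<delta>) \<longrightarrow>
    norm ((\<Sum>i<N. \<Xi> (p i) (p (Suc i))) - (sewn t - sewn s)) < \<epsilon>"
proof -
  \<comment> \<open>Each interval errs by at most K \<delta>^(\<theta> - 1) times its length. This
    \<delta> makes the factor \<epsilon> K / (K + 1) < \<epsilon>, and the lengths add up to t - s
    \<le> 1.\<close>
  define \<delta> where "\<delta> = (\<epsilon> / (K + 1)) powr (1 / (\<theta> - 1))"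
  have "\<delta> > 0" using K_nonneg assms by (simp add: \<delta>_def)
  have \<delta>: "\<delta> powr (\<theta> - 1) = \<epsilon> / (K + 1)"
    using theta K_nonneg assms by (simp add: \<delta>_def powr_powr)
  show ?thesis
  proof (intro exI[of _ \<delta>] conjI allI impI \<open>\<delta> > 0\<close>)
    fix N p assume p: "is_partition s t N p \<and> (\<forall>i<N. p (Suc i) - p i < \<delta>)"
    then have p0: "p 0 = s" "p N = t" and inc: "\<And>i. i < N \<Longrightarrow> p i < p (Suc i)"
      and mesh: "\<And>i. i < N \<Longrightarrow> p (Suc i) - p i < \<delta>"
      by (auto simp: is_partition_def)
    have mono: "p i \<le> p j" if "i \<le> j" "j \<le> N" for i j
      using that inc by (intro mono_between[of 0 N p i j]) (auto intro: less_imp_le)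
    have eq: "(\<Sum>i<N. \<Xi> (p i) (p (Suc i))) - (sewn t - sewn s) =
       (\<Sum>i<N. - (sewn (p (Suc i)) - sewn (p i) - \<Xi> (p i) (p (Suc i))))"
      using sum_lessThan_telescope[of "\<lambda>i. sewn (p i)" N] p0
      by (simp add: sum_subtractf sum.distrib algebra_simps)
    have "norm ((\<Sum>i<N. \<Xi> (p i) (p (Suc i))) - (sewn t - sewn s)) \<le> (\<Sum>i<N. \<epsilon> / (K + 1) * K * (p (Suc i) - p i))"
      unfolding eq
    proof (rule sum_norm_le)
      fix i assume "i \<in> {..<N}"
      then have i: "i < N" by simp
      have "norm (- (sewn (p (Suc i)) - sewn (p i) - \<Xi> (p i) (p (Suc i)))) \<le> K * (p (Suc i) - p i) powr \<theta>"
        unfolding norm_minus_cancel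
        using i mono[of 0 i] mono[of "Suc i" N] inc[OF i] p0 assms by (intro sewn_germ) auto
      also have "(p (Suc i) - p i) powr \<theta> = (p (Suc i) - p i) powr (\<theta> - 1) * (p (Suc i) - p i)"
        using inc[OF i] powr_add[of "p (Suc i) - p i" "\<theta> - 1" 1] by simp
      also have "K * ((p (Suc i) - p i) powr (\<theta> - 1) * (p (Suc i) - p i)) \<le> K * (\<delta> powr (\<theta> - 1) * (p (Suc i) - p i))"
        using inc[OF i] mesh[OF i] theta by (intro mult_left_mono mult_right_mono powr_mono2 K_nonneg) auto
      finally show "norm (- (sewn (p (Suc i)) - sewn (p i) - \<Xi> (p i) (p (Suc i)))) \<le> \<epsilon> / (K + 1) * K * (p (Suc i) - p i)"
        by (simp add: \<delta> mult_ac)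
    qed
    also have "\<dots> = \<epsilon> / (K + 1) * K * (t - s)"
      by (simp only: sum_distrib_left[symmetric] sum_lessThan_telescope[of p N] p0)
    also have "\<dots> \<le> \<epsilon> / (K + 1) * K * 1"
      using assms K_nonneg by (intro mult_left_mono) auto
    also have "\<dots> < \<epsilon>"
      using assms K_nonneg by (simp add: field_simps)
    finally show "norm ((\<Sum>i<N. \<Xi> (p i) (p (Suc i))) - (sewn t - sewn s)) < \<epsilon>" .
  qed
qed

end

section \<open>Uniqueness of the rough integral\<close>

lemma fine_partition_exists:
  assumes "s \<le> t" "\<delta> > 0"
  obtains N p where "is_partition s t N p" "\<And>i. i < N \<Longrightarrow> p (Suc i) - p i < \<delta>"
proof (cases "s = t")
  \<comment> \<open>Partitions are strictly increasing, so for s = t only the empty one, N = 0,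
    qualifies.\<close>
  case True
  then show ?thesis
    using that[of 0 "\<lambda>_. s"] by (simp add: is_partition_def)
next
  case False
  with assms have "s < t" by simp
  obtain N :: nat where N: "(t - s) / \<delta> < N" using reals_Archimedean2 by blast
  have "0 < (t - s) / \<delta>" using \<open>s < t\<close> assms by simp
  with N have N0: "N > 0" by (metis of_nat_0_less_iff order_less_trans)
  define p where "p i = s + (t - s) * (real i / real N)" for i
  have diff: "p (Suc i) - p i = (t - s) / N" for i
    using N0 by (simp add: p_def add_divide_distrib distrib_left)
  show ?thesis
  proof (rule that[of N p])
    have "p i < p (Suc i)" for i
      using diff[of i] \<open>s < t\<close> N0 by (smt (verit) divide_pos_pos of_nat_0_less_iff)
    then show "is_partition s t N p"
      using N0 by (simp add: is_partition_def p_def)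
    show "p (Suc i) - p i < \<delta>" for i
      using N N0 assms by (simp add: diff field_simps)
  qed
qed

text \<open>Since partitions of arbitrarily small mesh exist, the limit condition is never vacuous,
  and one partition fine enough for both candidates separates them. This gives the description
  operator in \<open>rough_integral\<close> its meaning.\<close>

lemma has_rough_integral_unique:
  assumes "s \<le> t" "has_rough_integral Y \<W> s t I" "has_rough_integral Y \<W> s t J"
  shows "I = J"
proof (rule ccontr)
  assume "I \<noteq> J"
  define e where "e = norm (I - J) / 2"
  have "e > 0" using \<open>I \<noteq> J\<close> by (simp add: e_def)
  define \<sigma> where "\<sigma> N p = (\<Sum>i<N. fst Y (p i) (fst \<W> (p (Suc i)) - fst \<W> (p i)) +
                      tapply (snd Y (p i)) (snd \<W> (p i) (p (Suc i))))" for N and p :: "nat \<Rightarrow> real"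
  have lim: "\<exists>d>0. \<forall>N p. is_partition s t N p \<and> (\<forall>i<N. p (Suc i) - p i < d) \<longrightarrow> norm (\<sigma> N p - L) < e"
    if "has_rough_integral Y \<W> s t L" for L
    unfolding \<sigma>_def using that[unfolded has_rough_integral_def] \<open>e > 0\<close> by (elim allE[of _ e] impE)
  obtain d1 where d1: "d1 > 0" "\<And>N p. is_partition s t N p \<Longrightarrow> (\<And>i. i < N \<Longrightarrow> p (Suc i) - p i < d1) \<Longrightarrow> norm (\<sigma> N p - I) < e"
    using lim[OF assms(2)] by blast
  obtain d2 where d2: "d2 > 0" "\<And>N p. is_partition s t N p \<Longrightarrow> (\<And>i. i < N \<Longrightarrow> p (Suc i) - p i < d2) \<Longrightarrow> norm (\<sigma> N p - J) < e"
    using lim[OF assms(3)] by blast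
  obtain N p where p: "is_partition s t N p" "\<And>i. i < N \<Longrightarrow> p (Suc i) - p i < min d1 d2"
    using fine_partition_exists[OF assms(1), of "min d1 d2"] d1 d2 by auto
  have "norm (\<sigma> N p - I) < e" "norm (\<sigma> N p - J) < e"
    using p by (auto intro!: d1 d2)
  moreover have "norm (I - J) \<le> norm (\<sigma> N p - I) + norm (\<sigma> N p - J)"
    using norm_triangle_ineq4[of "\<sigma> N p - J" "\<sigma> N p - I"] by simp
  ultimately show False by (simp add: e_def)
qed

lemma rough_integral_eqI:
  assumes "s \<le> t" "has_rough_integral Y \<W> s t I"
  shows "rough_integral Y \<W> s t = I"
  unfolding rough_integral_def
  by (rule the_equality[where P = "has_rough_integral Y \<W> s t"])
    (use assms has_rough_integral_unique in blast)+

section \<open>Controlled paths and the rough integral\<close>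

lemma hoelder2_on_add:
  assumes "hoelder2_on 0 1 \<alpha> g" "hoelder2_on 0 1 \<alpha> h"
  shows "hoelder2_on 0 1 \<alpha> (\<lambda>s t. g s t + h s t)"
proof -
  obtain C where C: "\<And>s t. 0 \<le> s \<Longrightarrow> s < t \<Longrightarrow> t \<le> 1 \<Longrightarrow> norm (g s t) \<le> C * (t - s) powr \<alpha>"
    using assms(1) by (rule hoelder2_onE) blast
  obtain D where D: "\<And>s t. 0 \<le> s \<Longrightarrow> s < t \<Longrightarrow> t \<le> 1 \<Longrightarrow> norm (h s t) \<le> D * (t - s) powr \<alpha>"
    using assms(2) by (rule hoelder2_onE) blast
  show ?thesis
    by (rule hoelder2_onI[where C = "C + D"])
      (use C D in \<open>auto simp: distrib_right intro!: norm_triangle_mono\<close>)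
qed

lemma hoelder2_on_product_bound:
  assumes "hoelder2_on 0 1 \<alpha> g" "hoelder2_on 0 1 \<beta> h" "B \<ge> 0"
    "\<And>s t. 0 \<le> s \<Longrightarrow> s < t \<Longrightarrow> t \<le> 1 \<Longrightarrow> norm (f s t) \<le> B * (norm (g s t) * norm (h s t))"
  shows "hoelder2_on 0 1 (\<alpha> + \<beta>) f"
proof -
  obtain C where C: "C \<ge> 0" "\<And>s t. 0 \<le> s \<Longrightarrow> s < t \<Longrightarrow> t \<le> 1 \<Longrightarrow> norm (g s t) \<le> C * (t - s) powr \<alpha>"
    using assms(1) by (rule hoelder2_onE) blast
  obtain D where D: "D \<ge> 0" "\<And>s t. 0 \<le> s \<Longrightarrow> s < t \<Longrightarrow> t \<le> 1 \<Longrightarrow> norm (h s t) \<le> D * (t - s) powr \<beta>"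
    using assms(2) by (rule hoelder2_onE) blast
  show ?thesis
  proof (rule hoelder2_onI[where C = "B * (C * D)"])
    fix s t :: real assume st: "0 \<le> s" "s < t" "t \<le> 1"
    have "norm (f s t) \<le> B * (norm (g s t) * norm (h s t))"
      by (rule assms(4)[OF st])
    also have "\<dots> \<le> B * ((C * (t - s) powr \<alpha>) * (D * (t - s) powr \<beta>))"
      using C D st assms(3) by (intro mult_left_mono mult_mono) auto
    finally show "norm (f s t) \<le> B * (C * D) * (t - s) powr (\<alpha> + \<beta>)"
      by (simp add: powr_add mult_ac)
  qed
qed

lemma hoelder2_on_bound:
  assumes "hoelder2_on 0 1 \<alpha> g" "B \<ge> 0"
    "\<And>s t. 0 \<le> s \<Longrightarrow> s < t \<Longrightarrow> t \<le> 1 \<Longrightarrow> norm (f s t) \<le> B * norm (g s t)"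
  shows "hoelder2_on 0 1 \<alpha> f"
proof -
  have "hoelder2_on 0 1 0 (\<lambda>s t. 1 :: real)"
    by (rule hoelder2_onI[where C = 1]) simp
  then have "hoelder2_on 0 1 (\<alpha> + 0) f"
    by (rule hoelder2_on_product_bound[OF assms(1) _ assms(2)]) (use assms(3) in simp)
  then show ?thesis by simp
qed

lemma hoelder2_on_mono:
  assumes "hoelder2_on 0 1 \<beta> g" "\<alpha> \<le> \<beta>"
  shows "hoelder2_on 0 1 \<alpha> g"
proof -
  obtain C where C: "C \<ge> 0" "\<And>s t. 0 \<le> s \<Longrightarrow> s < t \<Longrightarrow> t \<le> 1 \<Longrightarrow> norm (g s t) \<le> C * (t - s) powr \<beta>"
    using assms(1) by (rule hoelder2_onE) blast
  show ?thesis
  proof (rule hoelder2_onI[where C = C])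
    fix s t :: real assume st: "0 \<le> s" "s < t" "t \<le> 1"
    then show "norm (g s t) \<le> C * (t - s) powr \<alpha>"
      using C(2)[OF st] mult_left_mono[OF powr_mono'[OF assms(2), of "t - s"] C(1)] by simp
  qed
qed

text \<open>\<open>ctrl\<close> without extensionality, so that it applies to auxiliary paths that
  are not restricted to [0,1], such as compositions and products with operators.\<close>

definition controlled ::
    "real \<Rightarrow> (real \<Rightarrow> real^'d) \<Rightarrow> ('d::finite, 'e::real_normed_vector) cpath \<Rightarrow> bool" where
  "controlled \<alpha> W U \<longleftrightarrow> hoelder_on 0 1 \<alpha> (fst U) \<and> hoelder_on 0 1 \<alpha> (snd U) \<and>
     hoelder2_on 0 1 (2 * \<alpha>) (remainder W U)"

lemma remainder_diag [simp]: "remainder W U s s = 0"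
  by (simp add: remainder_def blinfun.zero_right)

text \<open>The increment of the path is Y'_s W_{s,t} plus the remainder, of orders \<alpha> and
  2\<alpha>, so its own Hoelder regularity comes for free.\<close>

lemma controlledI:
  assumes "hoelder_on 0 1 \<alpha> W" "0 \<le> \<alpha>" "hoelder_on 0 1 \<alpha> (snd U)" "hoelder2_on 0 1 (2 * \<alpha>) (remainder W U)"
  shows "controlled \<alpha> W U"
proof -
  obtain B where B: "B \<ge> 0" "\<And>t. t \<in> {0..1} \<Longrightarrow> norm (snd U t) \<le> B"
    using hoelder_on_bounded[OF assms(3,2)] by metis
  have "hoelder2_on 0 1 \<alpha> (\<lambda>s t. snd U s (W t - W s))"
  proof (rule hoelder2_on_bound[OF assms(1)[unfolded hoelder_on_def] B(1)])
    fix s t :: real assume "0 \<le> s" "s < t" "t \<le> 1"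
    then have "norm (snd U s) * norm (W t - W s) \<le> B * norm (W t - W s)"
      using B by (intro mult_right_mono) auto
    then show "norm (snd U s (W t - W s)) \<le> B * norm (W t - W s)"
      using norm_blinfun[of "snd U s" "W t - W s"] by linarith
  qed
  moreover have "hoelder2_on 0 1 \<alpha> (remainder W U)"
    using assms(2,4) by (elim hoelder2_on_mono) simp
  ultimately have "hoelder2_on 0 1 \<alpha> (\<lambda>s t. snd U s (W t - W s) + remainder W U s t)"
    by (rule hoelder2_on_add)
  then show ?thesis
    using assms by (simp add: controlled_def hoelder_on_def remainder_def)
qed

text \<open>Expansion of both vectors in the standard basis. By this identity the tensor in Chen's
  relation becomes a repeated application of the Gubinelli derivative.\<close>

lemma tapply_tensor: "tapply Z (tensor a b) = Z a b"
proof -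
  have ex: "(\<Sum>i\<in>UNIV. (x $ i) *\<^sub>R axis i 1) = x" for x :: "real^'d"
    using basis_expansion[of x] by (simp add: scalar_mult_eq_scaleR)
  have "Z a b = Z (\<Sum>i\<in>UNIV. (a $ i) *\<^sub>R axis i 1) (\<Sum>j\<in>UNIV. (b $ j) *\<^sub>R axis j 1)"
    by (simp only: ex)
  also have "\<dots> = (\<Sum>j\<in>UNIV. \<Sum>i\<in>UNIV. (b $ j) *\<^sub>R (a $ i) *\<^sub>R Z (axis i 1) (axis j 1))"
    by (simp add: blinfun.sum_right blinfun.sum_left blinfun.scaleR_right blinfun.scaleR_left scaleR_sum_right)
  also have "\<dots> = (\<Sum>i\<in>UNIV. \<Sum>j\<in>UNIV. (b $ j) *\<^sub>R (a $ i) *\<^sub>R Z (axis i 1) (axis j 1))"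
    by (rule sum.swap)
  also have "\<dots> = tapply Z (tensor a b)"
    by (simp add: tapply_def tensor_def mult.commute)
  finally show ?thesis by simp
qed

lemma tapply_add_right: "tapply Z (m + n) = tapply Z m + tapply Z n"
  by (simp add: tapply_def sum.distrib scaleR_add_left)

lemma tapply_diff_left: "tapply (Z - Z') m = tapply Z m - tapply Z' m"
  by (simp add: tapply_def sum_subtractf scaleR_diff_right blinfun.diff_left)

lemma tapply_zero_left [simp]: "tapply 0 m = 0"
  by (simp add: tapply_def)

lemma norm_tapply:
  fixes Z :: "(real^'d::finite) \<Rightarrow>\<^sub>L ((real^'d) \<Rightarrow>\<^sub>L 'e::real_normed_vector)"
  shows "norm (tapply Z m) \<le> (real CARD('d))\<^sup>2 * (norm Z * norm m)"
proof -
  have "norm (tapply Z m) \<le> (\<Sum>i\<in>(UNIV::'d set). \<Sum>j\<in>(UNIV::'d set). norm m * norm Z)"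
    unfolding tapply_def
  proof (intro sum_norm_le)
    fix i j :: 'd
    have "norm (m $ i $ j) \<le> norm m"
      using Finite_Cartesian_Product.norm_nth_le[of "m $ i" j] Finite_Cartesian_Product.norm_nth_le[of m i] by linarith
    moreover have "norm (Z (axis i 1) (axis j 1)) \<le> norm Z"
    proof -
      have "norm (Z (axis i 1) (axis j 1)) \<le> norm (Z (axis i 1)) * norm (axis j (1::real))"
        by (rule norm_blinfun)
      also have "norm (Z (axis i 1)) \<le> norm Z * norm (axis i (1::real))"
        by (rule norm_blinfun)
      finally show ?thesis by (simp add: norm_axis_1)
    qed
    ultimately show "norm ((m $ i $ j) *\<^sub>R Z (axis i 1) (axis j 1)) \<le> norm m * norm Z"
      unfolding norm_scaleR by (intro mult_mono) auto
  qed
  then show ?thesis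
    by (simp add: power2_eq_square mult_ac)
qed

text \<open>Sewing with the compensated germ: its defect has order 3\<alpha> > 1. The integral is
  obtained as an increment of one function I, hence is additive in the interval.\<close>

lemma rough_integral_exists:
  fixes Z :: "('d::finite, (real^'d) \<Rightarrow>\<^sub>L 'e::banach) cpath"
  assumes "rough_path_on 0 1 \<alpha> \<W>" "1/3 < \<alpha>" "controlled \<alpha> (fst \<W>) Z"
  obtains I K where "K \<ge> 0"
    "\<And>s t. 0 \<le> s \<Longrightarrow> s \<le> t \<Longrightarrow> t \<le> 1 \<Longrightarrow> has_rough_integral Z \<W> s t (I t - I s)"
    "\<And>s t. 0 \<le> s \<Longrightarrow> s \<le> t \<Longrightarrow> t \<le> 1 \<Longrightarrow>
       norm (I t - I s - (fst Z s (fst \<W> t - fst \<W> s) + tapply (snd Z s) (snd \<W> s t))) \<le> K * (t - s) powr (3 * \<alpha>)"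
proof -
  obtain W WW where WW: "\<W> = (W, WW)" by (cases \<W>)
  have hW: "hoelder_on 0 1 \<alpha> W" and hWW: "hoelder2_on 0 1 (2 * \<alpha>) WW"
    and chen: "\<And>s u t. 0 \<le> s \<Longrightarrow> s \<le> u \<Longrightarrow> u \<le> t \<Longrightarrow> t \<le> 1 \<Longrightarrow>
        WW s t - WW s u - WW u t = tensor (W u - W s) (W t - W u)"
    using assms(1) by (auto simp: rough_path_on_def WW)
  \<comment> \<open>Chen's relation at s = u = t; the Hoelder bound of the second level does not see
    the diagonal.\<close>
  have WW0: "WW s s = 0" if "s \<in> {0..1}" for s
    using chen[of s s s] that by (simp add: tensor_def vec_eq_iff)
  obtain CW where CW: "CW \<ge> 0" "\<And>s t. 0 \<le> s \<Longrightarrow> s \<le> t \<Longrightarrow> t \<le> 1 \<Longrightarrow> norm (W t - W s) \<le> CW * (t - s) powr \<alpha>"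
    using hW by (rule hoelder_onE) blast
  obtain CWW where CWW': "CWW \<ge> 0" "\<And>s t. 0 \<le> s \<Longrightarrow> s < t \<Longrightarrow> t \<le> 1 \<Longrightarrow> norm (WW s t) \<le> CWW * (t - s) powr (2 * \<alpha>)"
    using hWW by (rule hoelder2_onE) blast
  have CWW: "norm (WW s t) \<le> CWW * (t - s) powr (2 * \<alpha>)" if "0 \<le> s" "s \<le> t" "t \<le> 1" for s t
    using CWW'(2)[of s t] WW0[of s] that by (cases "s = t") auto
  obtain CZ where CZ: "CZ \<ge> 0" "\<And>s t. 0 \<le> s \<Longrightarrow> s \<le> t \<Longrightarrow> t \<le> 1 \<Longrightarrow> norm (snd Z t - snd Z s) \<le> CZ * (t - s) powr \<alpha>"
    using assms(3) unfolding controlled_def by (metis hoelder_onE)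
  obtain CR where CR: "CR \<ge> 0" "\<And>s t. 0 \<le> s \<Longrightarrow> s \<le> t \<Longrightarrow> t \<le> 1 \<Longrightarrow> norm (remainder W Z s t) \<le> CR * (t - s) powr (2 * \<alpha>)"
  proof -
    have "hoelder2_on 0 1 (2 * \<alpha>) (remainder W Z)"
      using assms(3) by (simp add: controlled_def WW)
    then show ?thesis
      by (rule hoelder2_on_leE) (use that in auto)
  qed
  define \<Xi> where "\<Xi> s t = fst Z s (W t - W s) + tapply (snd Z s) (WW s t)" for s t
  define C where "C = CR * CW + (real CARD('d))\<^sup>2 * (CZ * CWW)"
  interpret sewing \<Xi> C "3 * \<alpha>"
  proof
    show "1 < 3 * \<alpha>" using assms(2) by simp
    show "0 \<le> C" using CR CW CZ CWW'(1) by (simp add: C_def)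
    fix s u t :: real assume o: "0 \<le> s" "s \<le> u" "u \<le> t" "t \<le> 1"
    have pm: "(u - s) powr a \<le> (t - s) powr a" "(t - u) powr a \<le> (t - s) powr a" if "a \<ge> 0" for a
      using o that by (auto intro!: powr_mono2)
    have pw: "(t - s) powr (2 * \<alpha>) * (t - s) powr \<alpha> = (t - s) powr (3 * \<alpha>)"
      by (simp flip: powr_add)
    have e: "WW s t = WW s u + (WW u t + tensor (W u - W s) (W t - W u))"
      using chen[OF o] by (simp add: algebra_simps)
    \<comment> \<open>Chen's relation cancels Y'_s applied to W_{s,u} and W_{u,t}. What is left are
      products of orders 2\<alpha> and \<alpha>: remainder times path increment, and derivative
      increment times second level.\<close>
    have "\<Xi> s t - \<Xi> s u - \<Xi> u t = - (remainder W Z s u (W t - W u) + tapply (snd Z u - snd Z s) (WW u t))"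
      unfolding \<Xi>_def remainder_def e tapply_add_right tapply_tensor tapply_diff_left
      by (simp add: blinfun.diff_left blinfun.diff_right blinfun.add_left algebra_simps)
    then have "norm (\<Xi> s t - \<Xi> s u - \<Xi> u t) \<le> norm (remainder W Z s u (W t - W u)) + norm (tapply (snd Z u - snd Z s) (WW u t))"
      by (simp only: norm_minus_cancel norm_triangle_ineq)
    also have "norm (remainder W Z s u (W t - W u)) \<le> norm (remainder W Z s u) * norm (W t - W u)"
      by (rule norm_blinfun)
    also have "\<dots> \<le> (CR * (t - s) powr (2 * \<alpha>)) * (CW * (t - s) powr \<alpha>)"
    proof (intro mult_mono)
      show "norm (remainder W Z s u) \<le> CR * (t - s) powr (2 * \<alpha>)"
        using CR(2)[of s u] o mult_left_mono[OF pm(1)[of "2 * \<alpha>"] CR(1)] assms(2) by simp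
      show "norm (W t - W u) \<le> CW * (t - s) powr \<alpha>"
        using CW(2)[of u t] o mult_left_mono[OF pm(2)[of \<alpha>] CW(1)] assms(2) by simp
    qed (use CR CW in auto)
    also have "norm (tapply (snd Z u - snd Z s) (WW u t)) \<le> (real CARD('d))\<^sup>2 * (norm (snd Z u - snd Z s) * norm (WW u t))"
      by (rule norm_tapply)
    also have "\<dots> \<le> (real CARD('d))\<^sup>2 * ((CZ * (t - s) powr \<alpha>) * (CWW * (t - s) powr (2 * \<alpha>)))"
    proof (intro mult_left_mono mult_mono)
      show "norm (snd Z u - snd Z s) \<le> CZ * (t - s) powr \<alpha>"
        using CZ(2)[of s u] o mult_left_mono[OF pm(1)[of \<alpha>] CZ(1)] assms(2) by simp
      show "norm (WW u t) \<le> CWW * (t - s) powr (2 * \<alpha>)"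
        using CWW[of u t] o mult_left_mono[OF pm(2)[of "2 * \<alpha>"] CWW'(1)] assms(2) by simp
    qed (use CZ CWW'(1) in auto)
    also have "(CR * (t - s) powr (2 * \<alpha>)) * (CW * (t - s) powr \<alpha>) + (real CARD('d))\<^sup>2 * ((CZ * (t - s) powr \<alpha>) * (CWW * (t - s) powr (2 * \<alpha>)))
       = C * (t - s) powr (3 * \<alpha>)"
      unfolding pw[symmetric] C_def by (simp add: algebra_simps)
    finally show "norm (\<Xi> s t - \<Xi> s u - \<Xi> u t) \<le> C * (t - s) powr (3 * \<alpha>)"
      by simp
  qed
  show ?thesis
  proof (rule that[of K sewn])
    show "has_rough_integral Z \<W> s t (sewn t - sewn s)" if "0 \<le> s" "s \<le> t" "t \<le> 1" for s t
      unfolding has_rough_integral_def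
      using sewn_partition_limit[OF that] by (simp add: \<Xi>_def WW)
    show "norm (sewn t - sewn s - (fst Z s (fst \<W> t - fst \<W> s) + tapply (snd Z s) (snd \<W> s t))) \<le> K * (t - s) powr (3 * \<alpha>)"
      if "0 \<le> s" "s \<le> t" "t \<le> 1" for s t
      using sewn_germ[OF that] by (simp add: \<Xi>_def WW)
  qed (rule K_nonneg)
qed

lemma blinfun_postcomp_apply:
  "blinfun_apply (Blinfun (\<lambda>v. T o\<^sub>L blinfun_apply Z v)) v = T o\<^sub>L Z v"
proof -
  have "bounded_linear (\<lambda>v. T o\<^sub>L blinfun_apply Z v)"
    by (rule bounded_linear_compose[OF bounded_bilinear.bounded_linear_right[OF bounded_bilinear_blinfun_compose]
          blinfun.bounded_linear_right])
  then show ?thesis by (simp add: bounded_linear_Blinfun_apply)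
qed

text \<open>A fixed operator commutes with each compensated Riemann sum, hence with the
  limit.\<close>

lemma has_rough_integral_linear:
  fixes Y :: "('d::finite, (real^'d) \<Rightarrow>\<^sub>L (real^'n)) cpath"
  assumes "has_rough_integral (op_mult T Y) \<W> s t J"
  shows "has_rough_integral (op_mult (\<lambda>r. L o\<^sub>L T r) Y) \<W> s t (L J)"
  unfolding has_rough_integral_def
proof (intro allI impI)
  fix e :: real assume "e > 0"
  define \<sigma> where "\<sigma> Z N p = (\<Sum>i<N. fst Z (p i) (fst \<W> (p (Suc i)) - fst \<W> (p i)) +
                      tapply (snd Z (p i)) (snd \<W> (p i) (p (Suc i))))"
    for Z :: "('d::finite, (real^'d) \<Rightarrow>\<^sub>L (real^'n)) cpath" and N and p :: "nat \<Rightarrow> real"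
  have lin: "\<sigma> (op_mult (\<lambda>r. L o\<^sub>L T r) Y) N p = L (\<sigma> (op_mult T Y) N p)" for N p
    by (simp add: \<sigma>_def op_mult_def tapply_def blinfun_postcomp_apply blinfun.sum_right blinfun.add_right
       blinfun.scaleR_right sum.distrib)
  \<comment> \<open>Adding 1 to the norm keeps the denominator positive for L = 0.\<close>
  have "e / (norm L + 1) > 0" using \<open>e > 0\<close> by (simp add: add_nonneg_pos)
  then obtain d where d: "d > 0" "\<And>N p. is_partition s t N p \<and> (\<forall>i<N. p (Suc i) - p i < d) \<Longrightarrow>
      norm (\<sigma> (op_mult T Y) N p - J) < e / (norm L + 1)"
    using assms[unfolded has_rough_integral_def] unfolding \<sigma>_def[symmetric] by meson
  have "norm (\<sigma> (op_mult (\<lambda>r. L o\<^sub>L T r) Y) N p - L J) < e"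
    if "is_partition s t N p \<and> (\<forall>i<N. p (Suc i) - p i < d)" for N p
  proof -
    have "norm (\<sigma> (op_mult (\<lambda>r. L o\<^sub>L T r) Y) N p - L J) = norm (L (\<sigma> (op_mult T Y) N p - J))"
      by (simp add: lin blinfun.diff_right)
    also have "\<dots> \<le> norm L * norm (\<sigma> (op_mult T Y) N p - J)"
      by (rule norm_blinfun)
    also have "\<dots> \<le> norm L * (e / (norm L + 1))"
      using d(2)[OF that] by (intro mult_left_mono) auto
    also have "\<dots> < e"
    proof -
      have "0 < norm L + 1" by (simp add: add_nonneg_pos)
      then show ?thesis using \<open>e > 0\<close> by (simp add: pos_divide_less_eq algebra_simps)
    qed
    finally show ?thesis .
  qed
  then show "\<exists>\<delta>>0. \<forall>N p. is_partition s t N p \<and> (\<forall>i<N. p (Suc i) - p i < \<delta>) \<longrightarrow>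
      norm ((\<Sum>i<N. fst (op_mult (\<lambda>r. L o\<^sub>L T r) Y) (p i) (fst \<W> (p (Suc i)) - fst \<W> (p i)) +
         tapply (snd (op_mult (\<lambda>r. L o\<^sub>L T r) Y) (p i)) (snd \<W> (p i) (p (Suc i)))) - L J) < e"
    using d(1) unfolding \<sigma>_def by blast
qed

text \<open>The cut-off factor depends on the path as a whole but not on time, so \<open>chi\<close>
  is a plain scalar multiple as far as regularity is concerned.\<close>

lemma controlled_scaleR:
  assumes "controlled \<alpha> W U"
  shows "controlled \<alpha> W (\<lambda>t. c *\<^sub>R fst U t, \<lambda>t. c *\<^sub>R snd U t)"
  unfolding controlled_def hoelder_on_def
proof (intro conjI)
  let ?V = "(\<lambda>t. c *\<^sub>R fst U t, \<lambda>t. c *\<^sub>R snd U t)"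
  note U = assms[unfolded controlled_def hoelder_on_def]
  show "hoelder2_on 0 1 \<alpha> (\<lambda>s t. fst ?V t - fst ?V s)"
    by (rule hoelder2_on_bound[OF conjunct1[OF U], of "\<bar>c\<bar>"]) (simp_all flip: scaleR_diff_right)
  show "hoelder2_on 0 1 \<alpha> (\<lambda>s t. snd ?V t - snd ?V s)"
    by (rule hoelder2_on_bound[OF conjunct1[OF conjunct2[OF U]], of "\<bar>c\<bar>"]) (simp_all flip: scaleR_diff_right)
  have "remainder W ?V s t = c *\<^sub>R remainder W U s t" for s t
    by (simp add: remainder_def blinfun.scaleR_left scaleR_diff_right)
  then show "hoelder2_on 0 1 (2 * \<alpha>) (remainder W ?V)"
    by (intro hoelder2_on_bound[OF conjunct2[OF conjunct2[OF U]], of "\<bar>c\<bar>"]) simp_all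
qed

section \<open>Composition with smooth maps and products with operator-valued paths\<close>

lemma C1b_has_derivative: "C1b g \<Longrightarrow> (g has_derivative Dop g x) (at x)"
  unfolding C1b_def Dop_def using frechet_derivative_works has_derivative_bounded_linear
  by (metis bounded_linear_Blinfun_apply)

lemma C1b_lipschitz:
  assumes "C1b g"
  obtains L where "L \<ge> 0" "\<And>x. norm (Dop g x) \<le> L" "\<And>x y. norm (g x - g y) \<le> L * norm (x - y)"
proof -
  obtain L where L: "\<And>x. norm (Dop g x) \<le> L"
    using assms unfolding C1b_def bounded_iff by blast
  show thesis
  proof (rule that)
    show "L \<ge> 0" using L[of 0] norm_ge_zero order_trans by blast
    show "norm (g x - g y) \<le> L * norm (x - y)" for x y
      by (rule differentiable_bound[of UNIV g "\<lambda>x. Dop g x"])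
        (use C1b_has_derivative[OF assms] L in \<open>auto simp flip: norm_blinfun.rep_eq\<close>)
  qed (rule L)
qed

text \<open>Mean value bound for g minus its linearization at x along the segment: the derivative of
  that difference is at most L |y - x| there, which makes the error quadratic.\<close>

lemma taylor_first_order:
  assumes "C1b g" "\<And>x y. norm (Dop g x - Dop g y) \<le> L * norm (x - y)" "L \<ge> 0"
  shows "norm (g y - g x - Dop g x (y - x)) \<le> L * (norm (y - x) * norm (y - x))"
proof -
  have "norm (g y - g x - Dop g x (y - x)) \<le> norm (y - x) * (L * norm (y - x))"
  proof (rule differentiable_bound_linearization[where S = "closed_segment x y" and f' = "\<lambda>z. Dop g z"])
    show "x + t *\<^sub>R (y - x) \<in> closed_segment x y" if "t \<in> {0..1}" for t
      using that unfolding closed_segment_def by (auto simp: algebra_simps intro!: exI[of _ t])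
    show "(g has_derivative Dop g z) (at z within closed_segment x y)" for z
      using C1b_has_derivative[OF assms(1)] by (rule has_derivative_at_withinI)
    show "onorm (blinfun_apply (Dop g z) - blinfun_apply (Dop g x)) \<le> L * norm (y - x)"
      if "z \<in> closed_segment x y" for z
    proof -
      have "blinfun_apply (Dop g z) - blinfun_apply (Dop g x) = blinfun_apply (Dop g z - Dop g x)"
        by (simp add: fun_eq_iff blinfun.diff_left)
      then have "onorm (blinfun_apply (Dop g z) - blinfun_apply (Dop g x)) = norm (Dop g z - Dop g x)"
        by (simp add: norm_blinfun.rep_eq)
      also have "\<dots> \<le> L * norm (z - x)" by (rule assms)
      also have "\<dots> \<le> L * norm (y - x)"
        using segment_bound1[OF that] assms(3) by (intro mult_left_mono) (auto simp: norm_minus_commute)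
      finally show ?thesis .
    qed
  qed auto
  then show ?thesis by (simp add: mult_ac)
qed

text \<open>Chain rule. The remainder of g(Y) is the Taylor error, quadratic in the increment and so
  of order 2\<alpha>, plus Dg applied to the remainder of Y.\<close>

lemma controlled_compose:
  assumes "controlled \<alpha> W U" "hoelder_on 0 1 \<alpha> W" "0 \<le> \<alpha>" "C1b g" "C1b (Dop g)"
  shows "controlled \<alpha> W (\<lambda>t. g (fst U t), \<lambda>t. Dop g (fst U t) o\<^sub>L snd U t)"
proof (rule controlledI[OF assms(2,3)])
  let ?V = "(\<lambda>t. g (fst U t), \<lambda>t. Dop g (fst U t) o\<^sub>L snd U t)"
  note U = assms(1)[unfolded controlled_def hoelder_on_def]
  obtain L1 where L1: "L1 \<ge> 0" "\<And>x. norm (Dop g x) \<le> L1"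
    using C1b_lipschitz[OF assms(4)] by metis
  obtain L2 where L2: "L2 \<ge> 0" "\<And>x y. norm (Dop g x - Dop g y) \<le> L2 * norm (x - y)"
    using C1b_lipschitz[OF assms(5)] by metis
  obtain B where B: "B \<ge> 0" "\<And>t. t \<in> {0..1} \<Longrightarrow> norm (snd U t) \<le> B"
    using assms(1,3) unfolding controlled_def by (metis hoelder_on_bounded)
  show "hoelder_on 0 1 \<alpha> (snd ?V)"
  proof -
    have "hoelder2_on 0 1 \<alpha> (\<lambda>s t. (Dop g (fst U t) - Dop g (fst U s)) o\<^sub>L snd U t)"
    proof (rule hoelder2_on_bound[OF conjunct1[OF U], of "L2 * B"])
      fix s t :: real assume "0 \<le> s" "s < t" "t \<le> 1"
      then have "norm (Dop g (fst U t) - Dop g (fst U s)) * norm (snd U t) \<le> (L2 * norm (fst U t - fst U s)) * B"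
        using B L2 by (intro mult_mono) auto
      then show "norm ((Dop g (fst U t) - Dop g (fst U s)) o\<^sub>L snd U t) \<le> L2 * B * norm (fst U t - fst U s)"
        using norm_blinfun_compose[of "Dop g (fst U t) - Dop g (fst U s)" "snd U t"] by (simp add: mult_ac)
    qed (use L2 B in simp)
    moreover have "hoelder2_on 0 1 \<alpha> (\<lambda>s t. Dop g (fst U s) o\<^sub>L (snd U t - snd U s))"
    proof (rule hoelder2_on_bound[OF conjunct1[OF conjunct2[OF U]], of L1])
      fix s t :: real
      have "norm (Dop g (fst U s)) * norm (snd U t - snd U s) \<le> L1 * norm (snd U t - snd U s)"
        using L1 by (intro mult_right_mono) auto
      then show "norm (Dop g (fst U s) o\<^sub>L (snd U t - snd U s)) \<le> L1 * norm (snd U t - snd U s)"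
        using norm_blinfun_compose[of "Dop g (fst U s)" "snd U t - snd U s"] by simp
    qed (use L1 in simp)
    ultimately have "hoelder2_on 0 1 \<alpha> (\<lambda>s t. ((Dop g (fst U t) - Dop g (fst U s)) o\<^sub>L snd U t) + (Dop g (fst U s) o\<^sub>L (snd U t - snd U s)))"
      by (rule hoelder2_on_add)
    moreover have "(\<lambda>s t. ((Dop g (fst U t) - Dop g (fst U s)) o\<^sub>L snd U t) + (Dop g (fst U s) o\<^sub>L (snd U t - snd U s)))
       = (\<lambda>s t. snd ?V t - snd ?V s)"
      by (auto simp: fun_eq_iff blinfun.diff_left blinfun.diff_right blinfun.add_left intro!: blinfun_eqI)
    ultimately show ?thesis
      by (simp add: hoelder_on_def)
  qed
  show "hoelder2_on 0 1 (2 * \<alpha>) (remainder W ?V)"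
  proof -
    have "hoelder2_on 0 1 (\<alpha> + \<alpha>) (\<lambda>s t. g (fst U t) - g (fst U s) - Dop g (fst U s) (fst U t - fst U s))"
      by (rule hoelder2_on_product_bound[OF conjunct1[OF U] conjunct1[OF U] L2(1)])
         (rule taylor_first_order[OF assms(4) L2(2,1)])
    then have "hoelder2_on 0 1 (2 * \<alpha>) (\<lambda>s t. g (fst U t) - g (fst U s) - Dop g (fst U s) (fst U t - fst U s))"
      by (simp only: mult_2)
    moreover have "hoelder2_on 0 1 (2 * \<alpha>) (\<lambda>s t. Dop g (fst U s) (remainder W U s t))"
    proof (rule hoelder2_on_bound[OF conjunct2[OF conjunct2[OF U]] L1(1)])
      fix s t :: real
      have "norm (Dop g (fst U s)) * norm (remainder W U s t) \<le> L1 * norm (remainder W U s t)"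
        using L1 by (intro mult_right_mono) auto
      then show "norm (Dop g (fst U s) (remainder W U s t)) \<le> L1 * norm (remainder W U s t)"
        using norm_blinfun[of "Dop g (fst U s)" "remainder W U s t"] by simp
    qed
    ultimately have "hoelder2_on 0 1 (2 * \<alpha>) (\<lambda>s t. (g (fst U t) - g (fst U s) - Dop g (fst U s) (fst U t - fst U s)) + Dop g (fst U s) (remainder W U s t))"
      by (rule hoelder2_on_add)
    moreover have "(\<lambda>s t. (g (fst U t) - g (fst U s) - Dop g (fst U s) (fst U t - fst U s)) + Dop g (fst U s) (remainder W U s t)) = remainder W ?V"
      by (simp add: fun_eq_iff remainder_def blinfun.diff_right)
    ultimately show ?thesis by simp
  qed
qed

text \<open>A Lipschitz factor has increments of order 1, and 1 \<ge> 2\<alpha> since \<alpha> \<le>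
  1/2. They can therefore be put into the remainder and leave no trace in the Gubinelli
  derivative.\<close>

lemma controlled_op_mult:
  fixes Y :: "('d::finite, (real^'d) \<Rightarrow>\<^sub>L (real^'n)) cpath"
  assumes "controlled \<alpha> W Y" "hoelder_on 0 1 \<alpha> W" "0 \<le> \<alpha>" "\<alpha> \<le> 1 / 2" "L \<ge> 0"
    "\<And>s t. s \<in> {0..1} \<Longrightarrow> t \<in> {0..1} \<Longrightarrow> norm (T t - T s) \<le> L * \<bar>t - s\<bar>"
  shows "controlled \<alpha> W (op_mult T Y)"
proof (rule controlledI[OF assms(2,3)])
  note Y = assms(1)[unfolded controlled_def hoelder_on_def]
  have hT: "hoelder2_on 0 1 1 (\<lambda>s t. T t - T s)"
  proof (rule hoelder2_onI[where C = L])
    show "norm (T t - T s) \<le> L * (t - s) powr 1" if "0 \<le> s" "s < t" "t \<le> 1" for s t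
      using assms(6)[of s t] that by simp
  qed
  have hT': "hoelder2_on 0 1 a (\<lambda>s t. T t - T s)" if "a \<le> 1" for a
    using hT that by (rule hoelder2_on_mono)
  have "hoelder_on 0 1 1 T" using hT by (simp add: hoelder_on_def)
  then obtain BT where BT: "BT \<ge> 0" "\<And>t. t \<in> {0..1} \<Longrightarrow> norm (T t) \<le> BT"
    using hoelder_on_bounded[of 1 T] by auto
  obtain B where B: "B \<ge> 0" "\<And>t. t \<in> {0..1} \<Longrightarrow> norm (fst Y t) \<le> B"
    using assms(1,3) unfolding controlled_def by (metis hoelder_on_bounded)
  obtain B' where B': "B' \<ge> 0" "\<And>t. t \<in> {0..1} \<Longrightarrow> norm (snd Y t) \<le> B'"
    using assms(1,3) unfolding controlled_def by (metis hoelder_on_bounded)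
  show "hoelder_on 0 1 \<alpha> (snd (op_mult T Y))"
  proof -
    \<comment> \<open>Postcomposition as a bounded bilinear operation, so that the increment of the
      product splits into one increment per factor.\<close>
    define c where "c T Z = Blinfun (\<lambda>v. T o\<^sub>L blinfun_apply Z v)"
      for T :: "(real^'n) \<Rightarrow>\<^sub>L (real^'n)" and Z :: "(real^'d) \<Rightarrow>\<^sub>L ((real^'d) \<Rightarrow>\<^sub>L (real^'n))"
    have c_apply: "c T Z v = T o\<^sub>L Z v" for T Z v
      by (simp add: c_def blinfun_postcomp_apply)
    have nc: "norm (c T Z) \<le> norm T * norm Z" for T Z
    proof (rule norm_blinfun_bound)
      fix v :: "real^'d"
      have "norm (c T Z v) \<le> norm T * norm (Z v)"
        unfolding c_apply by (rule norm_blinfun_compose)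
      also have "\<dots> \<le> norm T * (norm Z * norm v)"
        by (intro mult_left_mono norm_blinfun) auto
      finally show "norm (c T Z v) \<le> norm T * norm Z * norm v" by (simp add: mult_ac)
    qed auto
    have "hoelder2_on 0 1 \<alpha> (\<lambda>s t. c (T t - T s) (snd Y t))"
    proof (rule hoelder2_on_bound[OF hT'[of \<alpha>] B'(1)])
      fix s t :: real assume "0 \<le> s" "s < t" "t \<le> 1"
      then have "norm (T t - T s) * norm (snd Y t) \<le> norm (T t - T s) * B'"
        using B' by (intro mult_left_mono) auto
      then show "norm (c (T t - T s) (snd Y t)) \<le> B' * norm (T t - T s)"
        using nc[of "T t - T s" "snd Y t"] by (simp add: mult_ac)
    qed (use assms in simp)
    moreover have "hoelder2_on 0 1 \<alpha> (\<lambda>s t. c (T s) (snd Y t - snd Y s))"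
    proof (rule hoelder2_on_bound[OF conjunct1[OF conjunct2[OF Y]] BT(1)])
      fix s t :: real assume "0 \<le> s" "s < t" "t \<le> 1"
      then have "norm (T s) * norm (snd Y t - snd Y s) \<le> BT * norm (snd Y t - snd Y s)"
        using BT by (intro mult_right_mono) auto
      then show "norm (c (T s) (snd Y t - snd Y s)) \<le> BT * norm (snd Y t - snd Y s)"
        using nc[of "T s" "snd Y t - snd Y s"] by simp
    qed
    ultimately have "hoelder2_on 0 1 \<alpha> (\<lambda>s t. c (T t - T s) (snd Y t) + c (T s) (snd Y t - snd Y s))"
      by (rule hoelder2_on_add)
    moreover have "(\<lambda>s t. c (T t - T s) (snd Y t) + c (T s) (snd Y t - snd Y s)) =
       (\<lambda>s t. snd (op_mult T Y) t - snd (op_mult T Y) s)"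
      unfolding op_mult_def snd_conv c_def[symmetric]
      by (auto simp: fun_eq_iff blinfun.diff_left blinfun.diff_right blinfun.add_left c_apply intro!: blinfun_eqI)
    ultimately show ?thesis
      by (simp add: hoelder_on_def)
  qed
  show "hoelder2_on 0 1 (2 * \<alpha>) (remainder W (op_mult T Y))"
  proof -
    have "hoelder2_on 0 1 (2 * \<alpha>) (\<lambda>s t. (T t - T s) o\<^sub>L fst Y t)"
    proof (rule hoelder2_on_bound[OF hT'[of "2 * \<alpha>"] B(1)])
      fix s t :: real assume "0 \<le> s" "s < t" "t \<le> 1"
      then have "norm (T t - T s) * norm (fst Y t) \<le> norm (T t - T s) * B"
        using B by (intro mult_left_mono) auto
      then show "norm ((T t - T s) o\<^sub>L fst Y t) \<le> B * norm (T t - T s)"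
        using norm_blinfun_compose[of "T t - T s" "fst Y t"] by (simp add: mult_ac)
    qed (use assms in simp)
    moreover have "hoelder2_on 0 1 (2 * \<alpha>) (\<lambda>s t. T s o\<^sub>L remainder W Y s t)"
    proof (rule hoelder2_on_bound[OF conjunct2[OF conjunct2[OF Y]] BT(1)])
      fix s t :: real assume "0 \<le> s" "s < t" "t \<le> 1"
      then have "norm (T s) * norm (remainder W Y s t) \<le> BT * norm (remainder W Y s t)"
        using BT by (intro mult_right_mono) auto
      then show "norm (T s o\<^sub>L remainder W Y s t) \<le> BT * norm (remainder W Y s t)"
        using norm_blinfun_compose[of "T s" "remainder W Y s t"] by simp
    qed
    ultimately have "hoelder2_on 0 1 (2 * \<alpha>) (\<lambda>s t. ((T t - T s) o\<^sub>L fst Y t) + (T s o\<^sub>L remainder W Y s t))"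
      by (rule hoelder2_on_add)
    moreover have "(\<lambda>s t. ((T t - T s) o\<^sub>L fst Y t) + (T s o\<^sub>L remainder W Y s t)) = remainder W (op_mult T Y)"
      by (auto simp: fun_eq_iff op_mult_def remainder_def blinfun.diff_left blinfun.diff_right blinfun.add_left blinfun_postcomp_apply intro!: blinfun_eqI)
    ultimately show ?thesis by simp
  qed
qed

section \<open>The cut-off solution map\<close>

lemma hoelder2_on_cong:
  assumes "hoelder2_on 0 1 \<alpha> g" "\<And>s t. 0 \<le> s \<Longrightarrow> s < t \<Longrightarrow> t \<le> 1 \<Longrightarrow> f s t = g s t"
  shows "hoelder2_on 0 1 \<alpha> f"
  by (rule hoelder2_on_bound[OF assms(1), of 1]) (use assms(2) in auto)

lemma ctrl_iff: "U \<in> ctrl \<alpha> W \<longleftrightarrow>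
    controlled \<alpha> W U \<and> fst U \<in> extensional {0..1} \<and> snd U \<in> extensional {0..1}"
  by (auto simp: ctrl_def controlled_def)

lemma rough_path_hoelder: "rough_path_on a b \<alpha> \<W> \<Longrightarrow> hoelder_on a b \<alpha> (fst \<W>)"
  by (cases \<W>) (simp add: rough_path_on_def)

lemma rough_path_hoelder2: "rough_path_on a b \<alpha> \<W> \<Longrightarrow> hoelder2_on a b (2 * \<alpha>) (snd \<W>)"
  by (cases \<W>) (simp add: rough_path_on_def)

lemma controlled_G_cut:
  assumes "controlled \<alpha> W U" "hoelder_on 0 1 \<alpha> W" "0 \<le> \<alpha>" "cond_G G"
  shows "controlled \<alpha> W (G_cut G f \<alpha> W R U)"
proof -
  have "C1b G" "C1b (Dop G)"
    using assms(4) by (auto simp: cond_G_def C3b_def)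
  from controlled_compose[OF controlled_scaleR[OF assms(1)] assms(2,3) this]
  show ?thesis by (simp add: G_cut_def chi_def)
qed

lemma sgrp_hoelder:
  fixes A :: "real^'n^'n"
  shows "hoelder2_on 0 1 1 (\<lambda>s t. sgrp A (- t) - sgrp A (- s))"
    and "hoelder2_on 0 1 1 (\<lambda>s t. sgrp A t - sgrp A s)"
proof -
  show "hoelder2_on 0 1 1 (\<lambda>s t. sgrp A (- t) - sgrp A (- s))"
  proof (rule hoelder2_onI)
    show "norm (sgrp A (- t) - sgrp A (- s)) \<le> mnorm A * exp (2 * mnorm A) * (t - s) powr 1"
      if "0 \<le> s" "s < t" "t \<le> 1" for s t
      using norm_sgrp_diff[of "- s" "- t" A] that by simp
  qed
  show "hoelder2_on 0 1 1 (\<lambda>s t. sgrp A t - sgrp A s)"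
  proof (rule hoelder2_onI)
    show "norm (sgrp A t - sgrp A s) \<le> mnorm A * exp (2 * mnorm A) * (t - s) powr 1"
      if "0 \<le> s" "s < t" "t \<le> 1" for s t
      using norm_sgrp_diff[of s t A] that by simp
  qed
qed

lemma continuous_F_cut:
  assumes "controlled \<alpha> W U" "0 < \<alpha>" "cond_F F"
  shows "continuous_on {0..1} (F_cut F f \<alpha> W R U)"
proof -
  obtain L where L: "L-lipschitz_on UNIV F" using assms(3) by (auto simp: cond_F_def)
  have "continuous_on {0..1} (fst U)"
    using assms(1,2) by (intro hoelder_on_continuous) (auto simp: controlled_def)
  then have "continuous_on {0..1} (\<lambda>t. F (f (dnorm \<alpha> W U / R) *\<^sub>R fst U t))"
    by (intro continuous_on_compose2[OF lipschitz_on_continuous_on[OF L]] continuous_intros) auto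
  then show ?thesis by (simp add: F_cut_def chi_def)
qed

text \<open>Separation of variables: S(\<tau> - r) P = S(\<tau>) P S(-r). The r-dependent part no
  longer involves P, \<tau> or the limits of integration, so a single sewing produces one N that
  serves all the convolutions of the Lyapunov-Perron map.\<close>

lemma conv_primitive:
  fixes A :: "real^'n^'n" and \<W> :: "'d::finite rpath"
  assumes "1 / 3 < \<alpha>" "\<alpha> \<le> 1 / 2" "rough_path_on 0 1 \<alpha> \<W>" "cond_F F" "cond_G G" "controlled \<alpha> (fst \<W>) U"
  obtains N where "N 0 = 0"
    "\<And>P a b \<tau>. (\<And>t. P o\<^sub>L sgrp A t = sgrp A t o\<^sub>L P) \<Longrightarrow> 0 \<le> a \<Longrightarrow> a \<le> b \<Longrightarrow> b \<le> 1 \<Longrightarrow>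
        conv A F G f \<alpha> \<W> R P U a b \<tau> = sgrp A \<tau> (P (N b - N a))"
    "controlled \<alpha> (fst \<W>) (N, \<lambda>s. sgrp A (- s) o\<^sub>L fst (G_cut G f \<alpha> (fst \<W>) R U) s)"
proof -
  define W where "W = fst \<W>"
  define g where "g = G_cut G f \<alpha> W R U"
  define Z where "Z = op_mult (\<lambda>r. sgrp A (- r)) g"
  define h where "h = (\<lambda>r. sgrp A (- r) (F_cut F f \<alpha> W R U r))"
  have hW: "hoelder_on 0 1 \<alpha> W" using assms(3) by (simp add: W_def rough_path_hoelder)
  have g: "controlled \<alpha> W g"
    unfolding g_def using assms hW by (intro controlled_G_cut) (auto simp: W_def)
  have Z: "controlled \<alpha> W Z"
    unfolding Z_def
  proof (rule controlled_op_mult[OF g hW])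
    show "norm (sgrp A (- t) - sgrp A (- s)) \<le> (mnorm A * exp (2 * mnorm A)) * \<bar>t - s\<bar>"
      if "s \<in> {0..1}" "t \<in> {0..1}" for s t
    proof -
      have 1: "\<bar>- s\<bar> \<le> 1" "\<bar>- t - - s\<bar> \<le> 1" "\<bar>- t - - s\<bar> = \<bar>t - s\<bar>"
        using that by auto
      show ?thesis
        using norm_sgrp_diff[OF 1(1,2), of A] unfolding 1(3) .
    qed
  qed (use assms mnorm_nonneg[of A] in auto)
  have "0 \<le> \<alpha>" using assms by simp
  have h: "continuous_on {0..1} h"
    unfolding h_def
  proof (rule bounded_bilinear.continuous_on[OF bounded_bilinear_blinfun_apply])
    show "continuous_on {0..1} (\<lambda>r. sgrp A (- r))"
      using sgrp_hoelder(1)[of A] by (intro hoelder_on_continuous[of 1]) (simp_all add: hoelder_on_def)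
    show "continuous_on {0..1} (F_cut F f \<alpha> W R U)"
      using assms by (intro continuous_F_cut) (auto simp: W_def)
  qed
  obtain I K where K: "K \<ge> 0"
    and I: "\<And>s t. 0 \<le> s \<Longrightarrow> s \<le> t \<Longrightarrow> t \<le> 1 \<Longrightarrow> has_rough_integral Z \<W> s t (I t - I s)"
    "\<And>s t. 0 \<le> s \<Longrightarrow> s \<le> t \<Longrightarrow> t \<le> 1 \<Longrightarrow>
       norm (I t - I s - (fst Z s (W t - W s) + tapply (snd Z s) (snd \<W> s t))) \<le> K * (t - s) powr (3 * \<alpha>)"
    using rough_integral_exists[OF assms(3,1) Z[unfolded W_def]] unfolding W_def by metis
  define N where "N t = integral {0..t} h + (I t - I 0)" for t
  have int: "h integrable_on {a..b}" if "0 \<le> a" "b \<le> 1" for a b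
    using that by (intro integrable_continuous_real continuous_on_subset[OF h]) auto
  have N_diff: "N b - N a = integral {a..b} h + (I b - I a)" if "0 \<le> a" "a \<le> b" "b \<le> 1" for a b
    using Henstock_Kurzweil_Integration.integral_combine[OF that(1,2) int[of 0 b]] that
    by (simp add: N_def algebra_simps)
  show thesis
  proof (rule that[of N])
    show "N 0 = 0" by (simp add: N_def)
    show "conv A F G f \<alpha> \<W> R P U a b \<tau> = sgrp A \<tau> (P (N b - N a))"
      if comm: "\<And>t. P o\<^sub>L sgrp A t = sgrp A t o\<^sub>L P" and ab: "0 \<le> a" "a \<le> b" "b \<le> 1" for P a b \<tau>
    proof -
      \<comment> \<open>Commutation is used at the negative time - r, which is why it is assumed for
        all t and not only for t \<ge> 0.\<close>
      have e: "sgrp A (\<tau> - r) o\<^sub>L P = (sgrp A \<tau> o\<^sub>L P) o\<^sub>L sgrp A (- r)" for r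
      proof (rule blinfun_eqI)
        fix x
        have "P (sgrp A (- r) x) = sgrp A (- r) (P x)"
          using comm[of "- r"] by (metis blinfun_apply_blinfun_compose)
        then show "(sgrp A (\<tau> - r) o\<^sub>L P) x = ((sgrp A \<tau> o\<^sub>L P) o\<^sub>L sgrp A (- r)) x"
          using sgrp_add[of A \<tau> "- r"] by simp
      qed
      have "integral {a..b} (\<lambda>r. (sgrp A (\<tau> - r) o\<^sub>L P) (F_cut F f \<alpha> W R U r)) = integral {a..b} ((sgrp A \<tau> o\<^sub>L P) \<circ> h)"
        by (simp add: e h_def o_def)
      also have "\<dots> = (sgrp A \<tau> o\<^sub>L P) (integral {a..b} h)"
        using ab by (intro integral_linear int blinfun.bounded_linear_right) auto
      finally have 1: "integral {a..b} (\<lambda>r. (sgrp A (\<tau> - r) o\<^sub>L P) (F_cut F f \<alpha> W R U r)) = (sgrp A \<tau> o\<^sub>L P) (integral {a..b} h)" .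
      have "has_rough_integral (op_mult (\<lambda>r. (sgrp A \<tau> o\<^sub>L P) o\<^sub>L sgrp A (- r)) g) \<W> a b ((sgrp A \<tau> o\<^sub>L P) (I b - I a))"
        using I(1)[OF ab] unfolding Z_def by (rule has_rough_integral_linear)
      then have 2: "rough_integral (op_mult (\<lambda>r. sgrp A (\<tau> - r) o\<^sub>L P) g) \<W> a b = (sgrp A \<tau> o\<^sub>L P) (I b - I a)"
        unfolding e by (rule rough_integral_eqI[OF ab(2)])
      show ?thesis
        unfolding conv_def W_def[symmetric] g_def[symmetric] 1 2 N_diff[OF ab]
        by (simp add: blinfun.add_right)
    qed
    show "controlled \<alpha> (fst \<W>) (N, \<lambda>s. sgrp A (- s) o\<^sub>L fst (G_cut G f \<alpha> (fst \<W>) R U) s)"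
      unfolding W_def[symmetric] g_def[symmetric]
    proof (rule controlledI[OF hW])
      show "0 \<le> \<alpha>" using assms by simp
      have fZ: "fst Z = (\<lambda>s. sgrp A (- s) o\<^sub>L fst g s)" by (simp add: Z_def op_mult_def)
      then show "hoelder_on 0 1 \<alpha> (snd (N, \<lambda>s. sgrp A (- s) o\<^sub>L fst g s))"
        using Z by (simp add: controlled_def)
      obtain B where "\<forall>x\<in>h ` {0..1}. norm x \<le> B"
        using compact_imp_bounded[OF compact_continuous_image[OF h]] unfolding bounded_iff by auto
      then have B: "\<And>r. r \<in> {0..1} \<Longrightarrow> norm (h r) \<le> B" by blast
      obtain B' where B': "B' \<ge> 0" "\<And>t. t \<in> {0..1} \<Longrightarrow> norm (snd Z t) \<le> B'"
        using Z \<open>0 \<le> \<alpha>\<close> unfolding controlled_def by (metis hoelder_on_bounded)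
      have "hoelder2_on 0 1 1 (\<lambda>s t. integral {s..t} h)"
      proof (rule hoelder2_onI[where C = B])
        fix s t :: real assume st: "0 \<le> s" "s < t" "t \<le> 1"
        have "norm (integral {s..t} h) \<le> B * (t - s)"
          by (rule integral_bound) (use st B in \<open>auto intro: continuous_on_subset[OF h]\<close>)
        then show "norm (integral {s..t} h) \<le> B * (t - s) powr 1"
          using st by simp
      qed
      then have "hoelder2_on 0 1 (2 * \<alpha>) (\<lambda>s t. integral {s..t} h)"
        by (rule hoelder2_on_mono) (use assms in simp)
      moreover have "hoelder2_on 0 1 (3 * \<alpha>) (\<lambda>s t. I t - I s - (fst Z s (W t - W s) + tapply (snd Z s) (snd \<W> s t)))"
        by (rule hoelder2_onI[where C = K]) (use I(2) in simp)
      then have "hoelder2_on 0 1 (2 * \<alpha>) (\<lambda>s t. I t - I s - (fst Z s (W t - W s) + tapply (snd Z s) (snd \<W> s t)))"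
        by (rule hoelder2_on_mono) (use assms in simp)
      moreover have "hoelder2_on 0 1 (2 * \<alpha>) (\<lambda>s t. tapply (snd Z s) (snd \<W> s t))"
      proof (rule hoelder2_on_bound[OF rough_path_hoelder2[OF assms(3)], of "(real CARD('d))\<^sup>2 * B'"])
        fix s t :: real assume st: "0 \<le> s" "s < t" "t \<le> 1"
        have "norm (tapply (snd Z s) (snd \<W> s t)) \<le> (real CARD('d))\<^sup>2 * (norm (snd Z s) * norm (snd \<W> s t))"
          by (rule norm_tapply)
        also have "\<dots> \<le> (real CARD('d))\<^sup>2 * (B' * norm (snd \<W> s t))"
          using B' st by (intro mult_left_mono mult_right_mono) auto
        finally show "norm (tapply (snd Z s) (snd \<W> s t)) \<le> (real CARD('d))\<^sup>2 * B' * norm (snd \<W> s t)"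
          by (simp add: mult_ac)
      qed (use B' in simp)
      \<comment> \<open>The three parts of the remainder of N: the drift of order 1, the sewing
        error of order 3\<alpha> and the second-level term of order 2\<alpha>.\<close>
      ultimately have sum: "hoelder2_on 0 1 (2 * \<alpha>) (\<lambda>s t. integral {s..t} h +
          ((I t - I s - (fst Z s (W t - W s) + tapply (snd Z s) (snd \<W> s t))) + tapply (snd Z s) (snd \<W> s t)))"
        by (intro hoelder2_on_add)
      show "hoelder2_on 0 1 (2 * \<alpha>) (remainder W (N, \<lambda>s. sgrp A (- s) o\<^sub>L fst g s))"
        by (rule hoelder2_on_cong[OF sum]) (simp add: remainder_def N_diff fZ algebra_simps)
    qed
  qed
qed

lemma sgrp_cancel [simp]: "sgrp A s (sgrp A (- s) x) = x" "sgrp A (- s) (sgrp A s x) = x"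
  using sgrp_minus_cancel[of A s] sgrp_minus_cancel[of A "- s"]
  by (metis blinfun_apply_blinfun_compose blinfun_apply_id_blinfun minus_minus)+

text \<open>With P the identity, \<open>conv_primitive\<close> gives T(t) = S(t) N(t), so N(t) =
  S(-t) T(t) may be eliminated in favour of T. Regularity of T is then that of a Lipschitz operator
  path applied to the controlled path N.\<close>

lemma T_cut_facts:
  fixes A :: "real^'n^'n" and \<W> :: "'d::finite rpath"
  assumes "1 / 3 < \<alpha>" "\<alpha> \<le> 1 / 2" "rough_path_on 0 1 \<alpha> \<W>" "cond_F F" "cond_G G" "U \<in> ctrl \<alpha> (fst \<W>)"
  shows T_cut_ctrl: "T_cut A F G f \<alpha> \<W> R U \<in> ctrl \<alpha> (fst \<W>)" (is "?T \<in> _")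
    and T_cut_0: "fst (T_cut A F G f \<alpha> \<W> R U) 0 = 0"
    and conv_eq_T_cut: "(\<And>t. P o\<^sub>L sgrp A t = sgrp A t o\<^sub>L P) \<Longrightarrow> 0 \<le> a \<Longrightarrow> a \<le> b \<Longrightarrow> b \<le> 1 \<Longrightarrow>
      conv A F G f \<alpha> \<W> R P U a b \<tau> =
        sgrp A \<tau> (P (sgrp A (- b) (fst (T_cut A F G f \<alpha> \<W> R U) b) - sgrp A (- a) (fst (T_cut A F G f \<alpha> \<W> R U) a)))"
proof -
  define W where "W = fst \<W>"
  define g where "g = G_cut G f \<alpha> W R U"
  have U: "controlled \<alpha> (fst \<W>) U" using assms(6) by (simp add: ctrl_iff)
  have hW: "hoelder_on 0 1 \<alpha> W" using assms(3) by (simp add: W_def rough_path_hoelder)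
  have g: "controlled \<alpha> W g"
    unfolding g_def using assms hW U by (intro controlled_G_cut) (auto simp: W_def)
  obtain N where N0: "N 0 = 0"
    and conv: "\<And>P a b \<tau>. (\<And>t. P o\<^sub>L sgrp A t = sgrp A t o\<^sub>L P) \<Longrightarrow> 0 \<le> a \<Longrightarrow> a \<le> b \<Longrightarrow> b \<le> 1 \<Longrightarrow>
        conv A F G f \<alpha> \<W> R P U a b \<tau> = sgrp A \<tau> (P (N b - N a))"
    and N: "controlled \<alpha> W (N, \<lambda>s. sgrp A (- s) o\<^sub>L fst g s)"
    by (rule conv_primitive[OF assms(1-5) U, of A f R, folded W_def, folded g_def]) blast
  have "id_blinfun o\<^sub>L sgrp A t = sgrp A t o\<^sub>L id_blinfun" for t
    by (rule blinfun_eqI) simp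
  then have fT: "fst ?T t = sgrp A t (N t)" if "t \<in> {0..1}" for t
    using conv[of id_blinfun 0 t t] that N0 by (simp add: T_cut_def)
  have sT: "snd ?T t = fst g t" if "t \<in> {0..1}" for t
    using that by (simp add: T_cut_def g_def W_def)
  show "fst ?T 0 = 0" using fT[of 0] N0 by (simp add: blinfun.zero_right)
  show "conv A F G f \<alpha> \<W> R P U a b \<tau> = sgrp A \<tau> (P (sgrp A (- b) (fst ?T b) - sgrp A (- a) (fst ?T a)))"
    if "\<And>t. P o\<^sub>L sgrp A t = sgrp A t o\<^sub>L P" "0 \<le> a" "a \<le> b" "b \<le> 1" for P a b \<tau>
    using conv[OF that] fT[of a] fT[of b] that by simp
  have \<alpha>: "0 \<le> \<alpha>" using assms by simp
  have "hoelder_on 0 1 \<alpha> N" using N by (simp add: controlled_def)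
  then obtain B where B: "B \<ge> 0" "\<And>t. t \<in> {0..1} \<Longrightarrow> norm (N t) \<le> B"
    using \<alpha> by (metis hoelder_on_bounded)
  have "hoelder_on 0 1 1 (sgrp A)" using sgrp_hoelder(2) by (simp add: hoelder_on_def)
  then obtain BS where BS: "BS \<ge> 0" "\<And>t. t \<in> {0..1} \<Longrightarrow> norm (sgrp A t) \<le> BS"
    by (metis hoelder_on_bounded zero_le_one)
  have "controlled \<alpha> W ?T"
  proof (rule controlledI[OF hW])
    show "0 \<le> \<alpha>" using assms by simp
    have "hoelder2_on 0 1 \<alpha> (\<lambda>s t. fst g t - fst g s)"
      using g by (simp add: controlled_def hoelder_on_def)
    then show "hoelder_on 0 1 \<alpha> (snd ?T)"
      unfolding hoelder_on_def by (rule hoelder2_on_cong) (simp add: sT)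
    have "hoelder2_on 0 1 1 (\<lambda>s t. (sgrp A t - sgrp A s) (N t))"
    proof (rule hoelder2_on_bound[OF sgrp_hoelder(2) B(1)])
      fix s t :: real assume "0 \<le> s" "s < t" "t \<le> 1"
      then have "norm (sgrp A t - sgrp A s) * norm (N t) \<le> norm (sgrp A t - sgrp A s) * B"
        using B by (intro mult_left_mono) auto
      then show "norm ((sgrp A t - sgrp A s) (N t)) \<le> B * norm (sgrp A t - sgrp A s)"
        using norm_blinfun[of "sgrp A t - sgrp A s" "N t"] by (simp only: mult.commute)
    qed
    then have "hoelder2_on 0 1 (2 * \<alpha>) (\<lambda>s t. (sgrp A t - sgrp A s) (N t))"
      by (rule hoelder2_on_mono) (use assms in simp)
    moreover have "hoelder2_on 0 1 (2 * \<alpha>) (\<lambda>s t. sgrp A s (remainder W (N, \<lambda>s. sgrp A (- s) o\<^sub>L fst g s) s t))"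
      (is "hoelder2_on _ _ _ (\<lambda>s t. sgrp A s (?r s t))")
    proof (rule hoelder2_on_bound[OF _ BS(1)])
      show "hoelder2_on 0 1 (2 * \<alpha>) ?r" using N by (simp add: controlled_def)
      fix s t :: real assume "0 \<le> s" "s < t" "t \<le> 1"
      then have "norm (sgrp A s) * norm (?r s t) \<le> BS * norm (?r s t)"
        using BS by (intro mult_right_mono) auto
      then show "norm (sgrp A s (?r s t)) \<le> BS * norm (?r s t)"
        using norm_blinfun[of "sgrp A s" "?r s t"] by linarith
    qed
    ultimately have sum: "hoelder2_on 0 1 (2 * \<alpha>) (\<lambda>s t. (sgrp A t - sgrp A s) (N t) + sgrp A s (?r s t))"
      by (rule hoelder2_on_add)
    \<comment> \<open>S(s) undoes the factor S(-s) in the derivative of N, so what remains as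
      Gubinelli derivative of T is the cut-off G itself.\<close>
    show "hoelder2_on 0 1 (2 * \<alpha>) (remainder W ?T)"
      by (rule hoelder2_on_cong[OF sum])
        (simp add: remainder_def fT sT blinfun.diff_left blinfun.diff_right)
  qed
  then show "?T \<in> ctrl \<alpha> (fst \<W>)"
    by (simp add: ctrl_iff W_def T_cut_def)
qed

definition zero_path :: "('d::finite, 'e::real_normed_vector) cpath" where
  "zero_path = (\<lambda>t\<in>{0..1}. 0, \<lambda>t\<in>{0..1}. 0)"

lemma zero_path_ctrl: "zero_path \<in> ctrl \<alpha> W"
  unfolding ctrl_iff controlled_def hoelder_on_def
  by (auto simp: zero_path_def remainder_def intro!: hoelder2_onI[where C = 0])

lemma is_partition_bounds:
  assumes "is_partition s t N p" "i \<le> N"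
  shows "s \<le> p i" "p i \<le> t"
  using assms mono_between[of 0 N p 0 i] mono_between[of 0 N p i N]
  by (auto simp: is_partition_def less_imp_le)

text \<open>F and G vanish at 0. This fixed value turns the Lipschitz estimate, which only compares
  two paths, into the growth bound \<open>T_bound\<close>.\<close>

lemma T_cut_zero_path:
  fixes A :: "real^'n^'n" and \<W> :: "'d::finite rpath"
  assumes "cond_F F" "cond_G G"
  shows "T_cut A F G f \<alpha> \<W> R zero_path = zero_path"
proof -
  have F0: "F_cut F f \<alpha> (fst \<W>) R zero_path r = 0" if "r \<in> {0..1}" for r
    using that assms by (simp add: F_cut_def chi_def zero_path_def cond_F_def)
  have G0: "fst (G_cut G f \<alpha> (fst \<W>) R zero_path) r = 0" "snd (G_cut G f \<alpha> (fst \<W>) R zero_path) r = 0"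
    if "r \<in> {0..1}" for r
    using that assms by (simp_all add: G_cut_def chi_def zero_path_def cond_G_def)
  have "conv A F G f \<alpha> \<W> R id_blinfun zero_path 0 t t = 0" if t: "t \<in> {0..1}" for t
  proof -
    have i: "integral {0..t} (\<lambda>r. (sgrp A (t - r) o\<^sub>L id_blinfun) (F_cut F f \<alpha> (fst \<W>) R zero_path r)) = integral {0..t} (\<lambda>_. 0)"
      using t by (intro Henstock_Kurzweil_Integration.integral_cong) (simp add: F0 blinfun.zero_right)
    have "has_rough_integral (op_mult (\<lambda>r. sgrp A (t - r) o\<^sub>L id_blinfun) (G_cut G f \<alpha> (fst \<W>) R zero_path)) \<W> 0 t 0"
      unfolding has_rough_integral_def
    proof (intro allI impI exI[of _ 1] conjI)
      fix e :: real and N and p :: "nat \<Rightarrow> real"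
      assume "e > 0" and p: "is_partition 0 t N p \<and> (\<forall>i<N. p (Suc i) - p i < 1)"
      have z: "Blinfun (\<lambda>v :: real^'d. (0 :: (real^'d) \<Rightarrow>\<^sub>L (real^'n))) = 0"
        by (rule blinfun_eqI) (simp add: bounded_linear_Blinfun_apply)
      \<comment> \<open>\<open>zero_path\<close> is \<open>undefined\<close> outside [0,1], so the
        partition points must be located before the integrand can be evaluated.\<close>
      have "p i \<in> {0..1}" if "i < N" for i
        using is_partition_bounds[of 0 t N p i] p that t by auto
      then have "(\<Sum>i<N. fst (op_mult (\<lambda>r. sgrp A (t - r) o\<^sub>L id_blinfun) (G_cut G f \<alpha> (fst \<W>) R zero_path)) (p i)
           (fst \<W> (p (Suc i)) - fst \<W> (p i)) +
          tapply (snd (op_mult (\<lambda>r. sgrp A (t - r) o\<^sub>L id_blinfun) (G_cut G f \<alpha> (fst \<W>) R zero_path)) (p i))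
           (snd \<W> (p i) (p (Suc i)))) = 0"
        by (intro sum.neutral) (simp add: op_mult_def G0 z)
      then show "norm ((\<Sum>i<N. fst (op_mult (\<lambda>r. sgrp A (t - r) o\<^sub>L id_blinfun) (G_cut G f \<alpha> (fst \<W>) R zero_path)) (p i)
           (fst \<W> (p (Suc i)) - fst \<W> (p i)) +
          tapply (snd (op_mult (\<lambda>r. sgrp A (t - r) o\<^sub>L id_blinfun) (G_cut G f \<alpha> (fst \<W>) R zero_path)) (p i))
           (snd \<W> (p i) (p (Suc i)))) - 0) < e"
        using \<open>e > 0\<close> by simp
    qed simp
    then show ?thesis
      using t unfolding conv_def i by (simp add: rough_integral_eqI)
  qed
  note conv0 = this
  have z: "fst (zero_path :: ('d, real^'n) cpath) = (\<lambda>t\<in>{0..1}. 0)" "snd (zero_path :: ('d, real^'n) cpath) = (\<lambda>t\<in>{0..1}. 0)"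
    by (simp_all add: zero_path_def)
  show ?thesis
  proof (rule prod_eqI)
    have "fst (T_cut A F G f \<alpha> \<W> R zero_path) = (\<lambda>t\<in>{0..1}. 0)"
      unfolding T_cut_def fst_conv by (rule restrict_ext) (rule conv0)
    then show "fst (T_cut A F G f \<alpha> \<W> R zero_path) = fst (zero_path :: ('d, real^'n) cpath)"
      using z(1) by (rule trans[OF _ sym])
    have "snd (T_cut A F G f \<alpha> \<W> R zero_path) = (\<lambda>t\<in>{0..1}. 0)"
      unfolding T_cut_def snd_conv by (rule restrict_ext) (rule G0)
    then show "snd (T_cut A F G f \<alpha> \<W> R zero_path) = snd zero_path"
      using z(2) by (rule trans[OF _ sym])
  qed
qed

section \<open>Norm and completeness of controlled paths\<close>

lemma cdiff_simps [simp]: "fst (cdiff U V) t = fst U t - fst V t" "snd (cdiff U V) t = snd U t - snd V t"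
  by (simp_all add: cdiff_def)

lemma remainder_cdiff: "remainder W (cdiff U V) s t = remainder W U s t - remainder W V s t"
  by (simp add: remainder_def blinfun.diff_left)

lemma controlled_bounds:
  assumes "controlled \<alpha> W U" "0 \<le> \<alpha>"
  shows norm_fst_le_dnorm: "t \<in> {0..1} \<Longrightarrow> norm (fst U t) \<le> dnorm \<alpha> W U"
    and norm_snd_le_dnorm: "t \<in> {0..1} \<Longrightarrow> norm (snd U t) \<le> dnorm \<alpha> W U"
    and hoelder_snd_le_dnorm: "0 \<le> s \<Longrightarrow> s < t \<Longrightarrow> t \<le> 1 \<Longrightarrow> norm (snd U t - snd U s) \<le> dnorm \<alpha> W U * (t - s) powr \<alpha>"
    and remainder_le_dnorm: "0 \<le> s \<Longrightarrow> s < t \<Longrightarrow> t \<le> 1 \<Longrightarrow> norm (remainder W U s t) \<le> dnorm \<alpha> W U * (t - s) powr (2 * \<alpha>)"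
    and dnorm_nonneg: "0 \<le> dnorm \<alpha> W U"
proof -
  note U = assms(1)[unfolded controlled_def]
  have n: "0 \<le> snorm (fst U)" "0 \<le> snorm (snd U)" "0 \<le> hnorm \<alpha> (snd U)" "0 \<le> hnorm2 (2 * \<alpha>) (remainder W U)"
    using U assms(2) by (auto simp: hnorm_def hoelder_on_def intro!: hnorm2_nonneg snorm_nonneg[of \<alpha>])
  then show "0 \<le> dnorm \<alpha> W U" by (simp add: dnorm_def)
  show "norm (fst U t) \<le> dnorm \<alpha> W U" if "t \<in> {0..1}"
    using snorm_bound[of \<alpha> "fst U" t] U assms(2) that n by (simp add: dnorm_def)
  show "norm (snd U t) \<le> dnorm \<alpha> W U" if "t \<in> {0..1}"
    using snorm_bound[of \<alpha> "snd U" t] U assms(2) that n by (simp add: dnorm_def)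
  show "norm (snd U t - snd U s) \<le> dnorm \<alpha> W U * (t - s) powr \<alpha>" if "0 \<le> s" "s < t" "t \<le> 1" for s
  proof -
    have "norm (snd U t - snd U s) \<le> hnorm \<alpha> (snd U) * (t - s) powr \<alpha>"
      unfolding hnorm_def
      by (rule hnorm2_bound[where g = "\<lambda>s t. snd U t - snd U s"]) (use U that in \<open>auto simp: hoelder_on_def\<close>)
    also have "\<dots> \<le> dnorm \<alpha> W U * (t - s) powr \<alpha>"
      using n by (intro mult_right_mono) (auto simp: dnorm_def)
    finally show ?thesis .
  qed
  show "norm (remainder W U s t) \<le> dnorm \<alpha> W U * (t - s) powr (2 * \<alpha>)" if "0 \<le> s" "s < t" "t \<le> 1" for s
  proof -
    have "norm (remainder W U s t) \<le> hnorm2 (2 * \<alpha>) (remainder W U) * (t - s) powr (2 * \<alpha>)"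
      by (rule hnorm2_bound) (use U that in auto)
    also have "\<dots> \<le> dnorm \<alpha> W U * (t - s) powr (2 * \<alpha>)"
      using n by (intro mult_right_mono) (auto simp: dnorm_def)
    finally show ?thesis .
  qed
qed

lemma dnorm_le:
  assumes "\<And>t. t \<in> {0..1} \<Longrightarrow> norm (fst U t) \<le> B1" "\<And>t. t \<in> {0..1} \<Longrightarrow> norm (snd U t) \<le> B2"
    "\<And>s t. 0 \<le> s \<Longrightarrow> s < t \<Longrightarrow> t \<le> 1 \<Longrightarrow> norm (snd U t - snd U s) \<le> B3 * (t - s) powr \<alpha>"
    "\<And>s t. 0 \<le> s \<Longrightarrow> s < t \<Longrightarrow> t \<le> 1 \<Longrightarrow> norm (remainder W U s t) \<le> B4 * (t - s) powr (2 * \<alpha>)"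
  shows "dnorm \<alpha> W U \<le> B1 + B2 + B3 + B4"
  unfolding dnorm_def hnorm_def
  by (intro add_mono snorm_le hnorm2_le assms) auto

text \<open>X has to be the sum on [0,1] only, so it may be an extensional path while the summands
  are not. Sums and differences are both handled in this form, regularity included.\<close>

lemma dnorm_triangle:
  assumes "controlled \<alpha> W U" "controlled \<alpha> W V" "0 \<le> \<alpha>"
    "\<And>t. t \<in> {0..1} \<Longrightarrow> fst X t = fst U t + fst V t" "\<And>t. t \<in> {0..1} \<Longrightarrow> snd X t = snd U t + snd V t"
  shows "controlled \<alpha> W X" "dnorm \<alpha> W X \<le> dnorm \<alpha> W U + dnorm \<alpha> W V"
proof -
  note U = assms(1)[unfolded controlled_def hoelder_on_def] and V = assms(2)[unfolded controlled_def hoelder_on_def]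
  have r: "remainder W X s t = remainder W U s t + remainder W V s t" if "0 \<le> s" "s < t" "t \<le> 1" for s t
    using that assms(4)[of s] assms(4)[of t] assms(5)[of s] by (simp add: remainder_def blinfun.add_left)
  have d: "fst X t - fst X s = (fst U t - fst U s) + (fst V t - fst V s)"
     "snd X t - snd X s = (snd U t - snd U s) + (snd V t - snd V s)" if "0 \<le> s" "s < t" "t \<le> 1" for s t
    using that assms(4)[of s] assms(4)[of t] assms(5)[of s] assms(5)[of t] by auto
  show "controlled \<alpha> W X"
    unfolding controlled_def hoelder_on_def
    using U V by (intro conjI; elim conjE)
      (rule hoelder2_on_cong[OF hoelder2_on_add[of _ _ ], rotated 2], (rule d r; assumption), assumption, assumption)+
  have "dnorm \<alpha> W X \<le> (snorm (fst U) + snorm (fst V)) + (snorm (snd U) + snorm (snd V)) +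
      (hnorm \<alpha> (snd U) + hnorm \<alpha> (snd V)) + (hnorm2 (2 * \<alpha>) (remainder W U) + hnorm2 (2 * \<alpha>) (remainder W V))"
  proof (rule dnorm_le)
    show "norm (fst X t) \<le> snorm (fst U) + snorm (fst V)" if "t \<in> {0..1}" for t
      unfolding assms(4)[OF that]
      by (intro norm_triangle_mono snorm_bound[OF _ assms(3) that]) (use U V in \<open>auto simp: hoelder_on_def\<close>)
    show "norm (snd X t) \<le> snorm (snd U) + snorm (snd V)" if "t \<in> {0..1}" for t
      unfolding assms(5)[OF that]
      by (intro norm_triangle_mono snorm_bound[OF _ assms(3) that]) (use U V in \<open>auto simp: hoelder_on_def\<close>)
    show "norm (snd X t - snd X s) \<le> (hnorm \<alpha> (snd U) + hnorm \<alpha> (snd V)) * (t - s) powr \<alpha>"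
      if st: "0 \<le> s" "s < t" "t \<le> 1" for s t
      unfolding d[OF st] distrib_right hnorm_def
      using hnorm2_bound[OF conjunct1[OF conjunct2[OF U]] st] hnorm2_bound[OF conjunct1[OF conjunct2[OF V]] st]
      by (intro norm_triangle_mono) auto
    show "norm (remainder W X s t) \<le> (hnorm2 (2 * \<alpha>) (remainder W U) + hnorm2 (2 * \<alpha>) (remainder W V)) * (t - s) powr (2 * \<alpha>)"
      if st: "0 \<le> s" "s < t" "t \<le> 1" for s t
      unfolding r[OF st] distrib_right
      by (intro norm_triangle_mono hnorm2_bound st) (use U V in auto)
  qed
  then show "dnorm \<alpha> W X \<le> dnorm \<alpha> W U + dnorm \<alpha> W V"
    by (simp add: dnorm_def)
qed

lemma controlled_cdiff:
  assumes "controlled \<alpha> W U" "controlled \<alpha> W V" "0 \<le> \<alpha>"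
  shows "controlled \<alpha> W (cdiff U V)"
  by (rule dnorm_triangle(1)[OF assms(1) controlled_scaleR[OF assms(2), of "- 1"] assms(3)]) auto

lemma dnorm_cong:
  assumes "controlled \<alpha> W U" "0 \<le> \<alpha>" "\<And>t. t \<in> {0..1} \<Longrightarrow> fst X t = fst U t" "\<And>t. t \<in> {0..1} \<Longrightarrow> snd X t = snd U t"
  shows "dnorm \<alpha> W X = dnorm \<alpha> W U"
proof -
  have 0: "snorm (fst X) = snorm (fst U)" "snorm (snd X) = snorm (snd U)"
    unfolding snorm_def using assms(3,4) by (auto intro!: SUP_cong)
  have 1: "hnorm2 a g = hnorm2 a h" if "\<And>s t. 0 \<le> s \<Longrightarrow> s < t \<Longrightarrow> t \<le> 1 \<Longrightarrow> g s t = h s t"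
    for a and g h :: "real \<Rightarrow> real \<Rightarrow> 'x::real_normed_vector"
    unfolding hnorm2_def using that by (auto intro!: SUP_cong)
  show ?thesis
    unfolding dnorm_def 0 hnorm_def
    by (intro arg_cong2[where f = "(+)"] refl 1) (use assms(3,4) in \<open>auto simp: remainder_def\<close>)
qed

lemma norm_diff_limit_le:
  fixes g h :: "'x::real_normed_vector"
  assumes "x \<longlonglongrightarrow> h" "\<And>m. m \<ge> N \<Longrightarrow> norm (g - x m) \<le> c"
  shows "norm (g - h) \<le> c"
  by (rule LIMSEQ_le_const2[of "\<lambda>m. norm (g - x m)"]) (use assms in \<open>auto intro!: tendsto_intros\<close>)

text \<open>The factor \<open>4\<close> is the number of summands of the norm.\<close>

lemma controlled_limit:
  fixes V :: "nat \<Rightarrow> ('d::finite, 'e::banach) cpath"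
  assumes "\<And>n. V n \<in> ctrl \<alpha> W" "0 \<le> \<alpha>" "hoelder_on 0 1 \<alpha> W" "E \<longlonglongrightarrow> 0"
    and cau: "\<And>n m. n \<le> m \<Longrightarrow> dnorm \<alpha> W (cdiff (V n) (V m)) \<le> E n"
  obtains L where "L \<in> ctrl \<alpha> W" "\<And>n. dnorm \<alpha> W (cdiff (V n) L) \<le> 4 * E n"
    "\<And>t. t \<in> {0..1} \<Longrightarrow> (\<lambda>n. fst (V n) t) \<longlonglongrightarrow> fst L t"
proof -
  have V: "controlled \<alpha> W (V n)" for n using assms(1) by (simp add: ctrl_iff)
  note dc = controlled_cdiff[OF V V assms(2)]
  have conv: "convergent (\<lambda>n. g (V n))"
    if "\<And>n m. n \<le> m \<Longrightarrow> norm (g (V n) - g (V m)) \<le> E n" for g :: "('d, 'e) cpath \<Rightarrow> 'x::banach"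
  proof -
    have "Cauchy (\<lambda>n. g (V n))"
    proof (rule metric_CauchyI)
      fix e :: real assume "e > 0"
      then obtain N where N: "\<And>n. n \<ge> N \<Longrightarrow> norm (E n) < e / 2"
        using LIMSEQ_D[OF assms(4), of "e / 2"] by auto
      have "dist (g (V m)) (g (V n)) < e" if "m \<ge> N" "n \<ge> N" for m n
      proof -
        have "norm (g (V N) - g (V m)) \<le> E N" "norm (g (V N) - g (V n)) \<le> E N" "E N < e / 2"
          using that(1) that(2) N[of N] \<open>\<And>n m. n \<le> m \<Longrightarrow> norm (g (V n) - g (V m)) \<le> E n\<close> by auto
        moreover have "dist (g (V m)) (g (V n)) \<le> norm (g (V N) - g (V m)) + norm (g (V N) - g (V n))"
          using norm_triangle_ineq4[of "g (V N) - g (V n)" "g (V N) - g (V m)"] by (simp add: dist_norm)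
        ultimately show ?thesis by linarith
      qed
      then show "\<exists>M. \<forall>m\<ge>M. \<forall>n\<ge>M. dist (g (V m)) (g (V n)) < e" by blast
    qed
    then show ?thesis by (simp add: Cauchy_convergent_iff)
  qed
  define L where "L = (\<lambda>t\<in>{0..1}. lim (\<lambda>n. fst (V n) t), \<lambda>t\<in>{0..1}. lim (\<lambda>n. snd (V n) t))"
  have l1: "(\<lambda>n. fst (V n) t) \<longlonglongrightarrow> fst L t" if t: "t \<in> {0..1}" for t
  proof -
    have "convergent (\<lambda>n. fst (V n) t)"
    proof (rule conv[of "\<lambda>U. fst U t"])
      show "norm (fst (V n) t - fst (V m) t) \<le> E n" if "n \<le> m" for n m
        using order_trans[OF norm_fst_le_dnorm[OF dc assms(2) t] cau[OF that]] by simp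
    qed
    then show ?thesis using t by (simp add: L_def convergent_LIMSEQ_iff)
  qed
  have l2: "(\<lambda>n. snd (V n) t) \<longlonglongrightarrow> snd L t" if t: "t \<in> {0..1}" for t
  proof -
    have "convergent (\<lambda>n. snd (V n) t)"
    proof (rule conv[of "\<lambda>U. snd U t"])
      show "norm (snd (V n) t - snd (V m) t) \<le> E n" if "n \<le> m" for n m
        using order_trans[OF norm_snd_le_dnorm[OF dc assms(2) t] cau[OF that]] by simp
    qed
    then show ?thesis using t by (simp add: L_def convergent_LIMSEQ_iff)
  qed
  have E: "norm (fst (cdiff (V n) L) t) \<le> E n" "norm (snd (cdiff (V n) L) t) \<le> E n" if t: "t \<in> {0..1}" for n t
  proof -
    show "norm (fst (cdiff (V n) L) t) \<le> E n"
      unfolding cdiff_simps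
      by (rule norm_diff_limit_le[OF l1[OF t], where N = n]) (use order_trans[OF norm_fst_le_dnorm[OF dc assms(2) t] cau] in simp)
    show "norm (snd (cdiff (V n) L) t) \<le> E n"
      unfolding cdiff_simps
      by (rule norm_diff_limit_le[OF l2[OF t], where N = n]) (use order_trans[OF norm_snd_le_dnorm[OF dc assms(2) t] cau] in simp)
  qed
  \<comment> \<open>The bounds hold for V n - V m with every m \<ge> n, and for fixed s, t they pass
    to the pointwise limit in m.\<close>
  have H: "norm (snd (cdiff (V n) L) t - snd (cdiff (V n) L) s) \<le> E n * (t - s) powr \<alpha>"
    "norm (remainder W (cdiff (V n) L) s t) \<le> E n * (t - s) powr (2 * \<alpha>)" if st: "0 \<le> s" "s < t" "t \<le> 1" for n s t
  proof -
    have s: "s \<in> {0..1}" and t: "t \<in> {0..1}" using st by auto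
    have "norm ((snd (V n) t - snd (V n) s) - (snd L t - snd L s)) \<le> E n * (t - s) powr \<alpha>"
    proof (rule norm_diff_limit_le[where N = n])
      show "(\<lambda>m. snd (V m) t - snd (V m) s) \<longlonglongrightarrow> snd L t - snd L s"
        by (intro tendsto_intros l2 s t)
      show "norm ((snd (V n) t - snd (V n) s) - (snd (V m) t - snd (V m) s)) \<le> E n * (t - s) powr \<alpha>" if "m \<ge> n" for m
        using hoelder_snd_le_dnorm[OF dc[of n m] assms(2) st] mult_right_mono[OF cau[OF that], of "(t - s) powr \<alpha>"]
        by (simp add: algebra_simps)
    qed
    then show "norm (snd (cdiff (V n) L) t - snd (cdiff (V n) L) s) \<le> E n * (t - s) powr \<alpha>"
      by (simp add: algebra_simps)
    have "norm (remainder W (V n) s t - remainder W L s t) \<le> E n * (t - s) powr (2 * \<alpha>)"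
    proof (rule norm_diff_limit_le[where N = n])
      show "(\<lambda>m. remainder W (V m) s t) \<longlonglongrightarrow> remainder W L s t"
        unfolding remainder_def by (intro tendsto_intros l1 l2 s t)
      show "norm (remainder W (V n) s t - remainder W (V m) s t) \<le> E n * (t - s) powr (2 * \<alpha>)" if "m \<ge> n" for m
        using remainder_le_dnorm[OF dc[of n m] assms(2) st] mult_right_mono[OF cau[OF that], of "(t - s) powr (2 * \<alpha>)"]
        by (simp add: remainder_cdiff)
    qed
    then show "norm (remainder W (cdiff (V n) L) s t) \<le> E n * (t - s) powr (2 * \<alpha>)"
      by (simp add: remainder_cdiff)
  qed
  show thesis
  proof (rule that[of L])
    \<comment> \<open>The bounds make the difference V 0 - L controlled; subtracting it from V 0
      recovers L.\<close>
    have "controlled \<alpha> W (cdiff (V 0) L)"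
      using H by (intro controlledI[OF assms(3,2)] hoelder_onI hoelder2_onI)
    then have "controlled \<alpha> W L"
      by (rule dnorm_triangle(1)[OF V[of 0] controlled_scaleR[of _ _ _ "- 1"] assms(2)]) auto
    then show "L \<in> ctrl \<alpha> W"
      by (simp add: ctrl_iff L_def)
    show "dnorm \<alpha> W (cdiff (V n) L) \<le> 4 * E n" for n
      using dnorm_le[of "cdiff (V n) L" "E n" "E n" "E n" \<alpha> W "E n"] E[of _ n] H[of _ _ n] by simp
  qed (rule l1)
qed

section \<open>Spectral projections and weighted sums\<close>

lemma complexify_linear:
  "complexify 0 = 0" "complexify (x + y) = complexify x + complexify y"
  "complexify (c *\<^sub>R x) = complex_of_real c *s complexify x"
  by (simp_all add: complexify_def vec_eq_iff)

lemma subspace_spectral_space: "subspace (spectral_space A \<Lambda>)"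
  unfolding subspace_def spectral_space_def
  by (auto simp: complexify_linear vec.span_zero vec.span_add vec.span_scale)

text \<open>A trivial intersection makes the component in U unique, and uniqueness makes it linear;
  in finite dimension it is then bounded, so that \<open>Blinfun\<close> returns the map it is
  given.\<close>

lemma proj_along:
  assumes "subspace U" "subspace V" "direct_decomp U V"
  shows proj_along_mem: "proj_along U V x \<in> U" "x - proj_along U V x \<in> V"
    and proj_along_eqI: "u \<in> U \<Longrightarrow> x - u \<in> V \<Longrightarrow> proj_along U V x = u"
proof -
  define p where "p x = (THE u. u \<in> U \<and> x - u \<in> V)" for x
  have uniq: "u = u'" if "u \<in> U" "x - u \<in> V" "u' \<in> U" "x - u' \<in> V" for x u u'
  proof -
    have "u - u' \<in> U" using assms(1) that by (simp add: subspace_diff)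
    moreover have "u - u' \<in> V"
      using subspace_diff[OF assms(2) that(4,2)] by simp
    ultimately have "u - u' \<in> {0}" using assms(3) unfolding direct_decomp_def by blast
    then show ?thesis by simp
  qed
  have pI: "p x = u" if "u \<in> U" "x - u \<in> V" for x u
    unfolding p_def using that uniq by blast
  have p: "p x \<in> U" "x - p x \<in> V" for x
  proof -
    obtain u v where "u \<in> U" "v \<in> V" "x = u + v"
      using assms(3) unfolding direct_decomp_def by blast
    then show "p x \<in> U" "x - p x \<in> V" using pI[of u x] by auto
  qed
  have "linear p"
  proof (rule linearI)
    show "p (x + y) = p x + p y" for x y
      using subspace_add[OF assms(2) p(2)[of x] p(2)[of y]]
      by (intro pI subspace_add[OF assms(1)] p) (simp add: algebra_simps)
    show "p (c *\<^sub>R x) = c *\<^sub>R p x" for c x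
      using subspace_scale[OF assms(2) p(2)[of x], of c]
      by (intro pI subspace_scale[OF assms(1)] p) (simp add: algebra_simps)
  qed
  then have "bounded_linear p"
    by (rule linear_conv_bounded_linear[THEN iffD1])
  then have "blinfun_apply (proj_along U V) = p"
    unfolding proj_along_def p_def[symmetric] by (rule bounded_linear_Blinfun_apply)
  then show "proj_along U V x \<in> U" "x - proj_along U V x \<in> V"
    "u \<in> U \<Longrightarrow> x - u \<in> V \<Longrightarrow> proj_along U V x = u"
    using p pI by auto
qed

lemma geometric_has_sum: "0 \<le> r \<Longrightarrow> r < 1 \<Longrightarrow> ((\<lambda>m. r ^ m) has_sum (1 / (1 - r :: real))) UNIV"
  using geometric_sums[of r] by (intro norm_summable_imp_has_sum) (auto simp: summable_geometric)

text \<open>The fixed point is found for each noise path separately, so one rough path is fixed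
  here. It is rough on every interval, since each block uses another shift of it.\<close>

locale lyapunov_perron =
  fixes A :: "real^'n^'n" and \<alpha> \<beta> \<gamma> \<eta> Mc Ms K C1 C2 :: real
    and F :: "real^'n \<Rightarrow> real^'n" and G :: "real^'n \<Rightarrow> (real^'d::finite) \<Rightarrow>\<^sub>L (real^'n)"
    and f :: "real \<Rightarrow> real" and \<W> :: "'d rpath" and \<xi> :: "real^'n"
  assumes alpha: "1 / 3 < \<alpha>" "\<alpha> \<le> 1 / 2" and CS: "CS A \<beta> \<gamma> Mc Ms"
    and F: "cond_F F" and G: "cond_G G" and C1: "C1 > 0" and C2: "C2 \<ge> 0"
    and estimate: "T_cut_estimate A F G f \<alpha> C1 C2"
    and eta: "- \<beta> < \<eta>" "\<eta> < 0" and K: "K > 0"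
    and rough: "\<And>a b. rough_path_on a b \<alpha> \<W>"
begin

abbreviation "Pc' \<equiv> Pc A"
abbreviation "Ps' \<equiv> Ps A"

lemma CS': "direct_decomp (Xc A) (Xs A)" "0 \<le> \<gamma>" "Mc \<ge> 1" "Ms \<ge> 1"
  "t \<le> 0 \<Longrightarrow> x \<in> Xc A \<Longrightarrow> norm (sgrp A t x) \<le> Mc * exp (\<gamma> * t) * norm x"
  "t \<ge> 0 \<Longrightarrow> x \<in> Xs A \<Longrightarrow> norm (sgrp A t x) \<le> Ms * exp (- \<beta> * t) * norm x"
  using CS by (auto simp: CS_def)

lemma direct_decomp_swap: "direct_decomp (Xs A) (Xc A)"
  using CS'(1) unfolding direct_decomp_def by (metis Int_commute add.commute)

lemma Pc_mem: "Pc' x \<in> Xc A" and Ps_mem: "Ps' x \<in> Xs A" and Pc_plus_Ps: "Pc' x + Ps' x = x"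
proof -
  have s: "subspace (Xc A)" "subspace (Xs A)"
    by (simp_all add: Xc_def Xs_def subspace_spectral_space)
  note c = proj_along[OF s CS'(1), folded Pc_def] and p = proj_along[OF s(2,1) direct_decomp_swap, folded Ps_def]
  show "Pc' x \<in> Xc A" "Ps' x \<in> Xs A" using c p by auto
  have "Ps' x = x - Pc' x"
    by (rule p(3)) (use c in auto)
  then show "Pc' x + Ps' x = x" by simp
qed

text \<open>(CS) gives this for t \<ge> 0. An operator that commutes with the invertible S(-t) also
  commutes with its inverse S(t).\<close>

lemma sgrp_commute: "Pc' o\<^sub>L sgrp A t = sgrp A t o\<^sub>L Pc'" "Ps' o\<^sub>L sgrp A t = sgrp A t o\<^sub>L Ps'"
proof -
  have *: "P o\<^sub>L sgrp A t = sgrp A t o\<^sub>L P" if P: "\<And>t. t \<ge> 0 \<Longrightarrow> P o\<^sub>L sgrp A t = sgrp A t o\<^sub>L P" for P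
  proof (cases "t \<ge> 0")
    case False
    have "P (sgrp A (- t) y) = sgrp A (- t) (P y)" for y
      using P[of "- t"] False by (metis blinfun_apply_blinfun_compose le_minus_iff minus_zero nle_le)
    from this[of "sgrp A t _"] have "P (sgrp A t x) = sgrp A t (P x)" for x
      by (metis sgrp_cancel)
    then show ?thesis by (auto intro: blinfun_eqI)
  qed (rule P)
  show "Pc' o\<^sub>L sgrp A t = sgrp A t o\<^sub>L Pc'" "Ps' o\<^sub>L sgrp A t = sgrp A t o\<^sub>L Ps'"
    using CS by (auto intro!: * simp: CS_def)
qed

lemma sgrp_commute_apply: "Pc' (sgrp A t x) = sgrp A t (Pc' x)" "Ps' (sgrp A t x) = sgrp A t (Ps' x)"
  using sgrp_commute[of t] by (metis blinfun_apply_blinfun_compose)+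

text \<open>The decay in (CS) holds for vectors of the subspace; the norm of the projection is the
  price for arbitrary x.\<close>

lemma center_decay: "t \<le> 0 \<Longrightarrow> norm (sgrp A t (Pc' x)) \<le> Mc * norm Pc' * exp (\<gamma> * t) * norm x"
proof -
  assume t: "t \<le> 0"
  have "norm (sgrp A t (Pc' x)) \<le> Mc * exp (\<gamma> * t) * norm (Pc' x)"
    by (rule CS'(5)[OF t Pc_mem])
  also have "\<dots> \<le> Mc * exp (\<gamma> * t) * (norm Pc' * norm x)"
    using CS'(3) by (intro mult_left_mono norm_blinfun) auto
  finally show ?thesis by (simp add: mult_ac)
qed

lemma stable_decay: "t \<ge> 0 \<Longrightarrow> norm (sgrp A t (Ps' x)) \<le> Ms * norm Ps' * exp (- \<beta> * t) * norm x"
proof -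
  assume t: "t \<ge> 0"
  have "norm (sgrp A t (Ps' x)) \<le> Ms * exp (- \<beta> * t) * norm (Ps' x)"
    by (rule CS'(6)[OF t Ps_mem])
  also have "\<dots> \<le> Ms * exp (- \<beta> * t) * (norm Ps' * norm x)"
    using CS'(4) by (intro mult_left_mono norm_blinfun) auto
  finally show ?thesis by (simp add: mult_ac)
qed

section \<open>Weighted geometric sums over the blocks\<close>

definition "rs = exp (- (\<beta> + \<eta>))"
definition "rc = exp (- (\<gamma> - \<eta>))"

lemma ratios: "0 < rs" "rs < 1" "0 < rc" "rc < 1"
  using eta CS'(2) by (auto simp: rs_def rc_def)

lemma exp_nat: "exp ((a::real) * of_int (int m)) = exp a ^ m"
  by (simp add: exp_of_nat2_mult)

text \<open>With m = i - 1 - k the decay e^(-\<beta> m) meets the weight e^(-\<eta> m), so the terms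
  are geometric with ratio \<open>rs\<close>. Block k carries the weight of index k - 1 = (i - 1) -
  m - 1; this shift by one is the factor e^(-\<eta>), which also appears in the gap
  condition.\<close>

lemma stable_sum:
  assumes c: "\<And>k. k \<le> 0 \<Longrightarrow> norm (c k) \<le> E * exp (\<eta> * of_int (k - 1))" and i: "i \<le> 0" and E: "0 \<le> E"
  shows stable_summable: "(\<lambda>k. sgrp A (of_int (i - 1 - k)) (Ps' (c k))) summable_on {..i - 1}"
    and norm_stable_sum: "norm (\<Sum>\<^sub>\<infinity>k\<in>{..i - 1}. sgrp A (of_int (i - 1 - k)) (Ps' (c k)))
      \<le> Ms * norm Ps' * E * exp (\<eta> * of_int (i - 1)) * exp (- \<eta>) / (1 - rs)"
proof -
  define B where "B = Ms * norm Ps' * E * exp (\<eta> * of_int (i - 1)) * exp (- \<eta>)"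
  have B: "B \<ge> 0" using CS'(4) E by (simp add: B_def)
  have b: "norm (sgrp A (of_int (i - 1 - k)) (Ps' (c k))) \<le> B * rs ^ nat (i - 1 - k)" if k: "k \<in> {..i - 1}" for k
  proof -
    define m where "m = nat (i - 1 - k)"
    have m: "i - 1 - k = int m" using k by (simp add: m_def)
    then have k': "k - 1 = (i - 1) + - int m + - 1" by simp
    have "norm (sgrp A (of_int (i - 1 - k)) (Ps' (c k))) \<le> Ms * norm Ps' * exp (- \<beta> * of_int (i - 1 - k)) * norm (c k)"
      using k by (intro stable_decay) auto
    also have "\<dots> \<le> Ms * norm Ps' * exp (- \<beta> * of_int (i - 1 - k)) * (E * exp (\<eta> * of_int (k - 1)))"
      using k i CS'(4) by (intro mult_left_mono c) auto
    also have "exp (\<eta> * of_int (k - 1)) = exp (\<eta> * of_int (i - 1)) * exp (- \<eta> * of_int (int m)) * exp (- \<eta>)"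
      unfolding k' by (simp add: algebra_simps flip: exp_add)
    also have "Ms * norm Ps' * exp (- \<beta> * of_int (i - 1 - k)) * (E * (exp (\<eta> * of_int (i - 1)) * exp (- \<eta> * of_int (int m)) * exp (- \<eta>)))
      = B * (exp (- \<beta> * of_int (int m)) * exp (- \<eta> * of_int (int m)))"
      unfolding m by (simp add: B_def)
    also have "exp (- \<beta> * of_int (int m)) * exp (- \<eta> * of_int (int m)) = exp (- (\<beta> + \<eta>) * of_int (int m))"
      by (simp add: algebra_simps flip: exp_add)
    also have "\<dots> = rs ^ m" unfolding exp_nat rs_def ..
    finally show ?thesis by (simp add: m_def)
  qed
  have bij: "bij_betw (\<lambda>m. i - 1 - int m) UNIV {..i - 1}"
    by (rule bij_betwI[where g = "\<lambda>k. nat (i - 1 - k)"]) auto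
  have "((\<lambda>m. B * rs ^ nat (i - 1 - (i - 1 - int m))) has_sum (B * (1 / (1 - rs)))) UNIV"
    using ratios by (intro has_sum_cmult_right) (simp add: geometric_has_sum)
  then have g: "((\<lambda>k. B * rs ^ nat (i - 1 - k)) has_sum (B * (1 / (1 - rs)))) {..i - 1}"
    using has_sum_reindex_bij_betw[OF bij, of "\<lambda>k. B * rs ^ nat (i - 1 - k)"] by simp
  have "(\<lambda>k. norm (sgrp A (of_int (i - 1 - k)) (Ps' (c k)))) summable_on {..i - 1}"
    by (rule Infinite_Sum.summable_on_comparison_test[OF has_sum_imp_summable[OF g]]) (use b in auto)
  then show s: "(\<lambda>k. sgrp A (of_int (i - 1 - k)) (Ps' (c k))) summable_on {..i - 1}"
    by (rule Infinite_Sum.abs_summable_summable)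
  show "norm (\<Sum>\<^sub>\<infinity>k\<in>{..i - 1}. sgrp A (of_int (i - 1 - k)) (Ps' (c k)))
      \<le> Ms * norm Ps' * E * exp (\<eta> * of_int (i - 1)) * exp (- \<eta>) / (1 - rs)"
    using norm_infsum_le[OF has_sum_infsum[OF s] g b] by (simp add: B_def)
qed

text \<open>Here m = k - i + 1 counts forward in time: e^(-\<gamma> m) meets e^(\<eta> m), with
  ratio \<open>rc\<close> < 1 because \<eta> < 0 \<le> \<gamma>. Comparison with the full series
  makes the bound uniform in i.\<close>

lemma norm_center_sum:
  assumes c: "\<And>k. k \<le> 0 \<Longrightarrow> norm (c k) \<le> E * exp (\<eta> * of_int (k - 1))" and E: "0 \<le> E"
  shows "norm (\<Sum>k\<in>{i..0}. sgrp A (of_int (i - 1 - k)) (Pc' (c k)))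
      \<le> Mc * norm Pc' * E * exp (\<eta> * of_int (i - 1)) * exp (- \<eta>) / (1 - rc)"
proof -
  define B where "B = Mc * norm Pc' * E * exp (\<eta> * of_int (i - 1)) * exp (- \<eta>)"
  have B: "B \<ge> 0" using CS'(3) E by (simp add: B_def)
  have b: "norm (sgrp A (of_int (i - 1 - k)) (Pc' (c k))) \<le> B * rc ^ nat (k - i + 1)" if k: "k \<in> {i..0}" for k
  proof -
    define m where "m = nat (k - i + 1)"
    have m: "i - 1 - k = - int m" using k by (simp add: m_def)
    then have k': "k - 1 = (i - 1) + int m + - 1" by simp
    have "norm (sgrp A (of_int (i - 1 - k)) (Pc' (c k))) \<le> Mc * norm Pc' * exp (\<gamma> * of_int (i - 1 - k)) * norm (c k)"
      using k by (intro center_decay) auto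
    also have "\<dots> \<le> Mc * norm Pc' * exp (\<gamma> * of_int (i - 1 - k)) * (E * exp (\<eta> * of_int (k - 1)))"
      using k CS'(3) by (intro mult_left_mono c) auto
    also have "exp (\<eta> * of_int (k - 1)) = exp (\<eta> * of_int (i - 1)) * exp (\<eta> * of_int (int m)) * exp (- \<eta>)"
      unfolding k' by (simp add: algebra_simps flip: exp_add)
    also have "Mc * norm Pc' * exp (\<gamma> * of_int (i - 1 - k)) * (E * (exp (\<eta> * of_int (i - 1)) * exp (\<eta> * of_int (int m)) * exp (- \<eta>)))
      = B * (exp (- \<gamma> * of_int (int m)) * exp (\<eta> * of_int (int m)))"
      unfolding m by (simp add: B_def)
    also have "exp (- \<gamma> * of_int (int m)) * exp (\<eta> * of_int (int m)) = exp (- (\<gamma> - \<eta>) * of_int (int m))"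
      by (simp add: algebra_simps flip: exp_add)
    also have "\<dots> = rc ^ m" unfolding exp_nat rc_def ..
    finally show ?thesis by (simp add: m_def)
  qed
  have "norm (\<Sum>k\<in>{i..0}. sgrp A (of_int (i - 1 - k)) (Pc' (c k))) \<le> (\<Sum>k\<in>{i..0}. B * rc ^ nat (k - i + 1))"
    by (rule sum_norm_le) (rule b)
  also have "\<dots> = B * (\<Sum>m\<in>(\<lambda>k. nat (k - i + 1)) ` {i..0}. rc ^ m)"
    unfolding sum_distrib_left[symmetric] by (subst sum.reindex) (auto simp: inj_on_def)
  \<comment> \<open>The finite sum starts at m = 1; it is enlarged to the whole series from m =
    0.\<close>
  also have "(\<Sum>m\<in>(\<lambda>k. nat (k - i + 1)) ` {i..0}. rc ^ m) \<le> (\<Sum>m. rc ^ m)"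
    using ratios by (intro sum_le_suminf) (auto simp: summable_geometric)
  also have "\<dots> = 1 / (1 - rc)"
    using ratios by (intro suminf_geometric) auto
  finally show ?thesis
    using B by (simp add: B_def mult_left_mono)
qed

text \<open>Green's operator of the recursion x_i = S(1) x_(i-1) + c_(i-1) for the splitting: the
  stable part is summed from the past, the center part backward from index 0.\<close>

definition shadow :: "(int \<Rightarrow> real^'n) \<Rightarrow> int \<Rightarrow> real^'n" where
  "shadow c i = (\<Sum>\<^sub>\<infinity>k\<in>{..i - 1}. sgrp A (of_int (i - 1 - k)) (Ps' (c k)))
     - (\<Sum>k\<in>{i..0}. sgrp A (of_int (i - 1 - k)) (Pc' (c k)))"

text \<open>A bound for the norm of \<open>shadow\<close> on sequences weighted by e^(\<eta> (i -
  1)).\<close>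

definition "\<kappa> = exp (- \<eta>) * (Mc * norm Pc' / (1 - rc) + Ms * norm Ps' / (1 - rs))"

lemma norm_shadow:
  assumes "\<And>k. k \<le> 0 \<Longrightarrow> norm (c k) \<le> E * exp (\<eta> * of_int (k - 1))" "i \<le> 0" "0 \<le> E"
  shows "norm (shadow c i) \<le> \<kappa> * E * exp (\<eta> * of_int (i - 1))"
proof -
  have "norm (shadow c i) \<le> Ms * norm Ps' * E * exp (\<eta> * of_int (i - 1)) * exp (- \<eta>) / (1 - rs) +
     Mc * norm Pc' * E * exp (\<eta> * of_int (i - 1)) * exp (- \<eta>) / (1 - rc)"
    unfolding shadow_def
    by (rule order_trans[OF norm_triangle_ineq4 add_mono[OF norm_stable_sum[OF assms] norm_center_sum[OF assms(1,3)]]])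
  also have "\<dots> = \<kappa> * E * exp (\<eta> * of_int (i - 1))"
    by (simp add: \<kappa>_def distrib_left distrib_right mult_ac)
  finally show ?thesis .
qed

text \<open>The stable part is an infinite sum, so linearity needs both sequences to be summable;
  their weight constants may differ.\<close>

lemma shadow_diff:
  assumes "\<And>k. k \<le> 0 \<Longrightarrow> norm (c k) \<le> E * exp (\<eta> * of_int (k - 1))" "0 \<le> E"
    "\<And>k. k \<le> 0 \<Longrightarrow> norm (d k) \<le> E' * exp (\<eta> * of_int (k - 1))" "0 \<le> E'" "i \<le> 0"
  shows "shadow c i - shadow d i = shadow (\<lambda>k. c k - d k) i"
proof -
  note s = stable_summable[OF assms(1,5,2)] stable_summable[OF assms(3,5,4)]
  show ?thesis
    using infsum_add[OF s(1) summable_on_uminus[THEN iffD2, OF s(2)]]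
    unfolding shadow_def by (simp add: blinfun.diff_right sum_subtractf infsum_uminus)
qed

text \<open>From i - 1 to i only the index k = i - 1 changes sides. It leaves the center sum, where
  it counts as -P^c c, and enters the stable sum as P^s c; the jump is P^c c + P^s c = c.\<close>

lemma shadow_step:
  assumes "\<And>k. k \<le> 0 \<Longrightarrow> norm (c k) \<le> E * exp (\<eta> * of_int (k - 1))" "0 \<le> E" "i \<le> 0"
  shows "sgrp A 1 (shadow c (i - 1)) + c (i - 1) = shadow c i"
proof -
  have e: "sgrp A 1 (sgrp A (of_int (i - 1 - 1 - k)) x) = sgrp A (of_int (i - 1 - k)) x" for k x
  proof -
    have "1 + of_int (i - 1 - 1 - k) = (of_int (i - 1 - k) :: real)" by simp
    then show ?thesis using sgrp_add[of A 1 "of_int (i - 1 - 1 - k)"] by (metis blinfun_apply_blinfun_compose)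
  qed
  have i: "i - 1 \<le> 0" using assms(3) by simp
  have s: "(\<lambda>k. sgrp A (of_int (i - 1 - 1 - k)) (Ps' (c k))) summable_on {..i - 1 - 1}"
    "(\<lambda>k. sgrp A (of_int (i - 1 - k)) (Ps' (c k))) summable_on {..i - 1}"
    by (rule stable_summable[OF _ i assms(2)], erule assms(1)) (rule stable_summable[OF _ assms(3,2)], erule assms(1))
  have "sgrp A 1 (\<Sum>\<^sub>\<infinity>k\<in>{..i - 1 - 1}. sgrp A (of_int (i - 1 - 1 - k)) (Ps' (c k))) =
      (\<Sum>\<^sub>\<infinity>k\<in>{..i - 1 - 1}. sgrp A (of_int (i - 1 - k)) (Ps' (c k)))"
    using has_sum_bounded_linear[OF blinfun.bounded_linear_right[of "sgrp A 1"] has_sum_infsum[OF s(1)], THEN infsumI, unfolded e]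
    by (rule sym)
  moreover have "(\<Sum>\<^sub>\<infinity>k\<in>{..i - 1}. sgrp A (of_int (i - 1 - k)) (Ps' (c k))) =
      Ps' (c (i - 1)) + (\<Sum>\<^sub>\<infinity>k\<in>{..i - 1 - 1}. sgrp A (of_int (i - 1 - k)) (Ps' (c k)))"
  proof -
    have ins: "{..i - 1} = insert (i - 1) {..i - 1 - 1}" by auto
    have "(\<lambda>k. sgrp A (of_int (i - 1 - k)) (Ps' (c k))) summable_on {..i - 1 - 1}"
      by (rule summable_on_subset_banach[OF s(2)]) auto
    from infsum_insert[OF this, of "i - 1"] show ?thesis
      unfolding ins by simp
  qed
  moreover have "sgrp A 1 (\<Sum>k\<in>{i - 1..0}. sgrp A (of_int (i - 1 - 1 - k)) (Pc' (c k))) =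
      Pc' (c (i - 1)) + (\<Sum>k\<in>{i..0}. sgrp A (of_int (i - 1 - k)) (Pc' (c k)))"
  proof -
    have "{i - 1..0} = insert (i - 1) {i..0}" using assms(3) by auto
    then show ?thesis unfolding blinfun.sum_right e by simp
  qed
  ultimately show ?thesis
    using Pc_plus_Ps[of "c (i - 1)"]
    by (simp add: shadow_def blinfun.diff_right algebra_simps)
qed

end

section \<open>The Lyapunov--Perron map\<close>

lemma dnorm_cdiff_self: "dnorm \<alpha> W (cdiff U U) \<le> 0"
  using dnorm_le[of "cdiff U U" 0 0 0 \<alpha> W 0] by (simp add: remainder_cdiff)

lemma dnorm_cdiff_triangle:
  assumes "controlled \<alpha> W U" "controlled \<alpha> W V" "controlled \<alpha> W X" "0 \<le> \<alpha>"
  shows "dnorm \<alpha> W (cdiff U X) \<le> dnorm \<alpha> W (cdiff U V) + dnorm \<alpha> W (cdiff V X)"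
  by (rule dnorm_triangle(2)[OF controlled_cdiff[OF assms(1,2,4)] controlled_cdiff[OF assms(2,3,4)] assms(4)]) auto

lemma dnorm_cdiff_zero_path:
  assumes "controlled \<alpha> W U" "0 \<le> \<alpha>"
  shows "dnorm \<alpha> W (cdiff U zero_path) = dnorm \<alpha> W U"
  by (rule dnorm_cong[OF assms]) (simp_all add: zero_path_def)

definition smooth_path :: "real^'n^'n \<Rightarrow> real^'n \<Rightarrow> ('d::finite, real^'n) cpath" where
  "smooth_path A x = (\<lambda>t. sgrp A t x, \<lambda>t. 0)"

text \<open>The first summand bounds the sup norm of S(t) x on [0,1], the second its remainder; the
  derivative terms of the norm vanish.\<close>

definition smooth_const :: "real^'n^'n \<Rightarrow> real" where
  "smooth_const A = exp (mnorm A) + mnorm A * exp (2 * mnorm A)"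

lemma smooth_const_pos: "0 < smooth_const A"
  unfolding smooth_const_def by (intro add_pos_nonneg) (simp_all add: mnorm_nonneg)

text \<open>With zero Gubinelli derivative the remainder is the plain increment, of order 1 and
  hence of order 2\<alpha> on [0,1].\<close>

lemma smooth_path:
  fixes A :: "real^'n^'n" and W :: "real \<Rightarrow> real^'d::finite"
  assumes "hoelder_on 0 1 \<alpha> W" "0 \<le> \<alpha>" "\<alpha> \<le> 1 / 2"
  shows controlled_smooth_path: "controlled \<alpha> W (smooth_path A x)"
    and dnorm_smooth_path: "dnorm \<alpha> W (smooth_path A x) \<le> smooth_const A * norm x"
proof -
  let ?U = "smooth_path A x :: ('d, real^'n) cpath"
  have r: "norm (remainder W ?U s t) \<le> (mnorm A * exp (2 * mnorm A) * norm x) * (t - s) powr (2 * \<alpha>)"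
    if st: "0 \<le> s" "s < t" "t \<le> 1" for s t
  proof -
    have "norm (remainder W ?U s t) \<le> norm (sgrp A t - sgrp A s) * norm x"
      using norm_blinfun[of "sgrp A t - sgrp A s" x]
      by (simp add: remainder_def smooth_path_def blinfun.diff_left)
    also have "\<dots> \<le> (mnorm A * exp (2 * mnorm A) * (t - s)) * norm x"
      using norm_sgrp_diff[of s t A] st by (intro mult_right_mono) auto
    also have "\<dots> = (mnorm A * exp (2 * mnorm A) * norm x) * (t - s) powr 1"
      using st by simp
    also have "\<dots> \<le> (mnorm A * exp (2 * mnorm A) * norm x) * (t - s) powr (2 * \<alpha>)"
      using st assms mnorm_nonneg[of A] by (intro mult_left_mono powr_mono') auto
    finally show ?thesis .
  qed
  show "controlled \<alpha> W ?U"
  proof (rule controlledI[OF assms(1,2)])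
    show "hoelder_on 0 1 \<alpha> (snd ?U)"
      by (rule hoelder_onI[where C = 0]) (simp add: smooth_path_def)
    show "hoelder2_on 0 1 (2 * \<alpha>) (remainder W ?U)"
      by (rule hoelder2_onI) (rule r)
  qed
  have "dnorm \<alpha> W ?U \<le> exp (mnorm A) * norm x + 0 + 0 + mnorm A * exp (2 * mnorm A) * norm x"
  proof (rule dnorm_le)
    show "norm (fst ?U t) \<le> exp (mnorm A) * norm x" if t: "t \<in> {0..1}" for t
    proof -
      have "norm (fst ?U t) \<le> norm (sgrp A t) * norm x"
        by (simp add: smooth_path_def norm_blinfun)
      also have "norm (sgrp A t) \<le> exp (mnorm A * \<bar>t\<bar>)" by (rule norm_sgrp)
      also have "\<dots> \<le> exp (mnorm A)"
        using t mnorm_nonneg[of A] by (simp add: mult_left_le)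
      finally show ?thesis by (simp add: mult_right_mono)
    qed
  qed (use r in \<open>auto simp: smooth_path_def\<close>)
  then show "dnorm \<alpha> W ?U \<le> smooth_const A * norm x"
    by (simp add: smooth_const_def distrib_right)
qed

context lyapunov_perron
begin

section \<open>Noise, cut-off radius and solution map on a single block\<close>

definition Z :: "int \<Rightarrow> 'd rpath" where "Z j = shift_rp (of_int j) \<W>"
definition path :: "int \<Rightarrow> real \<Rightarrow> real^'d" where "path j = shift (of_int j) (fst \<W>)"
definition rad :: "int \<Rightarrow> real" where "rad j = R_cut \<alpha> C1 C2 K (Z j)"
definition T :: "int \<Rightarrow> ('d, real^'n) cpath \<Rightarrow> ('d, real^'n) cpath" where
  "T j = T_cut A F G f \<alpha> (Z j) (rad j)"

abbreviation dn :: "int \<Rightarrow> ('d, real^'n) cpath \<Rightarrow> real" where "dn j \<equiv> dnorm \<alpha> (path j)"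

lemma alpha_nonneg: "0 \<le> \<alpha>"
  using alpha by simp

lemma fst_Z [simp]: "fst (Z j) = path j"
  by (simp add: Z_def path_def shift_rp_def)

lemma rough_Z: "rough_path_on 0 1 \<alpha> (Z j)"
proof -
  obtain W WW where W: "\<W> = (W, WW)" by (cases \<W>)
  define a where "a = real_of_int j"
  have h: "hoelder_on a (a + 1) \<alpha> W" "hoelder2_on a (a + 1) (2 * \<alpha>) WW"
    and chen: "\<And>s u t. a \<le> s \<Longrightarrow> s \<le> u \<Longrightarrow> u \<le> t \<Longrightarrow> t \<le> a + 1 \<Longrightarrow>
        WW s t - WW s u - WW u t = tensor (W u - W s) (W t - W u)"
    using rough[of a "a + 1"] by (auto simp: rough_path_on_def W)
  obtain C where C: "\<And>s t. a \<le> s \<Longrightarrow> s \<le> t \<Longrightarrow> t \<le> a + 1 \<Longrightarrow> norm (W t - W s) \<le> C * (t - s) powr \<alpha>"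
    using h(1) by (rule hoelder_onE) blast
  obtain D where D: "\<And>s t. a \<le> s \<Longrightarrow> s < t \<Longrightarrow> t \<le> a + 1 \<Longrightarrow> norm (WW s t) \<le> D * (t - s) powr (2 * \<alpha>)"
    using h(2) by (rule hoelder2_onE) blast
  have "hoelder_on 0 1 \<alpha> (shift a W)"
  proof (rule hoelder_onI)
    show "norm (shift a W t - shift a W s) \<le> C * (t - s) powr \<alpha>" if "0 \<le> s" "s < t" "t \<le> 1" for s t
      using C[of "s + a" "t + a"] that by (simp add: shift_def)
  qed
  moreover have "hoelder2_on 0 1 (2 * \<alpha>) (\<lambda>s t. WW (s + a) (t + a))"
  proof (rule hoelder2_onI)
    show "norm (WW (s + a) (t + a)) \<le> D * (t - s) powr (2 * \<alpha>)" if "0 \<le> s" "s < t" "t \<le> 1" for s t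
      using D[of "s + a" "t + a"] that by simp
  qed
  moreover have "WW (s + a) (t + a) - WW (s + a) (u + a) - WW (u + a) (t + a) =
      tensor (shift a W u - shift a W s) (shift a W t - shift a W u)"
    if "0 \<le> s" "s \<le> u" "u \<le> t" "t \<le> 1" for s u t
    using chen[of "s + a" "u + a" "t + a"] that by (simp add: shift_def)
  moreover have "Z j = (shift a W, \<lambda>s t. WW (s + a) (t + a))"
    unfolding Z_def by (simp add: shift_rp_def W a_def)
  ultimately show ?thesis
    by (simp add: rough_path_on_def)
qed

lemma hoelder_path: "hoelder_on 0 1 \<alpha> (path j)"
  using rough_path_hoelder[OF rough_Z[of j]] by simp

text \<open>The equation for the radius is linear, q R = K with q \<ge> C1 > 0, so it has the unique
  solution K / q. Taking the minimum with 1 keeps q R \<le> K and meets the restriction R \<le> 1 of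
  the estimate.\<close>

lemma rad_bounds: "0 < rad j" "rad j \<le> 1"
  "C1 * rad j + C2 * rad j * (1 + hnorm \<alpha> (path j)) * (hnorm \<alpha> (path j) + hnorm2 (2 * \<alpha>) (snd (Z j))) \<le> K"
proof -
  let ?h = "hnorm \<alpha> (path j)" and ?h2 = "hnorm2 (2 * \<alpha>) (snd (Z j))"
  define q where "q = C1 + C2 * (1 + ?h) * (?h + ?h2)"
  have "0 \<le> ?h" "0 \<le> ?h2"
    using hoelder_path[of j] rough_path_hoelder2[OF rough_Z[of j]]
    by (auto simp: hnorm_def hoelder_on_def intro: hnorm2_nonneg)
  then have q: "q > 0" using C1 C2 by (simp add: q_def add_pos_nonneg)
  have e: "C1 * R + C2 * R * (1 + ?h) * (?h + ?h2) = q * R" for R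
    by (simp add: q_def algebra_simps)
  have "R_tilde \<alpha> C1 C2 K (Z j) = K / q"
    unfolding R_tilde_def fst_Z e using q by (intro the_equality) (auto simp: field_simps)
  then have r: "rad j = min (K / q) 1" by (simp add: rad_def R_cut_def)
  then show "0 < rad j" "rad j \<le> 1" using q K by auto
  have "q * rad j \<le> q * (K / q)" using q r by (intro mult_left_mono) auto
  then show "C1 * rad j + C2 * rad j * (1 + ?h) * (?h + ?h2) \<le> K"
    unfolding e using q by simp
qed

lemma ctrl_controlled: "U \<in> ctrl \<alpha> W \<Longrightarrow> controlled \<alpha> W U"
  by (simp add: ctrl_iff)

lemma T_ctrl: "U \<in> ctrl \<alpha> (path j) \<Longrightarrow> T j U \<in> ctrl \<alpha> (path j)"
  unfolding T_def using T_cut_ctrl[OF alpha rough_Z F G] by simp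

lemma T_lipschitz:
  assumes "U \<in> ctrl \<alpha> (path j)" "V \<in> ctrl \<alpha> (path j)"
  shows "dn j (cdiff (T j U) (T j V)) \<le> K * dn j (cdiff U V)"
proof -
  have "dn j (cdiff (T j U) (T j V)) \<le>
    (C1 * rad j + C2 * rad j * (1 + hnorm \<alpha> (path j)) * (hnorm \<alpha> (path j) + hnorm2 (2 * \<alpha>) (snd (Z j)))) * dn j (cdiff U V)"
    using estimate[unfolded T_cut_estimate_def, rule_format, of "Z j" "rad j" U V] rough_Z[of j] rad_bounds[of j] assms
    by (simp add: T_def)
  also have "\<dots> \<le> K * dn j (cdiff U V)"
    by (intro mult_right_mono rad_bounds dnorm_nonneg[OF _ alpha_nonneg] controlled_cdiff ctrl_controlled assms alpha_nonneg)
  finally show ?thesis .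
qed

text \<open>Lipschitz estimate against the zero path, which T fixes.\<close>

lemma T_bound:
  assumes "U \<in> ctrl \<alpha> (path j)"
  shows "dn j (T j U) \<le> K * dn j U"
proof -
  have "T j zero_path = zero_path"
    unfolding T_def by (rule T_cut_zero_path[OF F G])
  moreover have "dn j (cdiff V zero_path) = dn j V" if "V \<in> ctrl \<alpha> (path j)" for V
    by (rule dnorm_cdiff_zero_path[OF ctrl_controlled[OF that] alpha_nonneg])
  ultimately show ?thesis
    using T_lipschitz[OF assms zero_path_ctrl] assms T_ctrl[OF assms] by simp
qed

text \<open>Membership in the ball of radius D of the weighted norm, apart from matching and
  extensionality; \<open>near\<close> is the corresponding distance bound. Explicit bounds replace
  the supremum over the blocks.\<close>

definition tame :: "real \<Rightarrow> (int \<Rightarrow> ('d, real^'n) cpath) \<Rightarrow> bool" where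
  "tame D U \<longleftrightarrow> (\<forall>j\<le>-1. U j \<in> ctrl \<alpha> (path j) \<and> dn j (U j) \<le> D * exp (\<eta> * of_int j))"

definition near :: "real \<Rightarrow> (int \<Rightarrow> ('d, real^'n) cpath) \<Rightarrow> (int \<Rightarrow> ('d, real^'n) cpath) \<Rightarrow> bool" where
  "near D U V \<longleftrightarrow> (\<forall>j\<le>-1. dn j (cdiff (U j) (V j)) \<le> D * exp (\<eta> * of_int j))"

definition endv :: "(int \<Rightarrow> ('d, real^'n) cpath) \<Rightarrow> int \<Rightarrow> real^'n" where
  "endv U k = fst (T (k - 1) (U (k - 1))) 1"

text \<open>This is \<open>x\<^sub>i\<close> in the decomposition \<open>J(U)\<^sub>i(t) = S(t) x\<^sub>i + T\<^sub>i(t)\<close>.\<close>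

definition base :: "(int \<Rightarrow> ('d, real^'n) cpath) \<Rightarrow> int \<Rightarrow> real^'n" where
  "base U i = sgrp A (of_int (i - 1)) (Pc' \<xi>) + shadow (endv U) i"

definition J :: "(int \<Rightarrow> ('d, real^'n) cpath) \<Rightarrow> int \<Rightarrow> ('d, real^'n) cpath" where
  "J U = Jd A F G f \<alpha> (R_cut \<alpha> C1 C2 K) \<W> U \<xi>"

lemma tame_nonneg: "tame D U \<Longrightarrow> 0 \<le> D"
proof -
  assume t: "tame D U"
  then have "0 \<le> dn (-1) (U (-1))"
    by (intro dnorm_nonneg[OF ctrl_controlled alpha_nonneg]) (simp add: tame_def)
  also have "\<dots> \<le> D * exp (\<eta> * of_int (-1))"
    using t unfolding tame_def by blast
  finally show "0 \<le> D" by (simp add: zero_le_mult_iff)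
qed

section \<open>Decomposition of the map and its contraction estimate\<close>

lemma norm_endv:
  assumes "tame D U" "k \<le> 0"
  shows "norm (endv U k) \<le> K * D * exp (\<eta> * of_int (k - 1))"
proof -
  have U: "U (k - 1) \<in> ctrl \<alpha> (path (k - 1))" "dn (k - 1) (U (k - 1)) \<le> D * exp (\<eta> * of_int (k - 1))"
    using assms(1)[unfolded tame_def, rule_format, of "k - 1"] assms(2) by auto
  have "norm (endv U k) \<le> dn (k - 1) (T (k - 1) (U (k - 1)))"
    unfolding endv_def by (rule norm_fst_le_dnorm[OF ctrl_controlled[OF T_ctrl[OF U(1)]] alpha_nonneg]) simp
  also have "\<dots> \<le> K * dn (k - 1) (U (k - 1))" by (rule T_bound[OF U(1)])
  also have "\<dots> \<le> K * (D * exp (\<eta> * of_int (k - 1)))" using U(2) K by simp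
  finally show ?thesis by simp
qed

lemma norm_endv_diff:
  assumes "tame D U" "tame D' V" "near E U V" "k \<le> 0"
  shows "norm (endv U k - endv V k) \<le> K * E * exp (\<eta> * of_int (k - 1))"
proof -
  have U: "U (k - 1) \<in> ctrl \<alpha> (path (k - 1))" "V (k - 1) \<in> ctrl \<alpha> (path (k - 1))"
    using assms unfolding tame_def by auto
  have E: "dn (k - 1) (cdiff (U (k - 1)) (V (k - 1))) \<le> E * exp (\<eta> * of_int (k - 1))"
    using assms(3)[unfolded near_def, rule_format, of "k - 1"] assms(4) by auto
  have "norm (endv U k - endv V k) \<le> dn (k - 1) (cdiff (T (k - 1) (U (k - 1))) (T (k - 1) (V (k - 1))))"
    unfolding endv_def
    using norm_fst_le_dnorm[OF controlled_cdiff[OF ctrl_controlled[OF T_ctrl[OF U(1)]] ctrl_controlled[OF T_ctrl[OF U(2)]] alpha_nonneg] alpha_nonneg, of 1]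
    by simp
  also have "\<dots> \<le> K * dn (k - 1) (cdiff (U (k - 1)) (V (k - 1)))" by (rule T_lipschitz[OF U])
  also have "\<dots> \<le> K * (E * exp (\<eta> * of_int (k - 1)))" using E K by simp
  finally show ?thesis by simp
qed

text \<open>The integral over [t,1] is the full block integral minus the one over [0,t]. The full
  one supplies the index k = i missing from the center sum; the other one adds P^c T(t) to the P^s
  T(t) of the stable integral and completes it to T(t).\<close>

lemma J1_eq:
  assumes U: "tame D U" and i: "i \<le> 0" and t: "t \<in> {0..1}"
  shows "J1 A F G f \<alpha> (R_cut \<alpha> C1 C2 K) \<W> U \<xi> i t = sgrp A t (base U i) + fst (T (i - 1) (U (i - 1))) t"
proof -
  let ?e = "endv U" and ?T = "fst (T (i - 1) (U (i - 1)))"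
  have block: "block A F G f \<alpha> (R_cut \<alpha> C1 C2 K) \<W> U P k a b \<tau> =
      sgrp A \<tau> (P (sgrp A (- b) (fst (T (k - 1) (U (k - 1))) b) - sgrp A (- a) (fst (T (k - 1) (U (k - 1))) a)))"
    if P: "\<And>t. P o\<^sub>L sgrp A t = sgrp A t o\<^sub>L P" and "k \<le> 0" "0 \<le> a" "a \<le> b" "b \<le> 1" for P k a b \<tau>
  proof -
    have "U (k - 1) \<in> ctrl \<alpha> (fst (Z (k - 1)))"
      using U \<open>k \<le> 0\<close> unfolding tame_def by simp
    from conv_eq_T_cut[OF alpha rough_Z F G this P that(3-5), where f = f and R = "rad (k - 1)" and \<tau> = \<tau>]
    show ?thesis
      unfolding block_def Let_def Z_def[symmetric] rad_def[symmetric] T_def .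
  qed
  have T0: "fst (T (k - 1) (U (k - 1))) 0 = 0" if "k \<le> 0" for k
    unfolding T_def by (rule T_cut_0[OF alpha rough_Z F G]) (use U that in \<open>simp add: tame_def\<close>)
  have full: "block A F G f \<alpha> (R_cut \<alpha> C1 C2 K) \<W> U Pc' k 0 1 1 = Pc' (?e k)"
    "block A F G f \<alpha> (R_cut \<alpha> C1 C2 K) \<W> U Ps' k 0 1 1 = Ps' (?e k)" if "k \<le> 0" for k
    using that by (simp_all add: block sgrp_commute T0 sgrp_commute_apply blinfun.zero_right endv_def)
  have b1: "block A F G f \<alpha> (R_cut \<alpha> C1 C2 K) \<W> U Pc' i t 1 t = sgrp A t (sgrp A (- 1) (Pc' (?e i))) - Pc' (?T t)"
    using t i by (simp add: block sgrp_commute sgrp_commute_apply blinfun.diff_right endv_def)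
  have b2: "block A F G f \<alpha> (R_cut \<alpha> C1 C2 K) \<W> U Ps' i 0 t t = Ps' (?T t)"
    using t i by (simp add: block sgrp_commute T0 sgrp_commute_apply blinfun.zero_right)
  have S: "sgrp A (t + of_int m) x = sgrp A t (sgrp A (of_int m) x)" for m :: int and x
    by (simp add: sgrp_add)
  have KD: "0 \<le> K * D" using tame_nonneg[OF U] K by simp
  have s: "(\<lambda>k. sgrp A (of_int (i - 1 - k)) (Ps' (?e k))) summable_on {..i - 1}"
    \<comment> \<open>Summability is what allows S(t) to be pulled out of the infinite sum
      below.\<close>
    by (rule stable_summable[where E = "K * D", OF norm_endv[OF U] i KD])
  have "(\<Sum>\<^sub>\<infinity>k\<in>{..i-1}. sgrp A (t + of_int (i - 1 - k)) (block A F G f \<alpha> (R_cut \<alpha> C1 C2 K) \<W> U Ps' k 0 1 1))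
     = (\<Sum>\<^sub>\<infinity>k\<in>{..i-1}. sgrp A t (sgrp A (of_int (i - 1 - k)) (Ps' (?e k))))"
    using i by (intro infsum_cong) (simp only: S, simp add: full)
  also have "\<dots> = sgrp A t (\<Sum>\<^sub>\<infinity>k\<in>{..i-1}. sgrp A (of_int (i - 1 - k)) (Ps' (?e k)))"
    using has_sum_bounded_linear[OF blinfun.bounded_linear_right[of "sgrp A t"] has_sum_infsum[OF s]] by (rule infsumI)
  finally have s1: "(\<Sum>\<^sub>\<infinity>k\<in>{..i-1}. sgrp A (t + of_int (i - 1 - k)) (block A F G f \<alpha> (R_cut \<alpha> C1 C2 K) \<W> U Ps' k 0 1 1))
     = sgrp A t (\<Sum>\<^sub>\<infinity>k\<in>{..i-1}. sgrp A (of_int (i - 1 - k)) (Ps' (?e k)))" .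
  have s2: "(\<Sum>k\<in>{i+1..0}. sgrp A (t + of_int (i - 1 - k)) (block A F G f \<alpha> (R_cut \<alpha> C1 C2 K) \<W> U Pc' k 0 1 1))
     = sgrp A t (\<Sum>k\<in>{i+1..0}. sgrp A (of_int (i - 1 - k)) (Pc' (?e k)))"
    unfolding blinfun.sum_right by (intro sum.cong refl) (simp only: S, simp add: full)
  \<comment> \<open>\<open>J1\<close> sums from i + 1, \<open>shadow\<close> from i; the extra term
    is the first summand of \<open>b1\<close>.\<close>
  have "{i..0} = insert i {i+1..0}" using i by auto
  then have s3: "(\<Sum>k\<in>{i..0}. sgrp A (of_int (i - 1 - k)) (Pc' (?e k))) =
      sgrp A (- 1) (Pc' (?e i)) + (\<Sum>k\<in>{i+1..0}. sgrp A (of_int (i - 1 - k)) (Pc' (?e k)))"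
    by simp
  show ?thesis
    unfolding J1_def s1 s2 b1 b2 S[of "i - 1"] base_def shadow_def s3
    using Pc_plus_Ps[of "?T t"] by (simp add: blinfun.add_right blinfun.diff_right algebra_simps)
qed

text \<open>The two projected derivatives add up to the cut-off G, because P^c + P^s is the
  identity.\<close>

lemma J2_eq:
  assumes "t \<in> {0..1}"
  shows "J2 A G f \<alpha> (R_cut \<alpha> C1 C2 K) \<W> U i t = snd (T (i - 1) (U (i - 1))) t"
proof -
  have "(Pc' o\<^sub>L g) + (Ps' o\<^sub>L g) = g" for g :: "(real^'d) \<Rightarrow>\<^sub>L (real^'n)"
    by (rule blinfun_eqI) (simp add: blinfun.add_left Pc_plus_Ps)
  then show ?thesis
    using assms unfolding J2_def Let_def Z_def[symmetric] rad_def[symmetric] by (simp add: T_def T_cut_def)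
qed

lemma J_apply:
  assumes "tame D U" "j \<le> -1" "t \<in> {0..1}"
  shows "fst (J U j) t = fst (smooth_path A (base U (j + 1)) :: ('d, real^'n) cpath) t + fst (T j (U j)) t"
    "snd (J U j) t = snd (smooth_path A (base U (j + 1))) t + snd (T j (U j)) t"
  using J1_eq[OF assms(1), of "j + 1" t] J2_eq[of t U "j + 1"] assms
  by (auto simp: J_def Jd_def smooth_path_def)

lemma J_ctrl:
  assumes "tame D U" "j \<le> -1"
  shows "J U j \<in> ctrl \<alpha> (path j)"
    and "dn j (J U j) \<le> smooth_const A * norm (base U (j + 1)) + dn j (T j (U j))"
proof -
  have "U j \<in> ctrl \<alpha> (path j)" using assms unfolding tame_def by blast
  note T = ctrl_controlled[OF T_ctrl[OF this]]
  have S: "controlled \<alpha> (path j) (smooth_path A (base U (j + 1)))"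
    using alpha by (intro controlled_smooth_path hoelder_path) auto
  have "J U j \<in> extensional {0..1} \<times> extensional {0..1}"
    using assms by (simp add: J_def Jd_def)
  then show "J U j \<in> ctrl \<alpha> (path j)"
    using dnorm_triangle(1)[OF S T alpha_nonneg J_apply[OF assms]] by (auto simp: ctrl_iff)
  have "dn j (J U j) \<le> dn j (smooth_path A (base U (j + 1))) + dn j (T j (U j))"
    by (rule dnorm_triangle(2)[OF S T alpha_nonneg J_apply[OF assms]])
  also have "dn j (smooth_path A (base U (j + 1))) \<le> smooth_const A * norm (base U (j + 1))"
    using alpha by (intro dnorm_smooth_path hoelder_path) auto
  finally show "dn j (J U j) \<le> smooth_const A * norm (base U (j + 1)) + dn j (T j (U j))"
    by simp
qed

lemma J_tame:
  assumes "tame D U"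
  shows "\<exists>D'. tame D' (J U)"
proof (intro exI)
  show "tame (smooth_const A * (Mc * norm Pc' * norm \<xi> + \<kappa> * (K * D)) + K * D) (J U)"
    unfolding tame_def
  proof (intro allI impI conjI)
    fix j :: int assume j: "j \<le> -1"
    show "J U j \<in> ctrl \<alpha> (path j)" by (rule J_ctrl[OF assms j])
    have U: "U j \<in> ctrl \<alpha> (path j)" "dn j (U j) \<le> D * exp (\<eta> * of_int j)"
      using assms j unfolding tame_def by auto
    have KD: "0 \<le> K * D" using tame_nonneg[OF assms] K by simp
    have "norm (base U (j + 1)) \<le> norm (sgrp A (of_int j) (Pc' \<xi>)) + norm (shadow (endv U) (j + 1))"
      unfolding base_def by (simp add: norm_triangle_ineq)
    also have "norm (sgrp A (of_int j) (Pc' \<xi>)) \<le> Mc * norm Pc' * exp (\<gamma> * of_int j) * norm \<xi>"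
      using j by (intro center_decay) simp
    \<comment> \<open>For j < 0 the inequality \<eta> < 0 \<le> \<gamma> gives e^(\<gamma> j) \<le>
      e^(\<eta> j): the center orbit of \<xi> fits the weight.\<close>
    also have "\<dots> \<le> Mc * norm Pc' * exp (\<eta> * of_int j) * norm \<xi>"
      using j eta CS'(2,3) by (intro mult_right_mono mult_left_mono) (auto intro!: mult_right_mono_neg)
    also have "norm (shadow (endv U) (j + 1)) \<le> \<kappa> * (K * D) * exp (\<eta> * of_int (j + 1 - 1))"
      using j norm_endv[OF assms] KD by (intro norm_shadow) auto
    finally have b: "norm (base U (j + 1)) \<le> (Mc * norm Pc' * norm \<xi> + \<kappa> * (K * D)) * exp (\<eta> * of_int j)"
      by (simp add: algebra_simps)
    have TU: "dn j (T j (U j)) \<le> K * (D * exp (\<eta> * of_int j))"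
      using T_bound[OF U(1)] mult_left_mono[OF U(2), of K] K by linarith
    have "dn j (J U j) \<le> smooth_const A * norm (base U (j + 1)) + dn j (T j (U j))"
      by (rule J_ctrl[OF assms j])
    also have "\<dots> \<le> smooth_const A * ((Mc * norm Pc' * norm \<xi> + \<kappa> * (K * D)) * exp (\<eta> * of_int j)) + K * (D * exp (\<eta> * of_int j))"
      using b smooth_const_pos[of A] TU by (intro add_mono mult_left_mono) auto
    finally show "dn j (J U j) \<le> (smooth_const A * (Mc * norm Pc' * norm \<xi> + \<kappa> * (K * D)) + K * D) * exp (\<eta> * of_int j)"
      by (simp add: algebra_simps)
  qed
qed

text \<open>The term with \<xi> cancels in the difference. The block's own T contributes K E, and
  the starting value, propagated as a smooth path, contributes
  \<open>smooth_const A * \<kappa>\<close> times K E.\<close>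

lemma J_near:
  assumes U: "tame D U" and V: "tame D' V" and near: "near E U V" and E: "0 \<le> E"
  shows "near (K * (1 + smooth_const A * \<kappa>) * E) (J U) (J V)"
  unfolding near_def
proof (intro allI impI)
  fix j :: int assume j: "j \<le> -1"
  have UV: "U j \<in> ctrl \<alpha> (path j)" "V j \<in> ctrl \<alpha> (path j)" "dn j (cdiff (U j) (V j)) \<le> E * exp (\<eta> * of_int j)"
    using U V near j unfolding tame_def near_def by auto
  note T = controlled_cdiff[OF ctrl_controlled[OF T_ctrl[OF UV(1)]] ctrl_controlled[OF T_ctrl[OF UV(2)]] alpha_nonneg]
  define x where "x = base U (j + 1) - base V (j + 1)"
  have S: "controlled \<alpha> (path j) (smooth_path A x)"
    using alpha by (intro controlled_smooth_path hoelder_path) auto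
  have KD: "0 \<le> K * D" "0 \<le> K * D'" using tame_nonneg[OF U] tame_nonneg[OF V] K by auto
  have j': "j + 1 \<le> 0" using j by simp
  have "x = shadow (\<lambda>k. endv U k - endv V k) (j + 1)"
    unfolding x_def base_def
    using shadow_diff[OF norm_endv[OF U] KD(1) norm_endv[OF V] KD(2) j'] by simp
  also have "norm \<dots> \<le> \<kappa> * (K * E) * exp (\<eta> * of_int (j + 1 - 1))"
    using norm_endv_diff[OF U V near] j' E K by (intro norm_shadow) auto
  finally have x: "norm x \<le> \<kappa> * (K * E) * exp (\<eta> * of_int j)" by simp
  have "dn j (cdiff (J U j) (J V j)) \<le> dn j (smooth_path A x) + dn j (cdiff (T j (U j)) (T j (V j)))"
    by (rule dnorm_triangle(2)[OF S T alpha_nonneg])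
      (simp_all add: J_apply[OF U j] J_apply[OF V j] smooth_path_def x_def blinfun.diff_right)
  also have "\<dots> \<le> smooth_const A * norm x + K * dn j (cdiff (U j) (V j))"
    using alpha by (intro add_mono dnorm_smooth_path hoelder_path T_lipschitz UV) auto
  also have "\<dots> \<le> smooth_const A * (\<kappa> * (K * E) * exp (\<eta> * of_int j)) + K * (E * exp (\<eta> * of_int j))"
    using x UV(3) K smooth_const_pos[of A] by (intro add_mono mult_left_mono) auto
  finally show "dn j (cdiff (J U j) (J V j)) \<le> K * (1 + smooth_const A * \<kappa>) * E * exp (\<eta> * of_int j)"
    by (simp add: algebra_simps)
qed

text \<open>T starts at 0, so block j starts at its base point; this is the end value of block j - 1
  by the recursion \<open>shadow_step\<close> and the group law for the orbit of \<xi>.\<close>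

lemma J_match:
  assumes "tame D U" "j \<le> -1"
  shows "fst (J U j) 0 = fst (J U (j - 1)) 1"
proof -
  have j: "j - 1 \<le> -1" "j + 1 \<le> 0" using assms(2) by auto
  have "U j \<in> ctrl \<alpha> (fst (Z j))" using assms unfolding tame_def by simp
  then have "fst (T j (U j)) 0 = 0" unfolding T_def by (rule T_cut_0[OF alpha rough_Z F G])
  then have "fst (J U j) 0 = base U (j + 1)"
    using J_apply(1)[OF assms, of 0] by (simp add: smooth_path_def)
  also have "\<dots> = sgrp A 1 (sgrp A (of_int (j - 1)) (Pc' \<xi>)) + (sgrp A 1 (shadow (endv U) j) + endv U j)"
  proof -
    have "1 + of_int (j - 1) = (of_int j :: real)" by simp
    then have "sgrp A (of_int j) (Pc' \<xi>) = sgrp A 1 (sgrp A (of_int (j - 1)) (Pc' \<xi>))"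
      using sgrp_add[of A 1 "of_int (j - 1)"] by (metis blinfun_apply_blinfun_compose)
    moreover have "0 \<le> K * D" using tame_nonneg[OF assms(1)] K by simp
    then have "sgrp A 1 (shadow (endv U) (j + 1 - 1)) + endv U (j + 1 - 1) = shadow (endv U) (j + 1)"
      using norm_endv[OF assms(1)] j(2) by (intro shadow_step) auto
    ultimately show ?thesis by (simp add: base_def)
  qed
  also have "\<dots> = fst (J U (j - 1)) 1"
    using J_apply(1)[OF assms(1) j(1), of 1] by (simp add: smooth_path_def base_def endv_def blinfun.add_right)
  finally show ?thesis .
qed

end

section \<open>The fixed point\<close>

lemma dnorm_cdiff_commute: "dnorm \<alpha> W (cdiff U V) = dnorm \<alpha> W (cdiff V U)"
proof -
  have s: "snorm g = snorm h" if "\<And>t. g t = - h t" for g h :: "real \<Rightarrow> 'x::real_normed_vector"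
    by (simp add: snorm_def that)
  have h: "hnorm2 a g = hnorm2 a h" if "\<And>s t. g s t = - h s t" for a and g h :: "real \<Rightarrow> real \<Rightarrow> 'y::real_normed_vector"
    by (simp add: hnorm2_def that)
  show ?thesis
    unfolding dnorm_def hnorm_def
    by (intro arg_cong2[where f = "(+)"] s h) (simp_all add: remainder_cdiff)
qed

context lyapunov_perron
begin

text \<open>The index i - 1 with i \<le> 0 becomes j \<le> -1, and finiteness of the weighted
  supremum becomes the existence of a \<open>tame\<close> bound.\<close>

lemma BC_iff:
  "U \<in> BC \<alpha> \<eta> (fst \<W>) \<longleftrightarrow> U \<in> extensional {..-1} \<and> (\<exists>D. tame D U) \<and>
     (\<forall>j\<le>-1. fst (U j) 0 = fst (U (j - 1)) 1)"
proof -
  have shift_all: "(\<forall>i\<le>0. P (i - 1)) \<longleftrightarrow> (\<forall>j\<le>-1. P j)" for P :: "int \<Rightarrow> bool"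
  proof (intro iffI allI impI)
    fix j :: int assume P: "\<forall>i\<le>0. P (i - 1)" and "j \<le> -1"
    then have "j + 1 \<le> 0" by simp
    with P have "P (j + 1 - 1)" by blast
    then show "P j" by simp
  next
    fix i :: int assume P: "\<forall>j\<le>-1. P j" and "i \<le> 0"
    then have "i - 1 \<le> -1" by simp
    with P show "P (i - 1)" by blast
  qed
  have "bdd_above ((\<lambda>i. exp (- \<eta> * of_int (i - 1)) * dn (i - 1) (U (i - 1))) ` {..0}) \<longleftrightarrow>
      (\<exists>D. \<forall>i\<le>0. exp (- \<eta> * of_int (i - 1)) * dn (i - 1) (U (i - 1)) \<le> D)"
    by (auto simp: bdd_above_def)
  also have "\<dots> \<longleftrightarrow> (\<exists>D. \<forall>i\<le>0. dn (i - 1) (U (i - 1)) \<le> D * exp (\<eta> * of_int (i - 1)))"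
  proof -
    have "exp (- \<eta> * x) * y \<le> D \<longleftrightarrow> y \<le> D * exp (\<eta> * x)" for x y D
      by (simp add: exp_minus divide_simps mult.commute)
    then show ?thesis by simp
  qed
  also have "\<dots> \<longleftrightarrow> (\<exists>D. \<forall>j\<le>-1. dn j (U j) \<le> D * exp (\<eta> * of_int j))"
    using shift_all[of "\<lambda>j. dn j (U j) \<le> D * exp (\<eta> * of_int j)" for D] by simp
  finally have b: "bdd_above ((\<lambda>i. exp (- \<eta> * of_int (i - 1)) * dn (i - 1) (U (i - 1))) ` {..0}) \<longleftrightarrow>
      (\<exists>D. \<forall>j\<le>-1. dn j (U j) \<le> D * exp (\<eta> * of_int j))" .
  have c: "(\<forall>i\<le>0. U (i - 1) \<in> ctrl \<alpha> (path (i - 1))) \<longleftrightarrow> (\<forall>j\<le>-1. U j \<in> ctrl \<alpha> (path j))"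
    by (rule shift_all)
  have m: "(\<forall>i\<le>0. fst (U (i - 1)) 0 = fst (U (i - 2)) 1) \<longleftrightarrow> (\<forall>j\<le>-1. fst (U j) 0 = fst (U (j - 1)) 1)"
    using shift_all[of "\<lambda>j. fst (U j) 0 = fst (U (j - 1)) 1"] by simp
  show ?thesis
    unfolding BC_def path_def[symmetric] mem_Collect_eq b c m tame_def by blast
qed

lemma J_BC: "U \<in> BC \<alpha> \<eta> (fst \<W>) \<Longrightarrow> J U \<in> BC \<alpha> \<eta> (fst \<W>)"
proof -
  assume "U \<in> BC \<alpha> \<eta> (fst \<W>)"
  then obtain D where D: "tame D U" unfolding BC_iff by blast
  have "J U \<in> extensional {..-1}" by (simp add: J_def Jd_def)
  then show ?thesis
    unfolding BC_iff using J_tame[OF D] J_match[OF D] by blast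
qed

section \<open>Limits and completeness for the weighted distance\<close>

lemma near_self: "near 0 U U"
  by (simp add: near_def dnorm_cdiff_self)

lemma near_triangle:
  assumes "near D U V" "near D' V X" "tame a U" "tame b V" "tame c X"
  shows "near (D + D') U X"
  unfolding near_def
proof (intro allI impI)
  fix j :: int assume j: "j \<le> -1"
  have "controlled \<alpha> (path j) (U j)" "controlled \<alpha> (path j) (V j)" "controlled \<alpha> (path j) (X j)"
    using assms(3-5) j unfolding tame_def by (auto intro: ctrl_controlled)
  from dnorm_cdiff_triangle[OF this alpha_nonneg]
  have "dn j (cdiff (U j) (X j)) \<le> dn j (cdiff (U j) (V j)) + dn j (cdiff (V j) (X j))" .
  also have "\<dots> \<le> D * exp (\<eta> * of_int j) + D' * exp (\<eta> * of_int j)"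
    using assms(1,2) j unfolding near_def by (intro add_mono) auto
  finally show "dn j (cdiff (U j) (X j)) \<le> (D + D') * exp (\<eta> * of_int j)"
    by (simp add: distrib_right)
qed

lemma near_tendsto:
  assumes "\<And>n. near (a * (1 / 4) ^ n) (u n) X" "\<And>n. u n \<in> BC \<alpha> \<eta> (fst \<W>)" "X \<in> BC \<alpha> \<eta> (fst \<W>)"
    and j: "j \<le> -1" and t: "t \<in> {0..1}"
  shows "(\<lambda>n. fst (u n j) t) \<longlonglongrightarrow> fst (X j) t" "(\<lambda>n. snd (u n j) t) \<longlonglongrightarrow> snd (X j) t"
proof -
  have ctrl: "V j \<in> ctrl \<alpha> (path j)" if "V \<in> BC \<alpha> \<eta> (fst \<W>)"
    for V :: "int \<Rightarrow> ('d, real^'n) cpath"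
    using that j unfolding BC_iff tame_def by blast
  have c: "controlled \<alpha> (path j) (cdiff (u n j) (X j))" for n
    using assms(2,3) by (intro controlled_cdiff ctrl_controlled ctrl alpha_nonneg)
  have d: "dn j (cdiff (u n j) (X j)) \<le> a * (1 / 4) ^ n * exp (\<eta> * of_int j)" for n
    using assms(1)[of n] j unfolding near_def by blast
  have z: "(\<lambda>n. a * (1 / 4) ^ n * exp (\<eta> * of_int j)) \<longlonglongrightarrow> 0"
    by (rule tendsto_mult_left_zero[OF tendsto_mult_right_zero[OF LIMSEQ_power_zero]]) simp
  have "(\<lambda>n. fst (u n j) t - fst (X j) t) \<longlonglongrightarrow> 0"
    by (rule Lim_null_comparison[OF always_eventually z])
      (use order_trans[OF norm_fst_le_dnorm[OF c alpha_nonneg t] d] in simp)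
  then show "(\<lambda>n. fst (u n j) t) \<longlonglongrightarrow> fst (X j) t" by (simp only: LIM_zero_iff)
  have "(\<lambda>n. snd (u n j) t - snd (X j) t) \<longlonglongrightarrow> 0"
    by (rule Lim_null_comparison[OF always_eventually z])
      (use order_trans[OF norm_snd_le_dnorm[OF c alpha_nonneg t] d] in simp)
  then show "(\<lambda>n. snd (u n j) t) \<longlonglongrightarrow> snd (X j) t" by (simp only: LIM_zero_iff)
qed

text \<open>Weighted closeness forces pointwise convergence on [0,1]; all components are
  extensional, so pointwise equality there is equality of sequences.\<close>

lemma near_limit_unique:
  assumes "\<And>n. near (a * (1 / 4) ^ n) (u n) X" "\<And>n. near (b * (1 / 4) ^ n) (u n) Y"
    "\<And>n. u n \<in> BC \<alpha> \<eta> (fst \<W>)" "X \<in> BC \<alpha> \<eta> (fst \<W>)" "Y \<in> BC \<alpha> \<eta> (fst \<W>)"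
  shows "X = Y"
proof (rule extensionalityI[of _ "{..-1}"])
  show "X \<in> extensional {..-1}" "Y \<in> extensional {..-1}"
    using assms(4,5) by (simp_all add: BC_iff)
  fix j :: int assume "j \<in> {..-1}"
  then have j: "j \<le> -1" by simp
  note X = near_tendsto[OF assms(1,3,4) j] and Y = near_tendsto[OF assms(2,3,5) j]
  have e: "fst (X j) \<in> extensional {0..1}" "snd (X j) \<in> extensional {0..1}"
    "fst (Y j) \<in> extensional {0..1}" "snd (Y j) \<in> extensional {0..1}"
    using assms(4,5) j by (auto simp: BC_iff tame_def ctrl_iff)
  have "fst (X j) = fst (Y j)"
    by (rule extensionalityI[OF e(1,3)]) (rule LIMSEQ_unique[OF X(1) Y(1)])
  moreover have "snd (X j) = snd (Y j)"
    by (rule extensionalityI[OF e(2,4)]) (rule LIMSEQ_unique[OF X(2) Y(2)])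
  ultimately show "X j = Y j" by (rule prod_eqI)
qed

text \<open>The limit is taken on each block separately. The weighted bounds are uniform in the
  block, and pointwise convergence of the end values carries the matching condition over to the
  limit.\<close>

lemma near_complete:
  assumes u: "\<And>n. u n \<in> BC \<alpha> \<eta> (fst \<W>)" and E: "E \<longlonglongrightarrow> 0"
    and cau: "\<And>n m. n \<le> m \<Longrightarrow> near (E n) (u n) (u m)"
  obtains X where "X \<in> BC \<alpha> \<eta> (fst \<W>)" "\<And>n. near (4 * E n) (u n) X"
proof -
  have ctrl: "u n j \<in> ctrl \<alpha> (path j)" if "j \<le> -1" for n j
    using u[of n] that unfolding BC_iff tame_def by blast
  define P where "P j L \<longleftrightarrow> L \<in> ctrl \<alpha> (path j) \<and>
      (\<forall>n. dn j (cdiff (u n j) L) \<le> 4 * (E n * exp (\<eta> * of_int j))) \<and>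
      (\<forall>t\<in>{0..1}. (\<lambda>n. fst (u n j) t) \<longlonglongrightarrow> fst L t)" for j L
  have "\<exists>L. j \<le> -1 \<longrightarrow> P j L" for j
  proof (cases "j \<le> -1")
    case True
    have lim: "(\<lambda>n. E n * exp (\<eta> * of_int j)) \<longlonglongrightarrow> 0"
      using E by (rule tendsto_mult_left_zero)
    have "dn j (cdiff (u n j) (u m j)) \<le> E n * exp (\<eta> * of_int j)" if "n \<le> m" for n m
      using cau[OF that] True unfolding near_def by blast
    then show ?thesis
    proof (rule controlled_limit[OF ctrl[OF True] alpha_nonneg hoelder_path lim])
      fix L assume "L \<in> ctrl \<alpha> (path j)" "\<And>n. dn j (cdiff (u n j) L) \<le> 4 * (E n * exp (\<eta> * of_int j))"
        "\<And>t. t \<in> {0..1} \<Longrightarrow> (\<lambda>n. fst (u n j) t) \<longlonglongrightarrow> fst L t"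
      then have "P j L" unfolding P_def by blast
      then show ?thesis by blast
    qed
  qed blast
  then have "\<exists>L. \<forall>j. j \<le> -1 \<longrightarrow> P j (L j)" by (intro choice allI)
  then obtain L where "\<And>j. j \<le> -1 \<Longrightarrow> P j (L j)" by blast
  then have L: "\<And>j. j \<le> -1 \<Longrightarrow> L j \<in> ctrl \<alpha> (path j)"
    "\<And>j n. j \<le> -1 \<Longrightarrow> dn j (cdiff (u n j) (L j)) \<le> 4 * (E n * exp (\<eta> * of_int j))"
    "\<And>j t. j \<le> -1 \<Longrightarrow> t \<in> {0..1} \<Longrightarrow> (\<lambda>n. fst (u n j) t) \<longlonglongrightarrow> fst (L j) t"
    unfolding P_def by blast+
  define X where "X = restrict L {..-1}"
  have X: "X j = L j" if "j \<le> -1" for j using that by (simp add: X_def)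
  have near: "near (4 * E n) (u n) X" for n
    unfolding near_def using L(2) X by (simp add: mult.assoc)
  obtain D where D: "tame D (u 0)" using u[of 0] by (auto simp: BC_iff)
  \<comment> \<open>The limit is at weighted distance at most 4 E 0 from the first iterate, which
    lies in the space.\<close>
  have "tame (D + 4 * E 0) X"
    unfolding tame_def
  proof (intro allI impI conjI)
    fix j :: int assume j: "j \<le> -1"
    show Xj: "X j \<in> ctrl \<alpha> (path j)" using L(1) X j by simp
    note c = ctrl_controlled[OF ctrl[OF j]] ctrl_controlled[OF Xj]
    have "dn j (X j) = dn j (cdiff (X j) zero_path)"
      by (rule dnorm_cdiff_zero_path[symmetric, OF c(2) alpha_nonneg])
    also have "\<dots> \<le> dn j (cdiff (X j) (u 0 j)) + dn j (cdiff (u 0 j) zero_path)"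
      by (rule dnorm_cdiff_triangle[OF c(2,1) ctrl_controlled[OF zero_path_ctrl] alpha_nonneg])
    also have "\<dots> = dn j (cdiff (u 0 j) (X j)) + dn j (u 0 j)"
      by (simp only: dnorm_cdiff_zero_path[OF c(1) alpha_nonneg] dnorm_cdiff_commute[of _ _ "X j" "u 0 j"])
    also have "\<dots> \<le> 4 * E 0 * exp (\<eta> * of_int j) + D * exp (\<eta> * of_int j)"
      using near[of 0] D j unfolding near_def tame_def by (intro add_mono) auto
    finally show "dn j (X j) \<le> (D + 4 * E 0) * exp (\<eta> * of_int j)"
      by (simp add: algebra_simps)
  qed
  moreover have "fst (X j) 0 = fst (X (j - 1)) 1" if j: "j \<le> -1" for j
  proof (rule LIMSEQ_unique)
    have j': "j - 1 \<le> -1" using j by simp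
    show "(\<lambda>n. fst (u n j) 0) \<longlonglongrightarrow> fst (X j) 0"
      unfolding X[OF j] by (rule L(3)[OF j]) simp
    have "fst (u n j) 0 = fst (u n (j - 1)) 1" for n
      using u[of n] j by (simp add: BC_iff)
    then show "(\<lambda>n. fst (u n j) 0) \<longlonglongrightarrow> fst (X (j - 1)) 1"
      unfolding X[OF j'] using L(3)[OF j', of 1] by simp
  qed
  moreover have "X \<in> extensional {..-1}" by (simp add: X_def)
  ultimately have "X \<in> BC \<alpha> \<eta> (fst \<W>)" unfolding BC_iff by blast
  then show thesis using near that by blast
qed

lemma near_J:
  assumes q: "K * (1 + smooth_const A * \<kappa>) \<le> 1 / 4"
    and U: "U \<in> BC \<alpha> \<eta> (fst \<W>)" and V: "V \<in> BC \<alpha> \<eta> (fst \<W>)" and near: "near E U V" and E: "0 \<le> E"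
  shows "near (1 / 4 * E) (J U) (J V)"
proof -
  obtain D D' where t: "tame D U" "tame D' V" using U V by (auto simp: BC_iff)
  have le: "K * (1 + smooth_const A * \<kappa>) * E \<le> 1 / 4 * E"
    using q E by (rule mult_right_mono)
  show ?thesis
    unfolding near_def
  proof (intro allI impI)
    fix j :: int assume "j \<le> -1"
    then have "dn j (cdiff (J U j) (J V j)) \<le> K * (1 + smooth_const A * \<kappa>) * E * exp (\<eta> * of_int j)"
      using J_near[OF t near E] unfolding near_def by blast
    also have "\<dots> \<le> 1 / 4 * E * exp (\<eta> * of_int j)"
      using le by (rule mult_right_mono) simp
    finally show "dn j (cdiff (J U j) (J V j)) \<le> 1 / 4 * E * exp (\<eta> * of_int j)" .
  qed
qed

lemma near_exists:
  assumes "U \<in> BC \<alpha> \<eta> (fst \<W>)" "V \<in> BC \<alpha> \<eta> (fst \<W>)"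
  obtains D where "0 \<le> D" "near D U V"
proof -
  obtain a b where t: "tame a U" "tame b V" using assms by (auto simp: BC_iff)
  have "near (a + b) U V"
    unfolding near_def
  proof (intro allI impI)
    fix j :: int assume j: "j \<le> -1"
    have c: "controlled \<alpha> (path j) (U j)" "controlled \<alpha> (path j) (V j)"
      using t j unfolding tame_def by (auto intro: ctrl_controlled)
    have "dn j (cdiff (U j) (V j)) \<le> dn j (cdiff (U j) zero_path) + dn j (cdiff zero_path (V j))"
      by (rule dnorm_cdiff_triangle[OF c(1) ctrl_controlled[OF zero_path_ctrl] c(2) alpha_nonneg])
    also have "\<dots> = dn j (U j) + dn j (V j)"
      by (simp only: dnorm_cdiff_commute[of _ _ zero_path] dnorm_cdiff_zero_path[OF c(1) alpha_nonneg]
          dnorm_cdiff_zero_path[OF c(2) alpha_nonneg])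
    also have "\<dots> \<le> a * exp (\<eta> * of_int j) + b * exp (\<eta> * of_int j)"
      using t j unfolding tame_def by (intro add_mono) auto
    finally show "dn j (cdiff (U j) (V j)) \<le> (a + b) * exp (\<eta> * of_int j)"
      by (simp add: distrib_right)
  qed
  then show thesis
    using tame_nonneg[OF t(1)] tame_nonneg[OF t(2)] by (intro that[of "a + b"]) auto
qed

text \<open>Banach iteration from the zero sequence, with factor 1/4 in the weighted
  distance.\<close>

theorem unique_fixed_point:
  assumes q: "K * (1 + smooth_const A * \<kappa>) \<le> 1 / 4"
  shows "\<exists>!\<Gamma>. \<Gamma> \<in> BC \<alpha> \<eta> (fst \<W>) \<and> J \<Gamma> = \<Gamma>"
proof -
  define u where "u n = (J ^^ n) (\<lambda>j\<in>{..-1}. zero_path)" for n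
  have u_Suc: "u (Suc n) = J (u n)" for n by (simp add: u_def)
  have "tame 0 (\<lambda>j\<in>{..-1}. zero_path)"
  proof -
    have "dn j zero_path \<le> 0" for j
      using dnorm_cdiff_self[of \<alpha> "path j" "zero_path :: ('d, real^'n) cpath"]
      by (simp add: dnorm_cdiff_zero_path[OF ctrl_controlled[OF zero_path_ctrl] alpha_nonneg])
    then show ?thesis by (simp add: tame_def zero_path_ctrl)
  qed
  then have "u 0 \<in> BC \<alpha> \<eta> (fst \<W>)"
    by (auto simp: u_def BC_iff) (simp_all add: zero_path_def)
  then have u: "u n \<in> BC \<alpha> \<eta> (fst \<W>)" for n
    by (induction n) (simp_all add: u_Suc J_BC)
  have ut: "\<exists>D. tame D (u n)" for n
    using u[of n] by (simp add: BC_iff)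
  obtain D where D: "0 \<le> D" "near D (u 0) (u 1)"
    using near_exists[OF u u] by blast
  have step: "near (D * (1 / 4) ^ n) (u n) (u (Suc n))" for n
  proof (induction n)
    case (Suc n)
    from near_J[OF q u u Suc] D(1) show ?case by (simp add: u_Suc mult_ac)
  qed (use D in simp)
  \<comment> \<open>The constant 2 D dominates the geometric series of steps: the induction needs
    only 1 + 2/4 \<le> 2.\<close>
  have multi: "near (2 * D * (1 / 4) ^ n) (u n) (u (n + p))" for n p
  proof (induction p arbitrary: n)
    case 0
    then show ?case using near_self[of "u n"] D(1) by (auto simp: near_def intro: order_trans)
  next
    case (Suc p)
    obtain a b c where "tame a (u n)" "tame b (u (Suc n))" "tame c (u (Suc n + p))"
      using ut by metis
    from near_triangle[OF step Suc this]
    have "near (D * (1 / 4) ^ n + 2 * D * (1 / 4) ^ Suc n) (u n) (u (n + Suc p))" by simp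
    moreover have "D * (1 / 4) ^ n + 2 * D * (1 / 4) ^ Suc n \<le> 2 * D * (1 / 4) ^ n"
      using D(1) by (simp add: field_simps)
    ultimately show ?case
      unfolding near_def by (meson exp_ge_zero mult_right_mono order_trans)
  qed
  have lim: "(\<lambda>n. 2 * D * (1 / 4 :: real) ^ n) \<longlonglongrightarrow> 0"
    by (rule tendsto_mult_right_zero[OF LIMSEQ_power_zero]) simp
  obtain X where X: "X \<in> BC \<alpha> \<eta> (fst \<W>)"
    and nX: "\<And>n. near (4 * (2 * D * (1 / 4) ^ n)) (u n) X"
  proof (rule near_complete[OF u lim])
    show "near (2 * D * (1 / 4) ^ n) (u n) (u m)" if "n \<le> m" for n m
      using multi[of n "m - n"] that by simp
    fix X assume "X \<in> BC \<alpha> \<eta> (fst \<W>)" "\<And>n. near (4 * (2 * D * (1 / 4) ^ n)) (u n) X"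
    then show thesis by (rule that)
  qed
  \<comment> \<open>The shifted iterates u (Suc n) = J (u n) converge both to J X, by contraction,
    and to X.\<close>
  have "J X = X"
  proof (rule near_limit_unique)
    show "near (2 * D * (1 / 4) ^ n) (u (Suc n)) (J X)" for n
      using near_J[OF q u X nX[of n]] D(1) by (simp add: u_Suc mult.assoc)
    show "near (2 * D * (1 / 4) ^ n) (u (Suc n)) X" for n
      using nX[of "Suc n"] by (simp add: mult.assoc)
  qed (use u X J_BC in auto)
  moreover have "Y = X" if Y: "Y \<in> BC \<alpha> \<eta> (fst \<W>)" "J Y = Y" for Y
  proof -
    obtain D where D: "0 \<le> D" "near D X Y" using near_exists[OF X Y(1)] by blast
    have "near (D * (1 / 4) ^ n) X Y" for n
    proof (induction n)
      case (Suc n)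
      from near_J[OF q X Y(1) Suc] D(1) Y(2) \<open>J X = X\<close> show ?case by (simp add: mult_ac)
    qed (use D in simp)
    \<comment> \<open>The constant sequence X converges to X, and also to Y, since the distance of
      two fixed points shrinks under every application of \<open>J\<close>.\<close>
    then show "Y = X"
      using near_self[of X] X Y by (intro near_limit_unique[of D "\<lambda>_. X" Y 0 X]) auto
  qed
  ultimately show ?thesis using X by blast
qed

end

text \<open>The witness for C_S. It collects the cost of a smooth path and the norms of both
  projections, all determined by A alone; the summand 1 lets it dominate each product separately and
  stay positive.\<close>

definition stability_const :: "real^'n^'n \<Rightarrow> real" where
  "stability_const A = smooth_const A * (1 + norm (Pc A) + norm (Ps A))"

text \<open>The left-hand side, divided by K, consists of 1 and two geometric terms. The gap
  condition dominates them, since C_S exceeds \<open>smooth_const A\<close> times either projection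
  norm and the prefactors e^(\<beta> + \<eta>), e^(\<gamma> - \<eta>) are at least 1.\<close>

lemma (in lyapunov_perron) gap_contraction:
  assumes "gap_condition K (stability_const A) \<beta> \<gamma> \<eta> Mc Ms"
  shows "K * (1 + smooth_const A * \<kappa>) \<le> 1 / 4"
proof -
  let ?C = "stability_const A"
  have C: "smooth_const A * norm Pc' \<le> ?C" "smooth_const A * norm Ps' \<le> ?C"
    unfolding stability_const_def using smooth_const_pos[of A] by (auto intro!: mult_left_mono)
  have e: "1 \<le> exp (\<beta> + \<eta>)" "1 \<le> exp (\<gamma> - \<eta>)"
    using eta CS'(2) by auto
  have s: "(smooth_const A * norm Ps' * Ms * exp (- \<eta>) + 1) / (1 - rs) \<le> exp (\<beta> + \<eta>) * (?C * Ms * exp (- \<eta>) + 1) / (1 - rs)"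
  proof (rule divide_right_mono)
    have "smooth_const A * norm Ps' * (Ms * exp (- \<eta>)) \<le> ?C * (Ms * exp (- \<eta>))"
      using C(2) CS'(4) by (intro mult_right_mono) auto
    then have le: "smooth_const A * norm Ps' * Ms * exp (- \<eta>) + 1 \<le> ?C * Ms * exp (- \<eta>) + 1"
      by (simp add: mult.assoc)
    moreover have "0 \<le> smooth_const A * norm Ps' * Ms * exp (- \<eta>) + 1"
      using smooth_const_pos[of A] CS'(4) by (intro add_nonneg_nonneg mult_nonneg_nonneg) auto
    ultimately show "smooth_const A * norm Ps' * Ms * exp (- \<eta>) + 1 \<le> exp (\<beta> + \<eta>) * (?C * Ms * exp (- \<eta>) + 1)"
      using mult_right_mono[OF e(1), of "?C * Ms * exp (- \<eta>) + 1"] by auto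
  qed (use ratios in simp)
  have c: "smooth_const A * norm Pc' * Mc * exp (- \<eta>) / (1 - rc) \<le> exp (\<gamma> - \<eta>) * (?C * Mc * exp (- \<eta>) + 1) / (1 - rc)"
  proof (rule divide_right_mono)
    have "smooth_const A * norm Pc' * (Mc * exp (- \<eta>)) \<le> ?C * (Mc * exp (- \<eta>))"
      using C(1) CS'(3) by (intro mult_right_mono) auto
    then have le: "smooth_const A * norm Pc' * Mc * exp (- \<eta>) \<le> ?C * Mc * exp (- \<eta>) + 1"
      by (simp add: mult.assoc)
    moreover have "0 \<le> smooth_const A * norm Pc' * Mc * exp (- \<eta>)"
      using smooth_const_pos[of A] CS'(3) by (intro mult_nonneg_nonneg) auto
    ultimately show "smooth_const A * norm Pc' * Mc * exp (- \<eta>) \<le> exp (\<gamma> - \<eta>) * (?C * Mc * exp (- \<eta>) + 1)"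
      using mult_right_mono[OF e(2), of "?C * Mc * exp (- \<eta>) + 1"] by auto
  qed (use ratios in simp)
  \<comment> \<open>The contribution 1 of the block's own T is absorbed into the stable fraction,
    where it becomes the + 1 of the numerator.\<close>
  have "1 \<le> 1 / (1 - rs)" using ratios by simp
  then have "1 + smooth_const A * \<kappa> \<le> (smooth_const A * norm Ps' * Ms * exp (- \<eta>) + 1) / (1 - rs)
       + smooth_const A * norm Pc' * Mc * exp (- \<eta>) / (1 - rc)"
    by (simp add: \<kappa>_def add_divide_distrib distrib_left mult_ac)
  also have "\<dots> \<le> exp (\<beta> + \<eta>) * (?C * Ms * exp (- \<eta>) + 1) / (1 - rs)
       + exp (\<gamma> - \<eta>) * (?C * Mc * exp (- \<eta>) + 1) / (1 - rc)"
    using s c by (rule add_mono)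
  finally have "K * (1 + smooth_const A * \<kappa>) \<le> K * (exp (\<beta> + \<eta>) * (?C * Ms * exp (- \<eta>) + 1) / (1 - rs)
       + exp (\<gamma> - \<eta>) * (?C * Mc * exp (- \<eta>) + 1) / (1 - rc))"
    using K by (intro mult_left_mono) auto
  also have "\<dots> < 1 / 4"
    using assms unfolding gap_condition_def rs_def rc_def .
  finally show ?thesis by simp
qed

theorem theorem4p7:
  fixes A :: "real^'n^'n"
  shows "\<exists>C\<^sub>S>0.
    \<forall>(\<alpha>::real) (\<beta>::real) (\<gamma>::real) (\<eta>::real) (Mc::real) (Ms::real) (K::real) (C1::real) (C2::real)
      (F :: real^'n \<Rightarrow> real^'n) (G :: real^'n \<Rightarrow> (real^'d) \<Rightarrow>\<^sub>L (real^'n)) (f :: real \<Rightarrow> real)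
      (M :: (real \<Rightarrow> real^'d) measure) (lift :: (real \<Rightarrow> real^'d) \<Rightarrow> real \<Rightarrow> real \<Rightarrow> real^'d^'d).
      1/3 < \<alpha> \<and> \<alpha> \<le> 1/2 \<and> CS A \<beta> \<gamma> Mc Ms \<and> cond_F F \<and> cond_G G \<and>
      rough_noise \<alpha> M lift \<and> cutoff_fun f \<and>
      C1 > 0 \<and> C2 \<ge> 0 \<and> T_cut_estimate A F G f \<alpha> C1 C2 \<and>
      - \<beta> < \<eta> \<and> \<eta> < 0 \<and> K > 0 \<and> gap_condition K C\<^sub>S \<beta> \<gamma> \<eta> Mc Ms
      \<longrightarrow>
      (\<forall>\<xi>. \<forall>W\<in>space M.
         (\<forall>U\<in>BC \<alpha> \<eta> W. Jd A F G f \<alpha> (R_cut \<alpha> C1 C2 K) (W, lift W) U \<xi> \<in> BC \<alpha> \<eta> W) \<and>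
         (\<exists>!\<Gamma>. \<Gamma> \<in> BC \<alpha> \<eta> W \<and> Jd A F G f \<alpha> (R_cut \<alpha> C1 C2 K) (W, lift W) \<Gamma> \<xi> = \<Gamma>))"
proof (intro exI[of _ "stability_const A"] conjI allI impI ballI)
  show "0 < stability_const A"
    unfolding stability_const_def
    by (intro mult_pos_pos smooth_const_pos add_pos_nonneg) auto
next
  fix \<alpha> \<beta> \<gamma> \<eta> Mc Ms K C1 C2 :: real and F :: "real^'n \<Rightarrow> real^'n"
    and G :: "real^'n \<Rightarrow> (real^'d) \<Rightarrow>\<^sub>L (real^'n)" and f :: "real \<Rightarrow> real"
    and M :: "(real \<Rightarrow> real^'d) measure" and lift and \<xi> :: "real^'n" and W
  assume h: "1/3 < \<alpha> \<and> \<alpha> \<le> 1/2 \<and> CS A \<beta> \<gamma> Mc Ms \<and> cond_F F \<and> cond_G G \<and>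
      rough_noise \<alpha> M lift \<and> cutoff_fun f \<and>
      C1 > 0 \<and> C2 \<ge> 0 \<and> T_cut_estimate A F G f \<alpha> C1 C2 \<and>
      - \<beta> < \<eta> \<and> \<eta> < 0 \<and> K > 0 \<and> gap_condition K (stability_const A) \<beta> \<gamma> \<eta> Mc Ms"
    and W: "W \<in> space M"
  interpret lyapunov_perron A \<alpha> \<beta> \<gamma> \<eta> Mc Ms K C1 C2 F G f "(W, lift W)" \<xi>
    by unfold_locales (use h W in \<open>auto simp: rough_noise_def\<close>)
  have q: "K * (1 + smooth_const A * \<kappa>) \<le> 1 / 4"
    by (rule gap_contraction) (use h in simp)
  show "\<exists>!\<Gamma>. \<Gamma> \<in> BC \<alpha> \<eta> W \<and> Jd A F G f \<alpha> (R_cut \<alpha> C1 C2 K) (W, lift W) \<Gamma> \<xi> = \<Gamma>"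
    using unique_fixed_point[OF q] by (simp add: J_def)
  show "Jd A F G f \<alpha> (R_cut \<alpha> C1 C2 K) (W, lift W) U \<xi> \<in> BC \<alpha> \<eta> W" if "U \<in> BC \<alpha> \<eta> W" for U
    using J_BC[of U] that by (simp add: J_def)
qed

end
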